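(* Let $q>1$, let $u:M\to\mathbb{R}$ be a $C^2$-smooth function on a Riemannian manifold $M$ with $|\nabla u|>0$, and let $s\in u(M)$. Let $\psi_t$ be the local flow, near $u^{-1}(s)$, of the vector field $Y=\frac{\nabla u}{|\nabla u|^2}$. If, for some $\varepsilon>0$, the $1$-parameter family of functions $\left(\frac{\Delta_qu}{|\nabla u|}\circ\psi_t\right)J^0\psi_t$, $t\in(-\varepsilon,\varepsilon)$, is dominated by a function (independent of $t$) integrable on the level sets $u^{-1}(s+t)$, $t\in(-\varepsilon,\varepsilon)$, then $\nu^q_u$ is differentiable at $s$ and $$\left(\frac{d}{dt}\nu^q_u\right)(s)=\int_{u^{-1}(s)}\frac{\Delta_qu}{|\nabla u|}\,d\mu_{u^{-1}(s)}.$$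
   Context: $\Delta_qu=\mathrm{div}(|\nabla u|^{q-2}\nabla u)$. $\mu_{u^{-1}(t)}$ is the Riemannian measure on the level set $u^{-1}(t)$. $\nu^q_u(t)=\int_{u^{-1}(t)}|\nabla u|^{q-1}\,d\mu_{u^{-1}(t)}$ for $t\in u(M)$, assumed finite. Since $u\circ\psi_t=u+t$, $\psi_t$ maps level sets of $u$ to level sets; it is a standing convention that for $|t|$ small $\psi_t$ carries $u^{-1}(s)$ onto $u^{-1}(s+t)$. $J^0\psi_t$ is the Jacobian of $\psi_t$ restricted to level sets, in particular of $\psi_t:u^{-1}(s)\to u^{-1}(s+t)$. *)

theory Defs
  imports "HOL-Analysis.Analysis"
begin

section \<open>Smooth manifolds\<close>

text \<open>Class $C^k$ on an open set \<open>S\<close>.\<close>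

fun Ck_on :: "nat \<Rightarrow> 'a::real_normed_vector set \<Rightarrow> ('a \<Rightarrow> 'b::real_normed_vector) \<Rightarrow> bool" where
  "Ck_on 0 S f \<longleftrightarrow> continuous_on S f"
| "Ck_on (Suc k) S f \<longleftrightarrow>
     f differentiable_on S \<and> (\<forall>v. Ck_on k S (\<lambda>x. frechet_derivative f (at x) v))"

text \<open>A chart is a pair of its domain and its coordinate map; only the values of the coordinate
  map on the domain matter.\<close>

type_synonym ('m, 'n) chart = "'m set \<times> ('m \<Rightarrow> real ^ 'n)"

definition cinv :: "('m, 'n) chart \<Rightarrow> real ^ 'n \<Rightarrow> 'm" where
  "cinv c = inv_into (fst c) (snd c)"

definition is_chart :: "('m::topological_space, 'n::finite) chart \<Rightarrow> bool" where
  "is_chart c \<longleftrightarrow> open (fst c) \<and> open (snd c ` fst c) \<and>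
     homeomorphism (fst c) (snd c ` fst c) (snd c) (cinv c)"

definition Ck_compatible :: "nat \<Rightarrow> ('m, 'n::finite) chart \<Rightarrow> ('m, 'n) chart \<Rightarrow> bool" where
  "Ck_compatible k c d \<longleftrightarrow>
     Ck_on k (snd c ` (fst c \<inter> fst d)) (snd d \<circ> cinv c) \<and>
     Ck_on k (snd d ` (fst c \<inter> fst d)) (snd c \<circ> cinv d)"

definition smooth_atlas :: "('m::topological_space, 'n::finite) chart set \<Rightarrow> bool" where
  "smooth_atlas A \<longleftrightarrow> (\<forall>c\<in>A. is_chart c) \<and> (\<forall>c\<in>A. \<forall>d\<in>A. \<forall>k. Ck_compatible k c d)"

text \<open>The manifold itself is the union of the chart domains, an open subset of the ambient type
  (which is taken to be Hausdorff and second countable in the theorem).\<close>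

definition carrier :: "('m, 'n) chart set \<Rightarrow> 'm set" where
  "carrier A = (\<Union>c\<in>A. fst c)"

text \<open>Tangent vectors at \<open>x\<close> are represented by their components in a chart around \<open>x\<close>.
  Chart-independent quantities at \<open>x\<close> are evaluated in the following arbitrarily chosen chart.\<close>

definition chart_at :: "('m, 'n) chart set \<Rightarrow> 'm \<Rightarrow> ('m, 'n) chart" where
  "chart_at A x = (SOME c. c \<in> A \<and> x \<in> fst c)"

definition Ck_function :: "nat \<Rightarrow> ('m, 'n::finite) chart set \<Rightarrow> ('m \<Rightarrow> real) \<Rightarrow> bool" where
  "Ck_function k A u \<longleftrightarrow> (\<forall>c\<in>A. Ck_on k (snd c ` fst c) (u \<circ> cinv c))"


section \<open>Riemannian metrics, gradient, divergence\<close>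

text \<open>A Riemannian metric is given by its component matrices \<open>g c x\<close> in the charts \<open>c\<close> of the atlas,
  which transform as a covariant 2-tensor.\<close>

type_synonym ('m, 'n) metric = "('m, 'n) chart \<Rightarrow> 'm \<Rightarrow> real ^ 'n ^ 'n"

definition ginner :: "('m, 'n::finite) metric \<Rightarrow> ('m, 'n) chart \<Rightarrow> 'm \<Rightarrow> real ^ 'n \<Rightarrow> real ^ 'n \<Rightarrow> real" where
  "ginner g c x v w = v \<bullet> (g c x *v w)"

definition gnorm :: "('m, 'n::finite) metric \<Rightarrow> ('m, 'n) chart \<Rightarrow> 'm \<Rightarrow> real ^ 'n \<Rightarrow> real" where
  "gnorm g c x v = sqrt (ginner g c x v v)"

definition riemannian_metric :: "('m, 'n::finite) chart set \<Rightarrow> ('m, 'n) metric \<Rightarrow> bool" where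
  "riemannian_metric A g \<longleftrightarrow>
     (\<forall>c\<in>A. \<forall>i j k. Ck_on k (snd c ` fst c) (\<lambda>y. g c (cinv c y) $ i $ j)) \<and>
     (\<forall>c\<in>A. \<forall>x\<in>fst c. transpose (g c x) = g c x \<and> (\<forall>v. v \<noteq> 0 \<longrightarrow> ginner g c x v v > 0)) \<and>
     (\<forall>c\<in>A. \<forall>d\<in>A. \<forall>x\<in>fst c \<inter> fst d. \<forall>v w.
        ginner g c x v w =
        ginner g d x (frechet_derivative (snd d \<circ> cinv c) (at (snd c x)) v)
                     (frechet_derivative (snd d \<circ> cinv c) (at (snd c x)) w))"

definition riemannian_manifold :: "('m::topological_space, 'n::finite) chart set \<Rightarrow> ('m, 'n) metric \<Rightarrow> bool" where
  "riemannian_manifold A g \<longleftrightarrow> smooth_atlas A \<and> riemannian_metric A g"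

text \<open>A vector field is given by its component vectors in the charts of the atlas.\<close>

type_synonym ('m, 'n) vfield = "('m, 'n) chart \<Rightarrow> 'm \<Rightarrow> real ^ 'n"

definition differential :: "('m \<Rightarrow> real) \<Rightarrow> ('m, 'n::finite) chart \<Rightarrow> 'm \<Rightarrow> real ^ 'n \<Rightarrow> real" where
  "differential u c x = frechet_derivative (u \<circ> cinv c) (at (snd c x))"

definition grad :: "('m, 'n::finite) metric \<Rightarrow> ('m \<Rightarrow> real) \<Rightarrow> ('m, 'n) vfield" where
  "grad g u c x = (THE v. \<forall>w. ginner g c x v w = differential u c x w)"

definition grad_norm :: "('m, 'n::finite) chart set \<Rightarrow> ('m, 'n) metric \<Rightarrow> ('m \<Rightarrow> real) \<Rightarrow> 'm \<Rightarrow> real" where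
  "grad_norm A g u x = gnorm g (chart_at A x) x (grad g u (chart_at A x) x)"

text \<open>$\mathrm{div} X = \frac{1}{\sqrt{\det g}} \sum_i \partial_i (\sqrt{\det g}\, X^i)$\<close>

definition divergence :: "('m, 'n::finite) chart set \<Rightarrow> ('m, 'n) metric \<Rightarrow> ('m, 'n) vfield \<Rightarrow> 'm \<Rightarrow> real" where
  "divergence A g X x = (let c = chart_at A x in
     (\<Sum>i\<in>UNIV. frechet_derivative (\<lambda>y. sqrt (det (g c (cinv c y))) * X c (cinv c y) $ i)
                  (at (snd c x)) (axis i 1)) / sqrt (det (g c x)))"

definition q_laplacian ::
  "('m, 'n::finite) chart set \<Rightarrow> ('m, 'n) metric \<Rightarrow> real \<Rightarrow> ('m \<Rightarrow> real) \<Rightarrow> 'm \<Rightarrow> real" where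
  "q_laplacian A g q u =
     divergence A g (\<lambda>c x. (gnorm g c x (grad g u c x) powr (q - 2)) *\<^sub>R grad g u c x)"


section \<open>Riemannian measure of a hypersurface\<close>

definition level_set :: "('m, 'n) chart set \<Rightarrow> ('m \<Rightarrow> real) \<Rightarrow> real \<Rightarrow> 'm set" where
  "level_set A u t = {x \<in> carrier A. u x = t}"

text \<open>An adapted chart of a hypersurface \<open>S\<close>: the coordinates with index \<open>i \<noteq> k\<close> are local
  coordinates of \<open>S\<close>. Level sets of $C^2$ functions are only $C^2$ hypersurfaces, so adapted
  charts are merely $C^2$-compatible with the atlas.\<close>

definition slice_chart ::
  "('m::topological_space, 'n::finite) chart set \<Rightarrow> 'm set \<Rightarrow> 'n \<Rightarrow> ('m, 'n) chart \<Rightarrow> bool" where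
  "slice_chart A S k c \<longleftrightarrow> is_chart c \<and> fst c \<subseteq> carrier A \<and> (\<forall>d\<in>A. Ck_compatible 2 c d) \<and>
     (\<forall>x\<in>fst c. x \<in> S \<longleftrightarrow> snd c x $ k = 0)"

definition slice_point :: "'n::finite \<Rightarrow> ('n \<Rightarrow> real) \<Rightarrow> real ^ 'n" where
  "slice_point k z = (\<chi> i. if i = k then 0 else z i)"

text \<open>The determinant of \<open>m\<close> with row and column \<open>k\<close> deleted (it is 1 if \<open>m\<close> is 1 by 1).\<close>

definition minor_det :: "'n::finite \<Rightarrow> real ^ 'n ^ 'n \<Rightarrow> real" where
  "minor_det k m = det (\<chi> i j. if i = k \<or> j = k then of_bool (i = j) else m $ i $ j)"

definition gram :: "('m, 'n::finite) metric \<Rightarrow> ('m, 'n) chart \<Rightarrow> 'm \<Rightarrow> ('n \<Rightarrow> real ^ 'n) \<Rightarrow> real ^ 'n ^ 'n" where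
  "gram g c x e = (\<chi> i j. ginner g c x (e i) (e j))"

text \<open>The square root of the determinant of the metric induced on \<open>S\<close>, in the coordinates of a
  slice chart \<open>c\<close>; the coordinate vector fields of \<open>c\<close> are expressed in a chart of the atlas.\<close>

definition slice_density ::
  "('m, 'n::finite) chart set \<Rightarrow> ('m, 'n) metric \<Rightarrow> 'n \<Rightarrow> ('m, 'n) chart \<Rightarrow> 'm \<Rightarrow> real" where
  "slice_density A g k c x = (let d = chart_at A x in
     sqrt (minor_det k
       (gram g d x (\<lambda>i. frechet_derivative (snd d \<circ> cinv c) (at (snd c x)) (axis i 1)))))"

text \<open>The product over \<open>UNIV - {k}\<close> is Lebesgue measure in dimension $n - 1$; for $n = 1$ it is the
  unit mass on a point, so that the Riemannian measure of a 0-dimensional level set is the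
  counting measure.\<close>

definition is_hypersurface_measure ::
  "('m::topological_space, 'n::finite) chart set \<Rightarrow> ('m, 'n) metric \<Rightarrow> 'm set \<Rightarrow> 'm measure \<Rightarrow> bool" where
  "is_hypersurface_measure A g S \<mu> \<longleftrightarrow>
     sets \<mu> = sets (restrict_space borel S) \<and>
     (\<forall>k c E. slice_chart A S k c \<longrightarrow> E \<in> sets borel \<longrightarrow> E \<subseteq> S \<inter> fst c \<longrightarrow>
        emeasure \<mu> E =
          (\<integral>\<^sup>+ z. (if slice_point k z \<in> snd c ` E
                  then ennreal (slice_density A g k c (cinv c (slice_point k z))) else 0)
             \<partial>(Pi\<^sub>M (UNIV - {k}) (\<lambda>_. lborel))))"

definition hypersurface_measure ::
  "('m::topological_space, 'n::finite) chart set \<Rightarrow> ('m, 'n) metric \<Rightarrow> 'm set \<Rightarrow> 'm measure" where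
  "hypersurface_measure A g S = (THE \<mu>. is_hypersurface_measure A g S \<mu>)"

abbreviation level_measure ::
  "('m::topological_space, 'n::finite) chart set \<Rightarrow> ('m, 'n) metric \<Rightarrow> ('m \<Rightarrow> real) \<Rightarrow> real \<Rightarrow> 'm measure" where
  "level_measure A g u t \<equiv> hypersurface_measure A g (level_set A u t)"

definition nu ::
  "('m::topological_space, 'n::finite) chart set \<Rightarrow> ('m, 'n) metric \<Rightarrow> real \<Rightarrow> ('m \<Rightarrow> real) \<Rightarrow> real \<Rightarrow> real" where
  "nu A g q u t = (\<integral>x. grad_norm A g u x powr (q - 1) \<partial>level_measure A g u t)"


section \<open>Local flow and Jacobian on level sets\<close>

definition Y_field :: "('m, 'n::finite) metric \<Rightarrow> ('m \<Rightarrow> real) \<Rightarrow> ('m, 'n) vfield" where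
  "Y_field g u c x = (1 / (gnorm g c x (grad g u c x))\<^sup>2) *\<^sub>R grad g u c x"

text \<open>A local flow of a $C^1$ vector field on \<open>(-\<delta>, \<delta>) \<times> N\<close>: a $C^1$ map whose orbits are
  integral curves. For \<open>t\<close> outside \<open>(-\<delta>, \<delta>)\<close> or \<open>x\<close> outside \<open>N\<close> the value \<open>\<psi> t x\<close> is irrelevant.\<close>

definition local_flow ::
  "('m::topological_space, 'n::finite) chart set \<Rightarrow> ('m, 'n) vfield \<Rightarrow> real \<Rightarrow> 'm set \<Rightarrow>
     (real \<Rightarrow> 'm \<Rightarrow> 'm) \<Rightarrow> bool" where
  "local_flow A X \<delta> N \<psi> \<longleftrightarrow>
     \<delta> > 0 \<and> open N \<and> N \<subseteq> carrier A \<and>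
     (\<forall>t\<in>{-\<delta><..<\<delta>}. \<forall>x\<in>N. \<psi> t x \<in> carrier A) \<and>
     continuous_on ({-\<delta><..<\<delta>} \<times> N) (\<lambda>(t, x). \<psi> t x) \<and>
     (\<forall>c\<in>A. \<forall>d\<in>A. Ck_on 1
        {(t, y). t \<in> {-\<delta><..<\<delta>} \<and> y \<in> snd c ` (N \<inter> fst c) \<and> \<psi> t (cinv c y) \<in> fst d}
        (\<lambda>(t, y). snd d (\<psi> t (cinv c y)))) \<and>
     (\<forall>x\<in>N. \<psi> 0 x = x) \<and>
     (\<forall>x\<in>N. \<forall>t\<in>{-\<delta><..<\<delta>}. \<forall>c\<in>A. \<psi> t x \<in> fst c \<longrightarrow>
        ((\<lambda>\<tau>. snd c (\<psi> \<tau> x)) has_vector_derivative X c (\<psi> t x)) (at t))"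

text \<open>The vectors \<open>e i\<close>, \<open>i \<noteq> k\<close>, form an orthonormal basis of the tangent space at \<open>x\<close> of the
  level set of \<open>u\<close> through \<open>x\<close>, which is the kernel of the differential of \<open>u\<close>.\<close>

definition level_frame ::
  "('m, 'n::finite) metric \<Rightarrow> ('m \<Rightarrow> real) \<Rightarrow> ('m, 'n) chart \<Rightarrow> 'm \<Rightarrow> 'n \<Rightarrow> ('n \<Rightarrow> real ^ 'n) \<Rightarrow> bool" where
  "level_frame g u c x k e \<longleftrightarrow>
     (\<forall>i. i \<noteq> k \<longrightarrow> differential u c x (e i) = 0) \<and>
     (\<forall>i j. i \<noteq> k \<longrightarrow> j \<noteq> k \<longrightarrow> ginner g c x (e i) (e j) = of_bool (i = j))"

text \<open>Jacobian at \<open>x\<close> of the restriction of \<open>f\<close> to the level set of \<open>u\<close> through \<open>x\<close>: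
  $\sqrt{\det \langle df(e_i), df(e_j)\rangle}$ for an orthonormal basis $(e_i)$ of its tangent space;
  the choice of the basis is immaterial.\<close>

definition level_jacobian ::
  "('m, 'n::finite) chart set \<Rightarrow> ('m, 'n) metric \<Rightarrow> ('m \<Rightarrow> real) \<Rightarrow> ('m \<Rightarrow> 'm) \<Rightarrow> 'm \<Rightarrow> real" where
  "level_jacobian A g u f x =
     (let c = chart_at A x; d = chart_at A (f x);
          L = frechet_derivative (snd d \<circ> f \<circ> cinv c) (at (snd c x));
          (k, e) = (SOME (k, e). level_frame g u c x k e)
      in sqrt (minor_det k (gram g d (f x) (\<lambda>i. L (e i)))))"

end

theory Submission
  imports Defs
begin

text \<open>
  Write $Y = \nabla u / |\nabla u|^2$. Since $Y$ is orthogonal to the level sets, the Jacobian of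
  $\psi_t$ along them can be read off from the full determinant of a frame in which $Y$ completes
  the tangent vectors of the level set: in a chart,
  $J^0\psi_t = |\nabla u| \sqrt{\det G}\, |\det V(t)|$, evaluated at $\psi_t(x)$, where the columns
  of $V$ are $Y$ and the images of an orthonormal frame at $x$. The columns solve the variational
  equation $V' = DY\, V$, so Liouville's formula gives
  $\frac{d}{dt}\bigl(|\nabla u|^{q-1}(\psi_t) J^0\psi_t\bigr) = \frac{\Delta_q u}{|\nabla u|}(\psi_t)\, J^0\psi_t$,
  because $\Delta_q u = \mathrm{div}(|\nabla u|^q Y)$.
  As $\psi_t$ is injective by uniqueness of integral curves, $\nu(s + t)$ is the integral of
  $|\nabla u|^{q-1}(\psi_t) J^0\psi_t$ over the level set of $s$, and the mean value theorem and
  dominated convergence allow differentiation under the integral.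

  The same determinant identity, applied to the identity map, shows that the Riemannian
  measures in different slice charts agree, so that the measure of a level set exists.
\<close>

section \<open>Functions of class $C^k$\<close>

text \<open>Two obstacles shape the development. First, slices of dimension n - 1 are represented
  inside \<open>real ^ 'n\<close> by striking out an index \<open>k\<close>, and \<open>k\<close>
  changes from chart to chart, so that the minors belonging to different charts do not multiply like
  matrices. Completing a slice by a transversal direction, \<open>Y\<close> for tangent vectors and
  a unit interval for sets, turns minors and slice integrals into determinants and integrals in full
  dimension. Second, regularity is scarce. As \<open>u\<close> is only C^2, the field
  \<open>Y\<close> is only C^1, and no more than C^1 is assumed of the flow; the variational
  equation therefore comes from an integral identity and not from the symmetry of second
  derivatives. The frame in \<open>level_jacobian\<close> is picked by \<open>SOME\<close> and need
  not vary continuously, so a frame-free determinant formula has to precede every continuity or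
  measurability claim. Measurability of the limit integrand in turn is inherited from the difference
  quotients that converge to it.\<close>

lemma frechet_derivative_cong_open:
  assumes "open S" "x \<in> S" "\<And>y. y \<in> S \<Longrightarrow> f y = g y"
  shows "frechet_derivative f (at x) = frechet_derivative g (at x)"
proof -
  have "(f has_derivative D) (at x) \<longleftrightarrow> (g has_derivative D) (at x)" for D
    using has_derivative_transform_within_open[of _ _ x UNIV S] assms by metis
  then show ?thesis unfolding frechet_derivative_def by presburger
qed

lemma differentiable_on_cong_open:
  assumes "open S" "\<And>y. y \<in> S \<Longrightarrow> f y = g y" "f differentiable_on S"
  shows "g differentiable_on S"
  using assms has_derivative_transform_within_open[of f _ _ UNIV S g]
  unfolding differentiable_on_eq_differentiable_at[OF assms(1)] differentiable_def by metis

lemma Ck_on_cong: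
  assumes "open S" "\<And>y. y \<in> S \<Longrightarrow> f y = g y" "Ck_on k S f"
  shows "Ck_on k S g"
  using assms(2,3)
proof (induction k arbitrary: f g)
  case 0
  then show ?case using continuous_on_cong by (simp cong: continuous_on_cong)
next
  case (Suc k)
  have "Ck_on k S (\<lambda>x. frechet_derivative g (at x) v)" for v
    by (rule Suc.IH[of "\<lambda>x. frechet_derivative f (at x) v"])
      (use Suc.prems frechet_derivative_cong_open[OF assms(1), of _ f g] in auto)
  with Suc.prems differentiable_on_cong_open[OF assms(1), of f g] show ?case by auto
qed

lemma Ck_on_subset: "Ck_on k S f \<Longrightarrow> T \<subseteq> S \<Longrightarrow> Ck_on k T f"
proof (induction k arbitrary: f)
  case 0
  then show ?case by (auto intro: continuous_on_subset)
next
  case (Suc k)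
  then show ?case by (auto intro: differentiable_on_subset)
qed

lemma Ck_on_has_derivative:
  assumes "Ck_on (Suc k) S f" "open S" "x \<in> S"
  shows "(f has_derivative frechet_derivative f (at x)) (at x)"
  using assms differentiable_on_eq_differentiable_at frechet_derivative_works by (metis Ck_on.simps(2))

lemma Ck_on_imp_continuous_on: "open S \<Longrightarrow> Ck_on k S f \<Longrightarrow> continuous_on S f"
  by (cases k) (auto simp: differentiable_imp_continuous_on)

lemma Ck_on_SucD: "open S \<Longrightarrow> Ck_on (Suc k) S f \<Longrightarrow> Ck_on k S f"
proof (induction k arbitrary: f)
  case 0
  then show ?case by (simp add: differentiable_imp_continuous_on)
next
  case (Suc k)
  then show ?case by (metis Ck_on.simps(2))
qed

lemma Ck_on_mono:
  assumes "open S" "Ck_on k S f" "j \<le> k"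
  shows "Ck_on j S f"
proof -
  have "Ck_on (j + m) S f \<Longrightarrow> Ck_on j S f" for m
    by (induction m) (use assms(1) Ck_on_SucD in auto)
  with assms show ?thesis by (metis le_add_diff_inverse)
qed

text \<open>Any family of derivatives may be supplied, because on an open set it coincides with
  \<open>frechet_derivative\<close>; the closure rules below rest on this form.\<close>

lemma Ck_on_SucI:
  assumes "open S" "\<And>x. x \<in> S \<Longrightarrow> (f has_derivative f' x) (at x)" "\<And>v. Ck_on k S (\<lambda>x. f' x v)"
  shows "Ck_on (Suc k) S f"
proof -
  have "f differentiable_on S"
    using assms(1,2) differentiable_on_eq_differentiable_at[OF assms(1)] by (auto simp: differentiable_def)
  moreover have "Ck_on k S (\<lambda>x. frechet_derivative f (at x) v)" for v
    by (rule Ck_on_cong[OF assms(1) _ assms(3)[of v]]) (use assms(2) frechet_derivative_at in metis)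
  ultimately show ?thesis by simp
qed

text \<open>Serves maps that factor through charts of the atlas only near each point, as in
  \<open>rep_Ck\<close>. The derivatives in \<open>Ck_on\<close> are taken \<open>at x\<close>,
  hence insensitive to the surrounding set.\<close>

lemma Ck_on_local:
  assumes "open S" "\<And>x. x \<in> S \<Longrightarrow> \<exists>T. open T \<and> x \<in> T \<and> Ck_on k T f"
  shows "Ck_on k S f"
  using assms(2)
proof (induction k arbitrary: f)
  case 0
  then show ?case
    by (metis Ck_on.simps(1) assms(1) continuous_on_eq_continuous_at)
next
  case (Suc k)
  have "f differentiable at x" if "x \<in> S" for x
    using Suc.prems[OF that] differentiable_on_eq_differentiable_at by (metis Ck_on.simps(2))
  moreover have "Ck_on k S (\<lambda>x. frechet_derivative f (at x) v)" for v
    proof (rule Suc.IH)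
    fix x assume "x \<in> S"
    then obtain T where "open T" "x \<in> T" "Ck_on (Suc k) T f" using Suc.prems by blast
    then show "\<exists>T. open T \<and> x \<in> T \<and> Ck_on k T (\<lambda>x. frechet_derivative f (at x) v)" by auto
  qed
  ultimately show ?case using differentiable_on_eq_differentiable_at[OF assms(1)] by auto
qed

section \<open>Closure of class C^k under algebraic operations and composition\<close>

lemma Ck_on_const: "open S \<Longrightarrow> Ck_on k S (\<lambda>x. c)"
proof (induction k arbitrary: c)
  case (Suc k)
  show ?case by (rule Ck_on_SucI[where f' = "\<lambda>x v. 0"]) (use Suc in auto)
qed auto

lemma Ck_on_bounded_linear:
  assumes "open S" "bounded_linear L"
  shows "Ck_on k S L"
proof (cases k)
  case 0
  then show ?thesis using assms by (simp add: linear_continuous_on)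
next
  case (Suc k)
  show ?thesis unfolding Suc
    by (rule Ck_on_SucI[where f' = "\<lambda>x. L"])
      (use assms bounded_linear_imp_has_derivative Ck_on_const in auto)
qed

lemma Ck_on_linear_comp:
  assumes "open S" "bounded_linear L"
  shows "Ck_on k S f \<Longrightarrow> Ck_on k S (\<lambda>x. L (f x))"
proof (induction k arbitrary: f)
  case 0
  then show ?case using assms by (simp add: bounded_linear.continuous_on)
next
  case (Suc k)
  show ?case
    by (rule Ck_on_SucI[where f' = "\<lambda>x v. L (frechet_derivative f (at x) v)"])
      (use assms Suc Ck_on_has_derivative[OF Suc.prems] in \<open>auto intro: bounded_linear.has_derivative\<close>)
qed

lemma Ck_on_add:
  assumes "open S"
  shows "Ck_on k S f \<Longrightarrow> Ck_on k S g \<Longrightarrow> Ck_on k S (\<lambda>x. f x + g x)"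
proof (induction k arbitrary: f g)
  case 0
  then show ?case by (simp add: continuous_on_add)
next
  case (Suc k)
  show ?case
    by (rule Ck_on_SucI[where f' = "\<lambda>x v. frechet_derivative f (at x) v + frechet_derivative g (at x) v"])
      (use assms Suc Ck_on_has_derivative[OF Suc.prems(1)] Ck_on_has_derivative[OF Suc.prems(2)]
        in \<open>auto intro: has_derivative_add\<close>)
qed

lemma Ck_on_sum:
  assumes "open S" "\<And>i. i \<in> I \<Longrightarrow> Ck_on k S (f i)"
  shows "Ck_on k S (\<lambda>x. \<Sum>i\<in>I. f i x)"
  using assms(2)
  by (induction I rule: infinite_finite_induct) (auto simp: Ck_on_const Ck_on_add assms(1))

lemma Ck_on_bilinear:
  assumes "open S" "bounded_bilinear B"
  shows "Ck_on k S f \<Longrightarrow> Ck_on k S g \<Longrightarrow> Ck_on k S (\<lambda>x. B (f x) (g x))"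
proof (induction k arbitrary: f g)
  case 0
  then show ?case using assms by (simp add: bounded_bilinear.continuous_on)
next
  case (Suc k)
  show ?case
  proof (rule Ck_on_SucI[where f' = "\<lambda>x v. B (f x) (frechet_derivative g (at x) v) + B (frechet_derivative f (at x) v) (g x)"])
    show "((\<lambda>x. B (f x) (g x)) has_derivative (\<lambda>v. B (f x) (frechet_derivative g (at x) v) + B (frechet_derivative f (at x) v) (g x))) (at x)"
      if "x \<in> S" for x
      using that Suc.prems assms by (intro bounded_bilinear.FDERIV Ck_on_has_derivative)
    show "Ck_on k S (\<lambda>x. B (f x) (frechet_derivative g (at x) v) + B (frechet_derivative f (at x) v) (g x))" for v
      by (rule Ck_on_add[OF assms(1)]; rule Suc.IH) (use Suc.prems assms Ck_on_SucD in auto)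
  qed (fact assms)
qed

lemmas Ck_on_mult = Ck_on_bilinear[OF _ bounded_bilinear_mult]
lemmas Ck_on_scaleR = Ck_on_bilinear[OF _ bounded_bilinear_scaleR]
lemmas Ck_on_inner = Ck_on_bilinear[OF _ bounded_bilinear_inner]

lemma Ck_on_prod:
  fixes f :: "'i \<Rightarrow> 'a::real_normed_vector \<Rightarrow> real"
  assumes "open S" "\<And>i. i \<in> I \<Longrightarrow> Ck_on k S (f i)"
  shows "Ck_on k S (\<lambda>x. \<Prod>i\<in>I. f i x)"
  using assms(2)
  by (induction I rule: infinite_finite_induct) (auto simp: Ck_on_const Ck_on_mult assms(1))

lemma Ck_on_minus: "open S \<Longrightarrow> Ck_on k S f \<Longrightarrow> Ck_on k S (\<lambda>x. - f x)"
  by (rule Ck_on_linear_comp) (auto intro: bounded_linear_minus bounded_linear_ident)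

lemma Ck_on_diff: "open S \<Longrightarrow> Ck_on k S f \<Longrightarrow> Ck_on k S g \<Longrightarrow> Ck_on k S (\<lambda>x. f x - g x)"
  using Ck_on_add[of S k f "\<lambda>x. - g x"] Ck_on_minus by auto

lemma Ck_on_inverse:
  fixes f :: "'a::real_normed_vector \<Rightarrow> real"
  assumes "open S" "\<And>x. x \<in> S \<Longrightarrow> f x \<noteq> 0"
  shows "Ck_on k S f \<Longrightarrow> Ck_on k S (\<lambda>x. inverse (f x))"
proof (induction k)
  case 0
  then show ?case using assms by (simp add: continuous_on_inverse)
next
  case (Suc k)
  have k: "Ck_on k S (\<lambda>x. inverse (f x))"
    using Suc assms Ck_on_SucD by blast
  show ?case
  proof (rule Ck_on_SucI[where f' = "\<lambda>x v. - (inverse (f x) * frechet_derivative f (at x) v * inverse (f x))"])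
    show "((\<lambda>x. inverse (f x)) has_derivative (\<lambda>v. - (inverse (f x) * frechet_derivative f (at x) v * inverse (f x)))) (at x)"
      if "x \<in> S" for x
      using that Suc.prems assms by (intro Deriv.has_derivative_inverse Ck_on_has_derivative)
    show "Ck_on k S (\<lambda>x. - (inverse (f x) * frechet_derivative f (at x) v * inverse (f x)))" for v
      by (intro Ck_on_minus Ck_on_mult assms k) (use Suc.prems in auto)
  qed (fact assms)
qed

lemma Ck_on_divide:
  fixes f g :: "'a::real_normed_vector \<Rightarrow> real"
  assumes "open S" "\<And>x. x \<in> S \<Longrightarrow> g x \<noteq> 0" "Ck_on k S f" "Ck_on k S g"
  shows "Ck_on k S (\<lambda>x. f x / g x)"
  unfolding divide_inverse by (intro Ck_on_mult Ck_on_inverse assms)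

lemma Ck_on_vec_iff:
  fixes f :: "'a::real_normed_vector \<Rightarrow> real ^ 'n"
  assumes "open S"
  shows "Ck_on k S f \<longleftrightarrow> (\<forall>i. Ck_on k S (\<lambda>x. f x $ i))"
proof
  assume "Ck_on k S f"
  then show "\<forall>i. Ck_on k S (\<lambda>x. f x $ i)"
    using Ck_on_linear_comp[OF assms bounded_linear_vec_nth] by blast
next
  assume *: "\<forall>i. Ck_on k S (\<lambda>x. f x $ i)"
  have "Ck_on k S (\<lambda>x. \<Sum>i\<in>UNIV. f x $ i *\<^sub>R axis i 1)"
    by (intro Ck_on_sum Ck_on_scaleR Ck_on_const assms *[rule_format])
  then show "Ck_on k S f"
    by (rule Ck_on_cong[OF assms, rotated])
      (simp add: vec_eq_iff axis_def if_distrib cong: if_cong)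
qed

lemma Ck_on_det:
  fixes a :: "'a::real_normed_vector \<Rightarrow> real ^ 'n ^ 'n"
  assumes "open S" "\<And>i j. Ck_on k S (\<lambda>x. a x $ i $ j)"
  shows "Ck_on k S (\<lambda>x. det (a x))"
  unfolding det_def by (intro Ck_on_sum Ck_on_mult Ck_on_const Ck_on_prod assms)

lemma continuous_on_det:
  fixes a :: "'a::topological_space \<Rightarrow> real ^ 'n ^ 'n"
  assumes "\<And>i j. continuous_on S (\<lambda>x. a x $ i $ j)"
  shows "continuous_on S (\<lambda>x. det (a x))"
  unfolding det_def by (intro continuous_intros assms)

lemma Ck_on_compose:
  fixes g :: "'a::real_normed_vector \<Rightarrow> 'b::euclidean_space"
  assumes "open S" "open T" "g ` S \<subseteq> T"
  shows "Ck_on k S g \<Longrightarrow> Ck_on k T f \<Longrightarrow> Ck_on k S (f \<circ> g)"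
proof (induction k arbitrary: f)
  case 0
  then show ?case using assms by (metis Ck_on.simps(1) continuous_on_compose continuous_on_subset)
next
  case (Suc k)
  define f' where "f' x = frechet_derivative f (at x)" for x
  define g' where "g' x = frechet_derivative g (at x)" for x
  have f': "(f has_derivative f' (g x)) (at (g x))" and g': "(g has_derivative g' x) (at x)" if "x \<in> S" for x
  proof -
    have "g x \<in> T" using that assms by blast
    then show "(f has_derivative f' (g x)) (at (g x))" "(g has_derivative g' x) (at x)"
      unfolding f'_def g'_def using that Suc.prems assms by (blast intro: Ck_on_has_derivative)+
  qed
  \<comment> \<open>The chain rule gives \<open>f' (g x) (g' x v)\<close>, where both the point and
    the direction move. Expanding the direction in \<open>Basis\<close> leaves directional
    derivatives along fixed vectors, which is all that \<open>Ck_on\<close> speaks of.\<close>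
  show ?case
  proof (rule Ck_on_SucI[where f' = "\<lambda>x v. \<Sum>b\<in>Basis. (g' x v \<bullet> b) *\<^sub>R f' (g x) b"])
    fix x assume x: "x \<in> S"
    interpret linear "f' (g x)" using f'[OF x] by (rule has_derivative_linear)
    have "(\<Sum>b\<in>Basis. (g' x v \<bullet> b) *\<^sub>R f' (g x) b) = f' (g x) (g' x v)" for v
      unfolding scaleR[symmetric] sum[symmetric] by (simp add: euclidean_representation)
    then show "(f \<circ> g has_derivative (\<lambda>v. \<Sum>b\<in>Basis. (g' x v \<bullet> b) *\<^sub>R f' (g x) b)) (at x)"
      using diff_chain_at[OF g'[OF x] f'[OF x]] by (simp add: o_def)
  next
    fix v
    have "Ck_on k S ((\<lambda>y. f' y b) \<circ> g)" for b
      by (rule Suc.IH[OF Ck_on_SucD[OF assms(1) Suc.prems(1)]]) (use Suc.prems(2) in \<open>simp add: f'_def\<close>)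
    then have "Ck_on k S (\<lambda>x. f' (g x) b)" for b by (simp add: o_def)
    moreover have "Ck_on k S (\<lambda>x. g' x v)" using Suc.prems by (simp add: g'_def)
    ultimately show "Ck_on k S (\<lambda>x. \<Sum>b\<in>Basis. (g' x v \<bullet> b) *\<^sub>R f' (g x) b)"
      by (intro Ck_on_sum Ck_on_scaleR Ck_on_inner Ck_on_const assms)
  qed (fact assms)
qed

lemma continuous_on_frechet:
  assumes "Ck_on (Suc k) S f" "open S"
  shows "continuous_on S (\<lambda>x. frechet_derivative f (at x) v)"
  using assms Ck_on_imp_continuous_on by auto

section \<open>Change of variables in Cartesian space\<close>

text \<open>The formula for \<open>has_integral\<close> speaks of finite values, the one for
  nonnegative integrals admits infinity. Hence the split on the integral: if it is infinite, an
  image of finite measure would make the determinant integrable, a contradiction.\<close>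

lemma emeasure_lborel_differentiable_image_wellorder:
  fixes f :: "real ^ 'n::{finite,wellorder} \<Rightarrow> real ^ 'n::_"
  assumes S: "S \<in> sets borel" and fS: "f ` S \<in> sets borel"
    and der: "\<And>x. x \<in> S \<Longrightarrow> (f has_derivative f' x) (at x within S)"
    and inj: "inj_on f S"
    and meas: "(\<lambda>x. indicator S x * \<bar>det (matrix (f' x))\<bar>) \<in> borel_measurable borel"
  shows "emeasure lborel (f ` S) = (\<integral>\<^sup>+x. ennreal (indicator S x * \<bar>det (matrix (f' x))\<bar>) \<partial>lborel)"
proof -
  let ?D = "\<lambda>x. indicator S x * \<bar>det (matrix (f' x))\<bar>"
  have SL: "S \<in> sets lebesgue" using S by simp
  have restr: "(?D has_integral m) UNIV \<longleftrightarrow> ((\<lambda>x. \<bar>det (matrix (f' x))\<bar>) has_integral m) S" for m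
  proof -
    have "?D = (\<lambda>x. if x \<in> S then \<bar>det (matrix (f' x))\<bar> else 0)" by (auto simp: indicator_def)
    then show ?thesis using has_integral_restrict_UNIV[of S "\<lambda>x. \<bar>det (matrix (f' x))\<bar>" m] by simp
  qed
  note img = has_measure_differentiable_image[OF SL der inj, unfolded restr[symmetric]]
  have em: "emeasure lborel (f ` S) = emeasure lebesgue (f ` S)"
    using fS by simp
  show ?thesis
  proof (cases "(\<integral>\<^sup>+x. ennreal (?D x) \<partial>lborel) = \<infinity>")
    case True
    have "f ` S \<notin> lmeasurable"
    proof
      assume "f ` S \<in> lmeasurable"
      then have "(?D has_integral measure lebesgue (f ` S)) UNIV" using img by blast
      then have "(\<integral>\<^sup>+x. ennreal (?D x) \<partial>lborel) = ennreal (measure lebesgue (f ` S))"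
        by (intro nn_integral_has_integral_lborel meas) auto
      with True show False by simp
    qed
    then have "emeasure lebesgue (f ` S) = \<infinity>"
      using fS by (auto simp: fmeasurable_def less_top[symmetric])
    with True em show ?thesis by simp
  next
    case False
    then obtain r where r: "(\<integral>\<^sup>+x. ennreal (?D x) \<partial>lborel) = ennreal r" "0 \<le> r"
      by (cases "\<integral>\<^sup>+x. ennreal (?D x) \<partial>lborel" rule: ennreal_cases) auto
    then have "(?D has_integral r) UNIV"
      by (intro nn_integral_has_integral meas) auto
    then have "f ` S \<in> lmeasurable" "measure lebesgue (f ` S) = r" using img by blast+
    with em r show ?thesis by (simp add: emeasure_eq_measure2)
  qed
qed

text \<open>The library proves the change of variables formula for coordinates indexed by a well-ordered
  type; the following copy of a finite type is well-ordered.\<close>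

typedef (overloaded) 'a wcopy = "UNIV :: 'a::finite set" by simp

lemma Rep_Abs_wcopy [simp]: "Rep_wcopy (Abs_wcopy x) = x"
  by (simp add: Abs_wcopy_inverse)

lemma bij_Rep_wcopy: "bij Rep_wcopy" and bij_Abs_wcopy: "bij Abs_wcopy"
  by (rule o_bij[of Abs_wcopy] o_bij[of Rep_wcopy]; simp add: o_def id_def Rep_wcopy_inverse)+

declare Rep_wcopy_inverse [simp]

instance wcopy :: (finite) finite
proof
  have "bij (Abs_wcopy :: 'a \<Rightarrow> 'a wcopy)" by (rule bij_Abs_wcopy)
  then show "finite (UNIV :: 'a wcopy set)"
    by (metis bij_is_surj finite finite_imageI)
qed

text \<open>An arbitrary injection; it serves only to pull the well-order of the naturals
  back.\<close>

definition wcopy_index :: "'a::finite wcopy \<Rightarrow> nat" where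
  "wcopy_index = (SOME f. inj f)"

lemma inj_wcopy_index: "inj wcopy_index"
proof -
  obtain f :: "'a wcopy \<Rightarrow> nat" where "inj f"
    using finite_imp_inj_to_nat_seg[of "UNIV :: 'a wcopy set"] by auto
  then show ?thesis unfolding wcopy_index_def by (rule someI[where P = inj])
qed

instantiation wcopy :: (finite) wellorder
begin

definition "x \<le> y \<longleftrightarrow> wcopy_index x \<le> wcopy_index y"
definition "x < y \<longleftrightarrow> wcopy_index x < wcopy_index y"

instance
proof (intro_classes, goal_cases)
  case (1 x y)
  then show ?case by (simp add: less_wcopy_def less_eq_wcopy_def less_le_not_le)
next
  case (2 x)
  then show ?case by (simp add: less_eq_wcopy_def)
next
  case (3 x y z)
  then show ?case by (simp add: less_eq_wcopy_def)
next
  case (4 x y)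
  then show ?case unfolding less_eq_wcopy_def by (intro injD[OF inj_wcopy_index]) simp
next
  case (5 x y)
  then show ?case by (simp add: less_eq_wcopy_def linear)
next
  case (6 P a)
  show ?case
  proof (induction a rule: measure_induct_rule[of wcopy_index])
    case (less x)
    show ?case by (rule 6, rule less.IH) (simp add: less_wcopy_def)
  qed
qed

end

definition to_wcopy :: "real ^ 'n::finite \<Rightarrow> real ^ 'n wcopy" where
  "to_wcopy v = (\<chi> i. v $ Rep_wcopy i)"

definition of_wcopy :: "real ^ 'n wcopy \<Rightarrow> real ^ 'n::finite" where
  "of_wcopy v = (\<chi> i. v $ Abs_wcopy i)"

lemma to_wcopy_inverse [simp]: "of_wcopy (to_wcopy v) = v"
  by (simp add: to_wcopy_def of_wcopy_def Abs_wcopy_inverse)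

lemma of_wcopy_inverse [simp]: "to_wcopy (of_wcopy v) = v"
  by (simp add: to_wcopy_def of_wcopy_def Rep_wcopy_inverse)

lemma linear_to_wcopy: "linear to_wcopy"
  by (rule linearI) (auto simp: to_wcopy_def vec_eq_iff)

lemma linear_of_wcopy: "linear of_wcopy"
  by (rule linearI) (auto simp: of_wcopy_def vec_eq_iff)

lemma bounded_linear_to_wcopy: "bounded_linear to_wcopy"
  and bounded_linear_of_wcopy: "bounded_linear of_wcopy"
  using linear_to_wcopy linear_of_wcopy linear_conv_bounded_linear by auto

lemma to_wcopy_measurable [measurable]: "to_wcopy \<in> borel_measurable borel"
  and of_wcopy_measurable [measurable]: "of_wcopy \<in> borel_measurable borel"
  using bounded_linear_to_wcopy bounded_linear_of_wcopy
  by (auto intro!: borel_measurable_continuous_onI linear_continuous_on)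

lemma prod_Basis_cart: "(\<Prod>b\<in>(Basis :: (real ^ 'n) set). f b) = (\<Prod>i\<in>UNIV. f (axis i 1))"
  by (simp add: Basis_vec_def UNION_singleton_eq_range prod.reindex axis_eq_axis inj_on_def)

lemma box_cart: "box l u = {x :: real ^ 'n. \<forall>i. l $ i < x $ i \<and> x $ i < u $ i}"
  by (auto simp: box_def Basis_vec_def inner_axis)

lemma lborel_to_wcopy: "distr lborel borel to_wcopy = (lborel :: (real ^ 'n::finite wcopy) measure)"
proof (rule lborel_eqI[symmetric])
  fix l u :: "real ^ 'n wcopy"
  assume le: "\<And>b. b \<in> Basis \<Longrightarrow> l \<bullet> b \<le> u \<bullet> b"
  have le': "l $ i \<le> u $ i" for i
    using le[of "axis i 1"] by (simp add: inner_axis)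
  have "to_wcopy -` box l u = box (of_wcopy l) (of_wcopy u)"
    unfolding box_cart
    by (auto simp: to_wcopy_def of_wcopy_def) (metis Rep_wcopy_inverse Rep_Abs_wcopy)+
  moreover have "(\<Prod>i\<in>UNIV. (u - l) $ Abs_wcopy i) = (\<Prod>i\<in>UNIV. (u - l) $ i)"
    by (rule prod.reindex_bij_witness[of _ Rep_wcopy Abs_wcopy]) (auto simp: Rep_wcopy_inverse Abs_wcopy_inverse)
  ultimately show "emeasure (distr lborel borel to_wcopy) (box l u) = (\<Prod>b\<in>Basis. (u - l) \<bullet> b)"
    using le'
    by (simp add: emeasure_distr emeasure_lborel_box_eq prod_Basis_cart inner_axis of_wcopy_def)
      (simp add: Basis_vec_def inner_axis)
qed simp

text \<open>Transporting a permutation along the renaming of indices keeps its sign, so the two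
  Leibniz sums agree term by term.\<close>

lemma det_wcopy:
  fixes a :: "real ^ 'n ^ 'n::finite"
  shows "det (\<chi> i j. a $ Rep_wcopy i $ Rep_wcopy j) = det a"
proof -
  let ?m = "map_permutation UNIV (Abs_wcopy :: 'n \<Rightarrow> 'n wcopy)"
  let ?w = "map_permutation UNIV (Rep_wcopy :: 'n wcopy \<Rightarrow> 'n)"
  have bA: "bij (Abs_wcopy :: 'n \<Rightarrow> 'n wcopy)"
    by (rule bij_Abs_wcopy)
  have perm: "?m p permutes UNIV" if "p permutes UNIV" for p
    by (rule map_permutation_permutes) (use that bA in auto)
  have perm': "?w p permutes UNIV" if "p permutes UNIV" for p
    by (rule map_permutation_permutes) (use that bij_Rep_wcopy in auto)
  have "(\<Sum>p | p permutes (UNIV :: 'n set). of_int (sign p) * (\<Prod>i\<in>UNIV. a $ i $ p i)) =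
      (\<Sum>p | p permutes (UNIV :: 'n wcopy set). of_int (sign p) *
         (\<Prod>i\<in>UNIV. a $ Rep_wcopy i $ Rep_wcopy (p i)))"
  proof (rule sum.reindex_bij_witness[of _ ?w ?m]; clarify)
    fix p :: "'n \<Rightarrow> 'n" assume p: "p permutes UNIV"
    show "?w (?m p) = p"
      by (rule map_permutation_compose_inv) (use p bA in \<open>auto simp: bij_def Abs_wcopy_inverse\<close>)
    show "?m p permutes UNIV" by (rule perm[OF p])
    have ap: "?m p (Abs_wcopy x) = Abs_wcopy (p x)" for x
      by (rule map_permutation_apply) (use p bA in \<open>auto simp: bij_def\<close>)
    have "sign (?m p) = sign p"
      by (rule sign_map_permutation) (use p bA in \<open>auto simp: bij_def\<close>)
    moreover have "(\<Prod>i\<in>UNIV. a $ Rep_wcopy i $ Rep_wcopy (?m p i)) = (\<Prod>i\<in>UNIV. a $ i $ p i)"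
    proof (rule prod.reindex_bij_witness[of _ Abs_wcopy Rep_wcopy])
      show "a $ Rep_wcopy i $ p (Rep_wcopy i) = a $ Rep_wcopy i $ Rep_wcopy (?m p i)" for i
        using ap[of "Rep_wcopy i"] by simp
    qed auto
    ultimately show "of_int (sign (?m p)) * (\<Prod>i\<in>UNIV. a $ Rep_wcopy i $ Rep_wcopy (?m p i)) =
      of_int (sign p) * (\<Prod>i\<in>UNIV. a $ i $ p i)" by simp
  next
    fix p :: "'n wcopy \<Rightarrow> 'n wcopy" assume p: "p permutes UNIV"
    show "?m (?w p) = p"
      by (rule map_permutation_compose_inv) (use p bij_Rep_wcopy in \<open>auto simp: bij_def Rep_wcopy_inverse\<close>)
    show "?w p permutes UNIV" by (rule perm'[OF p])
  qed
  then show ?thesis by (simp add: det_def)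
qed

text \<open>Conjugation with the renaming of coordinates changes neither Lebesgue measure nor the
  determinant of the derivative, so the well-ordered case carries over.\<close>

lemma emeasure_lborel_differentiable_image:
  fixes f :: "real ^ 'n::finite \<Rightarrow> real ^ 'n"
  assumes S: "S \<in> sets borel" and fS: "f ` S \<in> sets borel"
    and der: "\<And>x. x \<in> S \<Longrightarrow> (f has_derivative f' x) (at x within S)"
    and inj: "inj_on f S"
    and meas: "(\<lambda>x. indicator S x * \<bar>det (matrix (f' x))\<bar>) \<in> borel_measurable borel"
  shows "emeasure lborel (f ` S) = (\<integral>\<^sup>+x. ennreal (indicator S x * \<bar>det (matrix (f' x))\<bar>) \<partial>lborel)"
proof -
  define h where "h = to_wcopy \<circ> f \<circ> of_wcopy"
  define h' where "h' y = to_wcopy \<circ> f' (of_wcopy y) \<circ> of_wcopy" for y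
  define T where "T = to_wcopy ` S"
  have T_eq: "T = of_wcopy -` S" unfolding T_def by (force simp: image_iff)
  have hT: "h ` T = to_wcopy ` f ` S" unfolding h_def T_def by (simp add: image_comp o_def)
  have hT_eq: "h ` T = of_wcopy -` (f ` S)" unfolding hT by (force simp: image_iff intro: of_wcopy_inverse[symmetric])
  have pre': "to_wcopy -` (h ` T) = f ` S"
    unfolding hT_eq by auto
  have T: "T \<in> sets borel" "h ` T \<in> sets borel"
    unfolding hT_eq unfolding T_eq using measurable_sets[OF of_wcopy_measurable S] measurable_sets[OF of_wcopy_measurable fS] by auto
  have det: "det (matrix (h' (to_wcopy x))) = det (matrix (f' x))" for x
  proof -
    have "of_wcopy (axis j 1) = axis (Rep_wcopy j) 1" for j :: "'n wcopy"
      by (auto simp: of_wcopy_def axis_def vec_eq_iff Rep_wcopy_inverse Abs_wcopy_inverse)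
    then have "matrix (h' (to_wcopy x)) = (\<chi> i j. matrix (f' x) $ Rep_wcopy i $ Rep_wcopy j)"
      by (simp add: h'_def matrix_def o_def) (simp add: to_wcopy_def)
    then show ?thesis using det_wcopy by metis
  qed
  have "emeasure lborel (h ` T) = (\<integral>\<^sup>+x. ennreal (indicator T x * \<bar>det (matrix (h' x))\<bar>) \<partial>lborel)"
  proof (rule emeasure_lborel_differentiable_image_wellorder[OF T])
    fix y assume y: "y \<in> T"
    have "(f has_derivative f' (of_wcopy y)) (at (of_wcopy y) within of_wcopy ` T)"
      using der[of "of_wcopy y"] y by (auto simp: T_def image_comp o_def)
    then have "(f \<circ> of_wcopy has_derivative f' (of_wcopy y) \<circ> of_wcopy) (at y within T)"
      by (intro diff_chain_within bounded_linear_imp_has_derivative bounded_linear_of_wcopy)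
    then show "(h has_derivative h' y) (at y within T)"
      unfolding h_def h'_def comp_assoc
      by (intro diff_chain_within[of "f \<circ> of_wcopy"] bounded_linear_imp_has_derivative bounded_linear_to_wcopy)
  next
    show "inj_on h T"
      using inj unfolding h_def T_def inj_on_def by simp (metis to_wcopy_inverse)
    have "(\<lambda>y. indicator S (of_wcopy y) * \<bar>det (matrix (f' (of_wcopy y)))\<bar>) \<in> borel_measurable borel"
      using measurable_compose[OF of_wcopy_measurable meas] .
    moreover have "det (matrix (h' y)) = det (matrix (f' (of_wcopy y)))" for y
      using det[of "of_wcopy y"] by simp
    ultimately show "(\<lambda>x. indicator T x * \<bar>det (matrix (h' x))\<bar>) \<in> borel_measurable borel"
      by (simp add: T_eq indicator_def)
  qed
  also have "\<dots> = (\<integral>\<^sup>+x. ennreal (indicator T x * \<bar>det (matrix (h' x))\<bar>) \<partial>distr lborel borel to_wcopy)"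
    by (simp add: lborel_to_wcopy)
  also have "\<dots> = (\<integral>\<^sup>+x. ennreal (indicator T (to_wcopy x) * \<bar>det (matrix (h' (to_wcopy x)))\<bar>) \<partial>lborel)"
    using measurable_compose[OF of_wcopy_measurable meas] det[of "of_wcopy _"]
    by (intro nn_integral_distr) (simp_all add: T_eq indicator_def)
  also have "\<dots> = (\<integral>\<^sup>+x. ennreal (indicator S x * \<bar>det (matrix (f' x))\<bar>) \<partial>lborel)"
    by (simp add: det T_eq indicator_def)
  also have "emeasure lborel (h ` T) = emeasure (distr lborel borel to_wcopy) (h ` T)"
    by (simp add: lborel_to_wcopy)
  also have "\<dots> = emeasure lborel (f ` S)"
    using T pre' by (simp add: emeasure_distr)
  finally show ?thesis .
qed

text \<open>Both sides integrate \<open>F\<close> against a Borel measure. The two measures agree on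
  every Borel set \<open>B\<close> by the set version, applied to the part of \<open>S\<close> that
  is mapped into \<open>B\<close>.\<close>

lemma nn_integral_differentiable_image:
  fixes f :: "real ^ 'n::finite \<Rightarrow> real ^ 'n" and F :: "real ^ 'n \<Rightarrow> ennreal"
  assumes S: "S \<in> sets borel" and fS: "f ` S \<in> sets borel"
    and der: "\<And>x. x \<in> S \<Longrightarrow> (f has_derivative f' x) (at x within S)"
    and inj: "inj_on f S"
    and meas: "(\<lambda>x. indicator S x * \<bar>det (matrix (f' x))\<bar>) \<in> borel_measurable borel"
    and F [measurable]: "F \<in> borel_measurable borel"
  shows "(\<integral>\<^sup>+y. indicator (f ` S) y * F y \<partial>lborel) =
    (\<integral>\<^sup>+x. ennreal (indicator S x * \<bar>det (matrix (f' x))\<bar>) * F (f x) \<partial>lborel)"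
proof -
  note [measurable] = S fS
  let ?D = "\<lambda>x. indicator S x * \<bar>det (matrix (f' x))\<bar>"
  \<comment> \<open>The default value makes the map Borel on the whole space; the density vanishes
    off \<open>S\<close>, so the default never contributes.\<close>
  define f0 where "f0 x = (if x \<in> S then f x else 0)" for x
  have "continuous_on S f"
    using der has_derivative_continuous continuous_on_eq_continuous_within by blast
  then have f0 [measurable]: "f0 \<in> borel_measurable borel"
    using borel_measurable_continuous_on_if[OF S, of f "\<lambda>_. 0"] by (simp add: f0_def[abs_def])
  define M1 where "M1 = distr (density lborel (\<lambda>x. ennreal (?D x))) borel f0"
  define M2 where "M2 = density lborel (indicator (f ` S) :: real ^ 'n \<Rightarrow> ennreal)"
  have [measurable]: "(\<lambda>x. ennreal (?D x)) \<in> borel_measurable borel"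
    using meas by measurable
  have "M1 = M2"
  proof (rule measure_eqI)
    fix B assume "B \<in> sets M1"
    then have B [measurable]: "B \<in> sets borel" by (simp add: M1_def)
    define R where "R = S \<inter> f0 -` B"
    have fR: "f ` R = f ` S \<inter> B" by (auto simp: R_def f0_def)
    have RD: "indicator R x * \<bar>det (matrix (f' x))\<bar> = ?D x * indicator (f0 -` B) x" for x
      by (auto simp: R_def indicator_def)
    have [measurable]: "f0 -` B \<in> sets borel" using measurable_sets[OF f0 B] by simp
    have "emeasure M1 B = (\<integral>\<^sup>+x. ennreal (?D x) * indicator (f0 -` B) x \<partial>lborel)"
      proof -
      have "emeasure M1 B = emeasure (density lborel (\<lambda>x. ennreal (?D x))) (f0 -` B)"
        unfolding M1_def using B f0 by (subst emeasure_distr) auto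
      also have "\<dots> = (\<integral>\<^sup>+x. ennreal (?D x) * indicator (f0 -` B) x \<partial>lborel)"
        by (rule emeasure_density) measurable
      finally show ?thesis .
    qed
    also have "\<dots> = (\<integral>\<^sup>+x. ennreal (indicator R x * \<bar>det (matrix (f' x))\<bar>) \<partial>lborel)"
      by (intro nn_integral_cong) (auto simp: R_def indicator_def)
    also have "\<dots> = emeasure lborel (f ` R)"
    proof (rule emeasure_lborel_differentiable_image[symmetric])
      show "R \<in> sets borel" unfolding R_def by measurable
      show "f ` R \<in> sets borel" unfolding fR by measurable
      show "(f has_derivative f' x) (at x within R)" if "x \<in> R" for x
        using der[of x] that by (auto simp: R_def intro: has_derivative_subset)
      show "inj_on f R" using inj by (auto simp: R_def inj_on_def)
      show "(\<lambda>x. indicator R x * \<bar>det (matrix (f' x))\<bar>) \<in> borel_measurable borel"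
        unfolding RD using meas by measurable
    qed
    also have "\<dots> = emeasure M2 B"
    proof -
      have "emeasure M2 B = (\<integral>\<^sup>+x. indicator (f ` S) x * indicator B x \<partial>lborel)"
        unfolding M2_def by (rule emeasure_density) measurable
      also have "\<dots> = (\<integral>\<^sup>+x. indicator (f ` S \<inter> B) x \<partial>lborel)"
        by (intro nn_integral_cong) (simp add: indicator_def)
      finally show ?thesis unfolding fR by simp
    qed
    finally show "emeasure M1 B = emeasure M2 B" .
  qed (simp add: M1_def M2_def)
  have "(\<integral>\<^sup>+y. indicator (f ` S) y * F y \<partial>lborel) = (\<integral>\<^sup>+y. F y \<partial>M2)"
    unfolding M2_def by (subst nn_integral_density) auto
  also have "\<dots> = (\<integral>\<^sup>+y. F y \<partial>M1)" by (simp add: \<open>M1 = M2\<close>)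
  also have "\<dots> = (\<integral>\<^sup>+x. ennreal (?D x) * F (f0 x) \<partial>lborel)"
  proof -
    have "(\<integral>\<^sup>+y. F y \<partial>M1) = (\<integral>\<^sup>+x. F (f0 x) \<partial>density lborel (\<lambda>x. ennreal (?D x)))"
      unfolding M1_def by (rule nn_integral_distr) measurable
    also have "\<dots> = (\<integral>\<^sup>+x. ennreal (?D x) * F (f0 x) \<partial>lborel)"
      by (rule nn_integral_density) measurable
    finally show ?thesis .
  qed
  also have "\<dots> = (\<integral>\<^sup>+x. ennreal (?D x) * F (f x) \<partial>lborel)"
    by (intro nn_integral_cong) (auto simp: f0_def indicator_def)
  finally show ?thesis .
qed

section \<open>Integration over coordinate hyperplanes\<close>

definition drop_coord :: "'n \<Rightarrow> real ^ 'n \<Rightarrow> real ^ 'n" where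
  "drop_coord k y = (\<chi> i. if i = k then 0 else y $ i)"

lemma drop_coord_nth [simp]: "drop_coord k y $ i = (if i = k then 0 else y $ i)"
  by (simp add: drop_coord_def)

lemma drop_coord_ident: "y $ k = 0 \<Longrightarrow> drop_coord k y = y"
  by (simp add: vec_eq_iff)

lemma bounded_linear_drop_coord: "bounded_linear (drop_coord k :: real ^ 'n::finite \<Rightarrow> _)"
  unfolding linear_conv_bounded_linear[symmetric] by (rule linearI) (auto simp: vec_eq_iff)

lemma drop_coord_measurable [measurable]: "drop_coord k \<in> borel_measurable borel"
  using bounded_linear_drop_coord by (auto intro!: borel_measurable_continuous_onI linear_continuous_on)

lemma borel_measurable_vec_lambda [measurable (raw)]:
  fixes f :: "'a \<Rightarrow> 'n::finite \<Rightarrow> real"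
  assumes "\<And>i. (\<lambda>x. f x i) \<in> borel_measurable M"
  shows "(\<lambda>x. \<chi> i. f x i) \<in> borel_measurable M"
proof (subst borel_measurable_euclidean_space, rule ballI)
  fix b :: "real ^ 'n" assume "b \<in> Basis"
  then obtain i where "b = axis i 1" by (auto simp: Basis_vec_def)
  then show "(\<lambda>x. (\<chi> i. f x i) \<bullet> b) \<in> borel_measurable M"
    using assms[of i] by (simp add: inner_axis)
qed

text \<open>Connects the product measure, in which hypersurface measures are expressed, with
  Lebesgue measure on vectors; boxes determine the latter.\<close>

lemma distr_PiM_lborel_vec_lambda:
  "distr (Pi\<^sub>M UNIV (\<lambda>_::'n::finite. lborel)) borel vec_lambda = (lborel :: (real ^ 'n) measure)"
proof (rule lborel_eqI[symmetric])
  fix l u :: "real ^ 'n"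
  assume le: "\<And>b. b \<in> Basis \<Longrightarrow> l \<bullet> b \<le> u \<bullet> b"
  have le': "l $ i \<le> u $ i" for i
    using le[of "axis i 1"] by (simp add: inner_axis)
  have m: "vec_lambda \<in> Pi\<^sub>M UNIV (\<lambda>_::'n. lborel) \<rightarrow>\<^sub>M (borel :: (real ^ 'n) measure)"
    by measurable
  interpret product_sigma_finite "\<lambda>_::'n. lborel :: real measure" by standard
  have "vec_lambda -` box l u \<inter> space (Pi\<^sub>M UNIV (\<lambda>_::'n. lborel)) = Pi\<^sub>E UNIV (\<lambda>i. {l $ i <..< u $ i})"
    by (auto simp: box_cart space_PiM PiE_def)
  then have "emeasure (distr (Pi\<^sub>M UNIV (\<lambda>_. lborel)) borel vec_lambda) (box l u) =
      (\<Prod>i\<in>UNIV. emeasure lborel {l $ i <..< u $ i})"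
    using m by (simp add: emeasure_distr emeasure_PiM)
  also have "\<dots> = (\<Prod>b\<in>Basis. (u - l) \<bullet> b)"
    using le' by (simp add: prod_Basis_cart inner_axis prod_ennreal)
  finally show "emeasure (distr (Pi\<^sub>M UNIV (\<lambda>_. lborel)) borel vec_lambda) (box l u) = (\<Prod>b\<in>Basis. (u - l) \<bullet> b)" .
qed simp

text \<open>Thickening a coordinate hyperplane by the unit interval trades integrals over it for
  integrals over the whole space, where the library has a change of variables formula.\<close>

lemma nn_integral_slice_point:
  fixes F :: "real ^ 'n::finite \<Rightarrow> ennreal"
  assumes F [measurable]: "F \<in> borel_measurable borel"
  shows "(\<integral>\<^sup>+z. F (slice_point k z) \<partial>Pi\<^sub>M (UNIV - {k}) (\<lambda>_. lborel)) =
    (\<integral>\<^sup>+y. indicator {0..1} (y $ k) * F (drop_coord k y) \<partial>lborel)"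
proof -
  interpret product_sigma_finite "\<lambda>_::'n. lborel :: real measure" by standard
  let ?G = "\<lambda>y::real ^ 'n. indicator {0..1} (y $ k) * F (drop_coord k y) :: ennreal"
  have nth: "(\<lambda>y::real ^ 'n. y $ k) \<in> borel_measurable borel"
    by (intro borel_measurable_continuous_onI continuous_intros)
  have G [measurable]: "?G \<in> borel_measurable borel"
    using nth by measurable
  have vl: "vec_lambda \<in> Pi\<^sub>M UNIV (\<lambda>_::'n. lborel) \<rightarrow>\<^sub>M (borel :: (real ^ 'n) measure)"
    by measurable
  have ins: "insert k (UNIV - {k}) = (UNIV :: 'n set)" by auto
  have "(\<integral>\<^sup>+y. ?G y \<partial>lborel) = (\<integral>\<^sup>+f. ?G (vec_lambda f) \<partial>Pi\<^sub>M UNIV (\<lambda>_. lborel))"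
    by (subst distr_PiM_lborel_vec_lambda[symmetric], rule nn_integral_distr[OF vl]) (use G in simp)
  also have "\<dots> = (\<integral>\<^sup>+z. (\<integral>\<^sup>+t. ?G (vec_lambda (z(k := t))) \<partial>lborel) \<partial>Pi\<^sub>M (UNIV - {k}) (\<lambda>_. lborel))"
    by (subst ins[symmetric], rule product_nn_integral_insert)
      (use measurable_compose[OF vl, of ?G borel] G in \<open>simp_all add: ins\<close>)
  also have "\<dots> = (\<integral>\<^sup>+z. (\<integral>\<^sup>+t. F (slice_point k z) * indicator {0..1::real} t \<partial>lborel) \<partial>Pi\<^sub>M (UNIV - {k}) (\<lambda>_. lborel))"
  proof -
    have "drop_coord k (vec_lambda (z(k := t))) = slice_point k z" for z t
      by (simp add: vec_eq_iff slice_point_def)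
    then have "?G (vec_lambda (z(k := t))) = F (slice_point k z) * indicator {0..1} t" for z t
      by (simp add: mult.commute)
    then show ?thesis by (simp only:)
  qed
  also have "\<dots> = (\<integral>\<^sup>+z. F (slice_point k z) \<partial>Pi\<^sub>M (UNIV - {k}) (\<lambda>_. lborel))"
    by (subst nn_integral_cmult_indicator) auto
  finally show ?thesis by simp
qed

text \<open>The derivative \<open>L\<close> of a map between the hyperplanes with indices
  \<open>k\<close> and \<open>k'\<close>, extended by sending the \<open>k\<close>-th coordinate
  identically to the \<open>k'\<close>-th. Up to sign its determinant is the Jacobian of the map
  between the hyperplanes; the extension makes sense of it also when \<open>k\<close> and
  \<open>k'\<close> differ.\<close>

definition slice_extend_deriv :: "'n \<Rightarrow> 'n \<Rightarrow> (real ^ 'n \<Rightarrow> real ^ 'n) \<Rightarrow> real ^ 'n \<Rightarrow> real ^ 'n" where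
  "slice_extend_deriv k k' L h = (\<chi> j. if j = k' then h $ k else L (drop_coord k h) $ j)"

lemma slice_change_of_variables:
  fixes \<Theta> :: "real ^ 'n::finite \<Rightarrow> real ^ 'n" and F :: "real ^ 'n \<Rightarrow> ennreal"
  assumes \<Omega>: "open \<Omega>" and der: "\<And>y. y \<in> \<Omega> \<Longrightarrow> (\<Theta> has_derivative \<Theta>' y) (at y)"
    and cont: "\<And>v. continuous_on \<Omega> (\<lambda>y. \<Theta>' y v)"
    and slice: "\<And>y. y \<in> \<Omega> \<Longrightarrow> y $ k = 0 \<Longrightarrow> \<Theta> y $ k' = 0"
    and inj: "inj_on \<Theta> (\<Omega> \<inter> {y. y $ k = 0})"
    and E: "E \<in> sets borel" "E \<subseteq> \<Omega> \<inter> {y. y $ k = 0}"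
    and F [measurable]: "F \<in> borel_measurable borel"
  shows "\<Theta> ` E \<in> sets borel"
    and "(\<integral>\<^sup>+z. indicator (\<Theta> ` E) (slice_point k' z) * F (slice_point k' z) \<partial>Pi\<^sub>M (UNIV - {k'}) (\<lambda>_. lborel)) =
      (\<integral>\<^sup>+z. indicator E (slice_point k z) *
         (ennreal \<bar>det (matrix (slice_extend_deriv k k' (\<Theta>' (slice_point k z))))\<bar> * F (\<Theta> (slice_point k z)))
         \<partial>Pi\<^sub>M (UNIV - {k}) (\<lambda>_. lborel))"
proof -
  define W where "W = {y. drop_coord k y \<in> \<Omega>}"
  define T where "T y = (\<chi> j. if j = k' then y $ k else \<Theta> (drop_coord k y) $ j)" for y
  define T' where "T' y = slice_extend_deriv k k' (\<Theta>' (drop_coord k y))" for y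
  define R where "R = {y. 0 \<le> y $ k \<and> y $ k \<le> 1 \<and> drop_coord k y \<in> E}"
  have RW: "R \<subseteq> W" using E by (auto simp: R_def W_def)
  have cont_drop: "continuous_on X (drop_coord k)" for X :: "(real ^ 'n) set"
    using bounded_linear_drop_coord by (rule linear_continuous_on)
  have W: "open W"
    unfolding W_def using open_vimage[OF \<Omega> cont_drop[of UNIV]] by (simp add: vimage_def)
  have dT: "(T has_derivative T' y) (at y)" if "y \<in> W" for y
  proof -
    have d: "((\<lambda>y. \<Theta> (drop_coord k y)) has_derivative (\<lambda>h. \<Theta>' (drop_coord k y) (drop_coord k h))) (at y)"
      by (rule has_derivative_compose[OF bounded_linear_imp_has_derivative[OF bounded_linear_drop_coord]])
        (use that der in \<open>auto simp: W_def\<close>)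
    have n: "((\<lambda>y. y $ i) has_derivative (\<lambda>h. h $ i)) F" for i :: 'n and F
      by (intro bounded_linear_imp_has_derivative bounded_linear_vec_nth)
    have dn: "((\<lambda>y. \<Theta> (drop_coord k y) $ k') has_derivative (\<lambda>h. \<Theta>' (drop_coord k y) (drop_coord k h) $ k')) (at y)"
      by (rule has_derivative_compose[OF d n])
    have "((\<lambda>y. \<Theta> (drop_coord k y) + (y $ k - \<Theta> (drop_coord k y) $ k') *\<^sub>R axis k' 1) has_derivative
        (\<lambda>h. \<Theta>' (drop_coord k y) (drop_coord k h) + (h $ k - \<Theta>' (drop_coord k y) (drop_coord k h) $ k') *\<^sub>R axis k' 1)) (at y)"
      by (intro has_derivative_add d has_derivative_scaleR_left has_derivative_diff n dn)
    moreover have "(\<lambda>y. \<Theta> (drop_coord k y) + (y $ k - \<Theta> (drop_coord k y) $ k') *\<^sub>R axis k' 1) = T"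
      by (auto simp: T_def vec_eq_iff axis_def)
    moreover have "(\<lambda>h. \<Theta>' (drop_coord k y) (drop_coord k h) + (h $ k - \<Theta>' (drop_coord k y) (drop_coord k h) $ k') *\<^sub>R axis k' 1) = T' y"
      by (auto simp: T'_def slice_extend_deriv_def vec_eq_iff axis_def)
    ultimately show ?thesis by simp
  qed
  have contT: "continuous_on W T"
    using dT has_derivative_continuous continuous_at_imp_continuous_on by blast
  have T_drop: "drop_coord k' (T y) = \<Theta> (drop_coord k y)" if "y \<in> W" for y
    using slice[of "drop_coord k y"] that by (auto simp: W_def T_def vec_eq_iff)
  have injT: "inj_on T W"
  proof
    fix x y assume xy: "x \<in> W" "y \<in> W" "T x = T y"
    have "x $ k = y $ k" using arg_cong[OF xy(3), of "\<lambda>v. v $ k'"] by (simp add: T_def)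
    moreover have "drop_coord k x = drop_coord k y"
      by (rule inj_onD[OF inj]) (use xy T_drop[of x] T_drop[of y] in \<open>auto simp: W_def\<close>)
    ultimately show "x = y" by (metis drop_coord_nth vec_eq_iff)
  qed
  \<comment> \<open>Invariance of domain supplies a continuous inverse on an open image, and images
    of Borel sets under \<open>T\<close> are Borel as preimages under \<open>gi\<close>.\<close>
  obtain gi where gi: "homeomorphism W (T ` W) T gi"
    using invariance_of_domain_homeomorphism[OF W contT _ injT] by auto
  have TW: "open (T ` W)" using invariance_of_domain[OF contT W injT] .
  note [measurable] = E(1)
  have nth [measurable]: "(\<lambda>y::real ^ 'n. y $ i) \<in> borel_measurable borel" for i
    by (intro borel_measurable_continuous_onI continuous_intros)
  have R [measurable]: "R \<in> sets borel" unfolding R_def by measurable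
  have "gi \<in> borel_measurable (restrict_space borel (T ` W))"
    using gi by (intro borel_measurable_continuous_on_restrict) (auto simp: homeomorphism_def)
  from measurable_sets[OF this R] have "gi -` R \<inter> T ` W \<in> sets borel"
    using TW by (simp add: space_restrict_space sets_restrict_space_iff)
  moreover have "gi -` R \<inter> T ` W = T ` R"
    using gi RW by (force simp: homeomorphism_def)
  ultimately have TR [measurable]: "T ` R \<in> sets borel" by simp
  have TR_eq: "T ` R = {w. 0 \<le> w $ k' \<and> w $ k' \<le> 1 \<and> drop_coord k' w \<in> \<Theta> ` E}"
  proof safe
    fix y assume y: "y \<in> R"
    then show "0 \<le> T y $ k'" "T y $ k' \<le> 1" by (auto simp: R_def T_def)
    show "drop_coord k' (T y) \<in> \<Theta> ` E" using y RW T_drop by (auto simp: R_def)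
  next
    fix w e assume w: "0 \<le> w $ k'" "w $ k' \<le> 1" "drop_coord k' w = \<Theta> e" "e \<in> E"
    define y where "y = (\<chi> i. if i = k then w $ k' else e $ i)"
    have e: "drop_coord k y = e" using w(4) E by (auto simp: y_def vec_eq_iff)
    have yk: "y $ k = w $ k'" by (simp add: y_def)
    have "\<Theta> e $ j = w $ j" if "j \<noteq> k'" for j
      using arg_cong[OF w(3), of "\<lambda>v. v $ j"] that by simp
    then have "T y = w" unfolding T_def e yk by (subst vec_eq_iff) auto
    moreover have "y \<in> R" using w e yk by (simp add: R_def)
    ultimately show "w \<in> T ` R" by blast
  qed
  \<comment> \<open>The image is the bottom face of a slab already known to be Borel.\<close>
  have "\<Theta> ` E = {w. w $ k' = 0} \<inter> T ` R"
  proof -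
    have "\<Theta> x $ k' = 0" if "x \<in> E" for x using that E slice by auto
    then show ?thesis unfolding TR_eq by (auto simp: drop_coord_ident)
  qed
  also have "\<dots> \<in> sets borel" by measurable
  finally show \<Theta>E [measurable]: "\<Theta> ` E \<in> sets borel" .

  have contdet: "continuous_on \<Omega> (\<lambda>y. \<bar>det (matrix (slice_extend_deriv k k' (\<Theta>' y)))\<bar>)"
  proof -
    have "continuous_on \<Omega> (\<lambda>y. matrix (slice_extend_deriv k k' (\<Theta>' y)) $ i $ j)" for i j
      unfolding matrix_def slice_extend_deriv_def using cont
      by (cases "i = k'") (auto intro!: continuous_intros)
    then show ?thesis by (intro continuous_on_rabs continuous_on_det)
  qed
  \<comment> \<open>The indicator confines \<open>G\<close> to \<open>E\<close>, where
    \<open>\<Theta>\<close> and its derivative are continuous; outside \<open>\<Omega>\<close>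
    nothing is known of them, hence the default values in the proof of measurability.\<close>
  define G where "G y = (indicator E y *
         (ennreal \<bar>det (matrix (slice_extend_deriv k k' (\<Theta>' y)))\<bar> * F (\<Theta> y)) :: ennreal)" for y
  have G [measurable]: "G \<in> borel_measurable borel"
  proof -
    have c: "continuous_on E \<Theta>"
      using der E has_derivative_continuous continuous_at_imp_continuous_on by blast
    have [measurable]: "(\<lambda>y. if y \<in> E then \<Theta> y else 0) \<in> borel_measurable borel"
      using borel_measurable_continuous_on_if[OF E(1) c, of "\<lambda>_. 0"] by simp
    have [measurable]: "(\<lambda>y. if y \<in> E then \<bar>det (matrix (slice_extend_deriv k k' (\<Theta>' y)))\<bar> else 0) \<in> borel_measurable borel"
      using borel_measurable_continuous_on_if[OF E(1) continuous_on_subset[OF contdet], of "\<lambda>_. 0"] E by auto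
    have "G = (\<lambda>y. ennreal (if y \<in> E then \<bar>det (matrix (slice_extend_deriv k k' (\<Theta>' y)))\<bar> else 0) *
        F (if y \<in> E then \<Theta> y else 0))"
      by (auto simp: G_def indicator_def)
    also have "\<dots> \<in> borel_measurable borel" by measurable
    finally show ?thesis .
  qed
  have "(\<integral>\<^sup>+z. indicator (\<Theta> ` E) (slice_point k' z) * F (slice_point k' z) \<partial>Pi\<^sub>M (UNIV - {k'}) (\<lambda>_. lborel)) =
      (\<integral>\<^sup>+y. indicator {0..1} (y $ k') * (indicator (\<Theta> ` E) (drop_coord k' y) * F (drop_coord k' y)) \<partial>lborel)"
    by (rule nn_integral_slice_point) measurable
  also have "\<dots> = (\<integral>\<^sup>+y. indicator (T ` R) y * F (drop_coord k' y) \<partial>lborel)"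
    unfolding TR_eq by (intro nn_integral_cong) (auto simp: indicator_def)
  also have "\<dots> = (\<integral>\<^sup>+y. ennreal (indicator R y * \<bar>det (matrix (T' y))\<bar>) * F (drop_coord k' (T y)) \<partial>lborel)"
  proof (rule nn_integral_differentiable_image[OF R TR])
    show "(T has_derivative T' x) (at x within R)" if "x \<in> R" for x
      using dT[of x] that RW has_derivative_at_withinI by blast
    show "inj_on T R" using injT RW by (rule inj_on_subset)
    have "continuous_on W (\<lambda>y. \<bar>det (matrix (T' y))\<bar>)"
      unfolding T'_def by (rule continuous_on_compose2[OF contdet cont_drop]) (auto simp: W_def)
    then show "(\<lambda>x. indicator R x * \<bar>det (matrix (T' x))\<bar>) \<in> borel_measurable borel"
      using borel_measurable_continuous_on_indicator[OF R, of "\<lambda>y. \<bar>det (matrix (T' y))\<bar>"] RW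
      by (auto intro: continuous_on_subset)
  qed measurable
  also have "\<dots> = (\<integral>\<^sup>+y. indicator {0..1} (y $ k) * G (drop_coord k y) \<partial>lborel)"
  proof (intro nn_integral_cong)
    fix y
    show "ennreal (indicator R y * \<bar>det (matrix (T' y))\<bar>) * F (drop_coord k' (T y)) =
        indicator {0..1} (y $ k) * G (drop_coord k y)"
      using T_drop[of y] RW by (cases "y \<in> R") (auto simp: G_def R_def T'_def indicator_def)
  qed
  also have "\<dots> = (\<integral>\<^sup>+z. G (slice_point k z) \<partial>Pi\<^sub>M (UNIV - {k}) (\<lambda>_. lborel))"
    by (rule nn_integral_slice_point[symmetric]) measurable
  finally show "(\<integral>\<^sup>+z. indicator (\<Theta> ` E) (slice_point k' z) * F (slice_point k' z) \<partial>Pi\<^sub>M (UNIV - {k'}) (\<lambda>_. lborel)) =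
      (\<integral>\<^sup>+z. indicator E (slice_point k z) *
         (ennreal \<bar>det (matrix (slice_extend_deriv k k' (\<Theta>' (slice_point k z))))\<bar> * F (\<Theta> (slice_point k z)))
         \<partial>Pi\<^sub>M (UNIV - {k}) (\<lambda>_. lborel))"
    unfolding G_def .
qed

declare Ck_on.simps [simp del]

section \<open>Gram determinants\<close>

definition cols :: "('n \<Rightarrow> real ^ 'n) \<Rightarrow> real ^ 'n ^ 'n" where
  "cols e = (\<chi> i j. e j $ i)"

lemma cols_mult_axis: "cols e *v axis j 1 = e j"
  by (simp add: cols_def matrix_vector_mult_basis column_def vec_eq_iff)

lemma cols_mult: "cols e *v v = (\<Sum>j\<in>UNIV. v $ j *\<^sub>R e j)"
  by (simp add: cols_def matrix_vector_mult_def vec_eq_iff mult.commute)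

lemma cols_linear:
  assumes "linear L"
  shows "cols (\<lambda>i. L (e i)) = matrix L ** cols e"
proof -
  have "(matrix L ** cols e) $ i $ j = (matrix L *v e j) $ i" for i j
    by (simp add: matrix_matrix_mult_def matrix_vector_mult_def cols_def)
  then show ?thesis
    using assms by (simp add: vec_eq_iff matrix_works cols_def)
qed

lemma det_cols_linear:
  assumes "linear L"
  shows "det (cols (\<lambda>i. L (e i))) = det (matrix L) * det (cols e)"
  unfolding cols_linear[OF assms] by (rule det_mul)

lemma ginner_commute:
  assumes "transpose (g c x) = g c x"
  shows "ginner g c x v w = ginner g c x w v"
  unfolding ginner_def by (metis assms dot_lmul_matrix inner_commute transpose_matrix_vector)

lemma linear_ginner: "linear (ginner g c x v)"
  unfolding ginner_def by (rule linearI) (auto simp: matrix_vector_right_distrib inner_add_right matrix_vector_mult_scaleR)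

lemma ginner_scaleR_left: "ginner g c x (r *\<^sub>R v) w = r * ginner g c x v w"
  and ginner_sum_left: "ginner g c x (sum f I) w = (\<Sum>i\<in>I. ginner g c x (f i) w)"
  by (simp_all add: ginner_def inner_sum_left)

lemmas ginner_linear_right =
  linear_add[OF linear_ginner] linear_scale[OF linear_ginner] linear_diff[OF linear_ginner] linear_sum[OF linear_ginner]

lemma gram_eq: "gram g c x e = transpose (cols e) ** g c x ** cols e"
proof -
  have "(transpose (cols e) ** g c x ** cols e) $ i $ j = e i \<bullet> (g c x *v e j)" for i j
  proof -
    have "(transpose (cols e) ** g c x ** cols e) $ i $ j = (transpose (cols e) ** (g c x ** cols e)) $ i $ j"
      by (simp add: matrix_mul_assoc)
    also have "\<dots> = e i \<bullet> (g c x *v e j)"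
      by (simp add: matrix_matrix_mult_def transpose_def cols_def inner_vec_def matrix_vector_mult_def)
    finally show ?thesis .
  qed
  then show ?thesis by (simp add: vec_eq_iff gram_def ginner_def)
qed

lemma det_gram: "det (gram g c x e) = det (g c x) * (det (cols e))\<^sup>2"
  unfolding gram_eq by (simp add: det_mul det_transpose power2_eq_square)

text \<open>A vector orthogonal to the rest leaves only the diagonal entry in row and column
  \<open>k\<close> of the Gram matrix, and this entry factors out. The original \<open>e k\<close>
  is overwritten on both sides.\<close>

lemma det_gram_orthogonal:
  assumes "\<And>i. i \<noteq> k \<Longrightarrow> ginner g c x v (e i) = 0" "\<And>i. i \<noteq> k \<Longrightarrow> ginner g c x (e i) v = 0"
  shows "det (gram g c x (e(k := v))) = ginner g c x v v * minor_det k (gram g c x e)"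
proof -
  let ?m = "\<chi> i j. if i = k \<or> j = k then of_bool (i = j) else gram g c x e $ i $ j"
  have 1: "gram g c x (e(k := v)) = (\<chi> i. if i = k then ginner g c x v v *s axis k 1 else ?m $ i)"
    using assms by (auto simp: vec_eq_iff gram_def axis_def)
  have 2: "?m = (\<chi> i. if i = k then axis k 1 else ?m $ i)"
    by (auto simp: vec_eq_iff axis_def)
  show ?thesis unfolding 1 minor_det_def
    by (subst det_row_mul, subst (2) 2) simp
qed

lemma minor_det_orthonormal:
  assumes "\<And>i j. i \<noteq> k \<Longrightarrow> j \<noteq> k \<Longrightarrow> m $ i $ j = of_bool (i = j)"
  shows "minor_det k m = 1"
proof -
  have "(\<chi> i j. if i = k \<or> j = k then of_bool (i = j) else m $ i $ j) = mat 1"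
    using assms by (auto simp: vec_eq_iff mat_def)
  then show ?thesis by (simp add: minor_det_def)
qed

text \<open>Gram-Schmidt as a maximality argument. Orthonormal sets are independent, so their size
  is bounded by \<open>dim K\<close> and a largest one exists; if it did not span \<open>K\<close>,
  the normalized remainder of a vector outside its span could be added.\<close>

lemma orthonormal_basis_exists:
  fixes K :: "(real ^ 'n::finite) set"
  assumes sym: "transpose (g c x) = g c x" and pos: "\<And>v. v \<noteq> 0 \<Longrightarrow> ginner g c x v v > 0"
    and K: "subspace K"
  shows "\<exists>B\<subseteq>K. finite B \<and> card B = dim K \<and> (\<forall>v\<in>B. \<forall>w\<in>B. ginner g c x v w = of_bool (v = w))"
proof -
  define P where "P B \<longleftrightarrow> B \<subseteq> K \<and> finite B \<and>
    (\<forall>v\<in>B. \<forall>w\<in>B. ginner g c x v w = of_bool (v = w))" for B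
  have expand: "ginner g c x (\<Sum>v\<in>B. r v *\<^sub>R v) w = r w" if "P B" "w \<in> B" for B r w
  proof -
    have "ginner g c x (\<Sum>v\<in>B. r v *\<^sub>R v) w = (\<Sum>v\<in>B. r v * of_bool (v = w))"
      using that by (auto simp: P_def ginner_sum_left ginner_scaleR_left intro!: sum.cong)
    also have "\<dots> = r w" using that by (simp add: P_def of_bool_def if_distrib cong: if_cong)
    finally show ?thesis .
  qed
  have indep: "independent B" if "P B" for B
    unfolding independent_explicit
  proof (intro conjI allI impI ballI)
    show "finite B" using that by (simp add: P_def)
    fix r w assume "(\<Sum>v\<in>B. r v *\<^sub>R v) = 0" "w \<in> B"
    with expand[OF that, of w r] show "r w = 0" by (simp add: ginner_def)
  qed
  have bound: "card B \<le> dim K" if "P B" for B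
    using indep[OF that] that independent_card_le_dim unfolding P_def by blast
  have "P {}" by (simp add: P_def)
  then obtain B where B: "P B" "\<And>B'. P B' \<Longrightarrow> card B' \<le> card B"
    using ex_has_greatest_nat[of P "{}" card "Suc (dim K)"] bound by (auto simp: less_Suc_eq_le)
  have "K \<subseteq> span B"
  proof (rule ccontr)
    assume "\<not> K \<subseteq> span B"
    then obtain v where v: "v \<in> K" "v \<notin> span B" by blast
    define w where "w = v - (\<Sum>b\<in>B. ginner g c x v b *\<^sub>R b)"
    have "(\<Sum>b\<in>B. ginner g c x v b *\<^sub>R b) \<in> span B" by (intro span_sum span_scale span_base)
    then have w0: "w \<noteq> 0" using v by (auto simp: w_def)
    have wK: "w \<in> K" unfolding w_def
      using B(1) v K by (intro subspace_diff subspace_sum subspace_scale) (auto simp: P_def)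
    have orth: "ginner g c x w b = 0" if "b \<in> B" for b
      using expand[OF B(1) that, of "\<lambda>b. ginner g c x v b"]
      unfolding w_def by (simp add: ginner_def inner_diff_left)
    define n where "n = (1 / sqrt (ginner g c x w w)) *\<^sub>R w"
    have nn: "ginner g c x n n = 1"
      using pos[OF w0] by (simp add: n_def ginner_scaleR_left ginner_linear_right real_sqrt_mult_self field_simps flip: power2_eq_square)
    have nb: "ginner g c x n b = 0" "ginner g c x b n = 0" if "b \<in> B" for b
      using orth[OF that] ginner_commute[of g c x, OF sym] by (simp_all add: n_def ginner_scaleR_left ginner_linear_right)
    have nB: "n \<notin> B" using nb nn by force
    have "P (insert n B)"
      using B(1) nB nn nb wK K by (auto simp: P_def n_def subspace_scale)
    from B(2)[OF this] nB B(1) show False by (simp add: P_def)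
  qed
  then have "dim K \<le> card B" using B(1) by (auto simp: P_def intro: dim_le_card)
  with B(1) bound[OF B(1)] show ?thesis by (auto simp: P_def intro!: exI[of _ B])
qed

text \<open>For an orthonormal basis the Gram matrix is the identity, so \<open>det (g c x)\<close>
  times a square equals 1.\<close>

lemma det_posdef_pos:
  fixes g :: "('m, 'n::finite) metric"
  assumes "transpose (g c x) = g c x" "\<And>v. v \<noteq> 0 \<Longrightarrow> ginner g c x v v > 0"
  shows "det (g c x) > 0"
proof -
  obtain B :: "(real ^ 'n) set" where B: "finite B" "card B = dim (UNIV :: (real ^ 'n) set)"
    "\<forall>v\<in>B. \<forall>w\<in>B. ginner g c x v w = of_bool (v = w)"
    using orthonormal_basis_exists[of g c x UNIV, OF assms subspace_UNIV] by blast
  then obtain e :: "'n \<Rightarrow> real ^ 'n" where e: "bij_betw e UNIV B"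
    using finite_same_card_bij[of "UNIV :: 'n set" B] by (auto simp: dim_UNIV)
  have "gram g c x e = mat 1"
  proof -
    have "ginner g c x (e i) (e j) = of_bool (i = j)" for i j
      using e B(3) by (auto simp: bij_betw_def inj_eq)
    then show ?thesis by (auto simp: gram_def vec_eq_iff mat_def)
  qed
  then have "det (g c x) * (det (cols e))\<^sup>2 = 1" using det_gram[of g c x e] by simp
  then show ?thesis
    using mult_nonpos_nonneg[of "det (g c x)" "(det (cols e))\<^sup>2"] by (cases "det (g c x) > 0") auto
qed

section \<open>Charts\<close>

lemma is_chartD:
  assumes "is_chart c"
  shows "open (fst c)" "open (snd c ` fst c)"
    "\<And>x. x \<in> fst c \<Longrightarrow> cinv c (snd c x) = x" "\<And>y. y \<in> snd c ` fst c \<Longrightarrow> snd c (cinv c y) = y"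
    "\<And>y. y \<in> snd c ` fst c \<Longrightarrow> cinv c y \<in> fst c"
    "continuous_on (fst c) (snd c)" "continuous_on (snd c ` fst c) (cinv c)"
  using assms unfolding is_chart_def homeomorphism_def by auto

lemma open_chart_image:
  assumes "is_chart c" "open U"
  shows "open (snd c ` (fst c \<inter> U))"
proof -
  note c = is_chartD[OF assms(1)]
  have "snd c ` (fst c \<inter> U) = cinv c -` U \<inter> snd c ` fst c"
    using c(3) by auto
  then show ?thesis using continuous_open_vimage continuous_on_open_vimage[OF c(2)] c(7) assms(2) by metis
qed

definition transition :: "('m, 'n::finite) chart \<Rightarrow> ('m, 'n) chart \<Rightarrow> 'm \<Rightarrow> real ^ 'n \<Rightarrow> real ^ 'n" where
  "transition c d x = frechet_derivative (snd d \<circ> cinv c) (at (snd c x))"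

text \<open>Slice charts need not belong to the atlas. This weak compatibility holds for both kinds
  of chart and suffices for first derivatives, so that one set of chain rules covers both.\<close>

definition C1_charts :: "('m::topological_space, 'n::finite) chart \<Rightarrow> ('m, 'n) chart \<Rightarrow> bool" where
  "C1_charts c d \<longleftrightarrow> is_chart c \<and> is_chart d \<and> Ck_compatible 1 c d"

lemma C1_charts_sym: "C1_charts c d \<Longrightarrow> C1_charts d c"
  by (simp add: C1_charts_def Ck_compatible_def Int_commute)

lemma transition_has_derivative:
  assumes "C1_charts c d" "x \<in> fst c" "x \<in> fst d"
  shows "(snd d \<circ> cinv c has_derivative transition c d x) (at (snd c x))"
  unfolding transition_def
proof (rule Ck_on_has_derivative)
  show "Ck_on (Suc 0) (snd c ` (fst c \<inter> fst d)) (snd d \<circ> cinv c)"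
    using assms by (simp add: C1_charts_def Ck_compatible_def)
  show "open (snd c ` (fst c \<inter> fst d))"
    using assms by (intro open_chart_image is_chartD) (auto simp: C1_charts_def)
qed (use assms in auto)

lemma linear_transition:
  assumes "C1_charts c d" "x \<in> fst c" "x \<in> fst d"
  shows "linear (transition c d x)"
  using transition_has_derivative[OF assms] by (rule has_derivative_linear)

lemma continuous_on_transition:
  assumes "C1_charts c d"
  shows "continuous_on (fst c \<inter> fst d) (\<lambda>x. transition c d x v)"
proof -
  have "continuous_on (snd c ` (fst c \<inter> fst d)) (\<lambda>y. frechet_derivative (snd d \<circ> cinv c) (at y) v)"
    using assms unfolding C1_charts_def Ck_compatible_def
    by (intro continuous_on_frechet[of 0] open_chart_image is_chartD) auto
  then show ?thesis
    unfolding transition_def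
    by (rule continuous_on_compose2[of _ _ _ "snd c"])
      (use assms in \<open>auto simp: C1_charts_def intro: continuous_on_subset[OF is_chartD(6)]\<close>)
qed

lemma transition_self:
  assumes "is_chart c" "x \<in> fst c"
  shows "transition c c x v = v"
proof -
  have "transition c c x = frechet_derivative (\<lambda>y. y) (at (snd c x))"
    unfolding transition_def
    by (rule frechet_derivative_cong_open[of "snd c ` fst c"]) (use assms is_chartD[OF assms(1)] in auto)
  then show ?thesis by (simp add: frechet_derivative_ident)
qed

lemma transition_comp:
  assumes "C1_charts c d" "C1_charts d e" "C1_charts c e" "x \<in> fst c" "x \<in> fst d" "x \<in> fst e"
  shows "transition d e x (transition c d x v) = transition c e x v"
proof -
  note ch = assms(1,2)[unfolded C1_charts_def]
  have "((snd e \<circ> cinv d) \<circ> (snd d \<circ> cinv c) has_derivative transition d e x \<circ> transition c d x) (at (snd c x))"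
  proof (rule diff_chain_at)
    show "(snd e \<circ> cinv d has_derivative transition d e x) (at ((snd d \<circ> cinv c) (snd c x)))"
      using transition_has_derivative[OF assms(2,5,6)] ch assms by (simp add: is_chartD)
  qed (rule transition_has_derivative[OF assms(1,4,5)])
  then have "(snd e \<circ> cinv c has_derivative transition d e x \<circ> transition c d x) (at (snd c x))"
  proof (rule has_derivative_transform_within_open)
    show "open (snd c ` (fst c \<inter> fst d))" using ch by (intro open_chart_image is_chartD) auto
    show "(snd e \<circ> cinv d \<circ> (snd d \<circ> cinv c)) y = (snd e \<circ> cinv c) y" if "y \<in> snd c ` (fst c \<inter> fst d)" for y
      using that ch by (auto simp: is_chartD)
  qed (use assms in auto)
  from has_derivative_unique[OF this transition_has_derivative[OF assms(3,4,6)]]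
  show ?thesis by (metis comp_apply)
qed

lemma C1_charts_refl:
  assumes "is_chart c"
  shows "C1_charts c c"
proof -
  note c = is_chartD[OF assms]
  have "Ck_on 1 (snd c ` fst c) (snd c \<circ> cinv c)"
    by (rule Ck_on_cong[OF c(2) _ Ck_on_bounded_linear[OF c(2) bounded_linear_ident]])
      (use c in auto)
  then show ?thesis using assms by (simp add: C1_charts_def Ck_compatible_def)
qed

lemma transition_inverse:
  assumes "C1_charts c d" "x \<in> fst c" "x \<in> fst d"
  shows "transition d c x (transition c d x v) = v"
proof -
  have c: "is_chart c" using assms by (simp add: C1_charts_def)
  show ?thesis
    using transition_comp[OF assms(1) C1_charts_sym[OF assms(1)] C1_charts_refl[OF c] assms(2,3,2)]
      transition_self[OF c assms(2)] by simp
qed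

section \<open>Gradients in charts\<close>

locale regular_function =
  fixes A :: "('m::{t2_space,second_countable_topology}, 'n::finite) chart set"
    and g :: "('m, 'n) metric" and u :: "'m \<Rightarrow> real"
  assumes riemannian: "riemannian_manifold A g"
    and C2: "Ck_function 2 A u"
    and grad_norm_pos: "\<And>x. x \<in> carrier A \<Longrightarrow> grad_norm A g u x > 0"
begin

lemma chart: "c \<in> A \<Longrightarrow> is_chart c"
  using riemannian by (simp add: riemannian_manifold_def smooth_atlas_def)

lemmas chartD = is_chartD[OF chart]

lemma C1_atlas: "c \<in> A \<Longrightarrow> d \<in> A \<Longrightarrow> C1_charts c d"
  using riemannian by (simp add: riemannian_manifold_def smooth_atlas_def C1_charts_def)

lemma open_carrier: "open (carrier A)"
  unfolding carrier_def using chart is_chartD(1) by blast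

lemma chart_at:
  assumes "x \<in> carrier A"
  shows "chart_at A x \<in> A" "x \<in> fst (chart_at A x)"
proof -
  obtain c where "c \<in> A \<and> x \<in> fst c" using assms by (auto simp: carrier_def)
  from someI[of "\<lambda>c. c \<in> A \<and> x \<in> fst c", OF this]
  show "chart_at A x \<in> A" "x \<in> fst (chart_at A x)" by (simp_all add: chart_at_def)
qed

lemma in_carrier: "c \<in> A \<Longrightarrow> x \<in> fst c \<Longrightarrow> x \<in> carrier A"
  by (auto simp: carrier_def)

lemma metric: "riemannian_metric A g"
  using riemannian by (simp add: riemannian_manifold_def)

lemma g_sym: "c \<in> A \<Longrightarrow> x \<in> fst c \<Longrightarrow> transpose (g c x) = g c x"
  and g_pos: "c \<in> A \<Longrightarrow> x \<in> fst c \<Longrightarrow> v \<noteq> 0 \<Longrightarrow> ginner g c x v v > 0"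
  and g_Ck: "c \<in> A \<Longrightarrow> Ck_on k (snd c ` fst c) (\<lambda>y. g c (cinv c y) $ i $ j)"
  using metric unfolding riemannian_metric_def by blast+

lemma g_trans:
  assumes "c \<in> A" "d \<in> A" "x \<in> fst c" "x \<in> fst d"
  shows "ginner g d x (transition c d x v) (transition c d x w) = ginner g c x v w"
  using metric assms unfolding riemannian_metric_def transition_def by (metis IntI)

lemma det_g_pos: "c \<in> A \<Longrightarrow> x \<in> fst c \<Longrightarrow> det (g c x) > 0"
  by (rule det_posdef_pos) (auto simp: g_sym g_pos)

lemma gram_trans:
  assumes "c \<in> A" "d \<in> A" "x \<in> fst c" "x \<in> fst d"
  shows "gram g d x (\<lambda>i. transition c d x (e i)) = gram g c x e"
  using g_trans[OF assms] by (simp add: gram_def)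

lemma trans_inv: "c \<in> A \<Longrightarrow> d \<in> A \<Longrightarrow> x \<in> fst c \<Longrightarrow> x \<in> fst d \<Longrightarrow>
    transition d c x (transition c d x v) = v"
  using transition_inverse C1_atlas by blast

lemma differential_has_derivative:
  assumes "c \<in> A" "x \<in> fst c"
  shows "(u \<circ> cinv c has_derivative differential u c x) (at (snd c x))"
proof -
  have "Ck_on (Suc 1) (snd c ` fst c) (u \<circ> cinv c)"
    using C2 assms by (simp add: Ck_function_def numeral_2_eq_2)
  then show ?thesis
    unfolding differential_def by (rule Ck_on_has_derivative) (use assms in \<open>auto simp: chartD\<close>)
qed

lemma linear_differential: "c \<in> A \<Longrightarrow> x \<in> fst c \<Longrightarrow> linear (differential u c x)"
  using differential_has_derivative has_derivative_linear by blast

lemma differential_Ck: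
  assumes "c \<in> A"
  shows "Ck_on 1 (snd c ` fst c) (\<lambda>y. differential u c (cinv c y) v)"
proof -
  have "Ck_on 1 (snd c ` fst c) (\<lambda>y. frechet_derivative (u \<circ> cinv c) (at y) v)"
    using C2 assms by (simp add: Ck_function_def numeral_2_eq_2 Ck_on.simps(2))
  then show ?thesis
    by (rule Ck_on_cong[rotated 2]) (use assms in \<open>auto simp: chartD differential_def\<close>)
qed

lemma chain_differential:
  assumes "C1_charts c d" "d \<in> A" "x \<in> fst c" "x \<in> fst d"
  shows "(u \<circ> cinv c has_derivative (\<lambda>v. differential u d x (transition c d x v))) (at (snd c x))"
proof -
  have ch: "is_chart c" "is_chart d" using assms by (auto simp: C1_charts_def)
  have "((u \<circ> cinv d) \<circ> (snd d \<circ> cinv c) has_derivative differential u d x \<circ> transition c d x) (at (snd c x))"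
  proof (rule diff_chain_at)
    show "(u \<circ> cinv d has_derivative differential u d x) (at ((snd d \<circ> cinv c) (snd c x)))"
      using differential_has_derivative assms ch by (simp add: is_chartD)
  qed (rule transition_has_derivative[OF assms(1,3,4)])
  then have "(u \<circ> cinv c has_derivative differential u d x \<circ> transition c d x) (at (snd c x))"
  proof (rule has_derivative_transform_within_open)
    show "open (snd c ` (fst c \<inter> fst d))" using ch by (intro open_chart_image is_chartD) auto
    show "(u \<circ> cinv d \<circ> (snd d \<circ> cinv c)) y = (u \<circ> cinv c) y" if "y \<in> snd c ` (fst c \<inter> fst d)" for y
      using that ch by (auto simp: is_chartD)
  qed (use assms in auto)
  then show ?thesis by (simp add: o_def)
qed

lemma differential_trans:
  assumes "c \<in> A" "d \<in> A" "x \<in> fst c" "x \<in> fst d"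
  shows "differential u d x (transition c d x v) = differential u c x v"
  using has_derivative_unique[OF chain_differential[OF C1_atlas[OF assms(1,2)] assms(2-4)]
      differential_has_derivative[OF assms(1,3)]] by metis

text \<open>Cramer's rule for $G v = (\partial_j u)_j$; this shows that the gradient is $C^1$ in charts.\<close>

definition grad_coord :: "('m, 'n) chart \<Rightarrow> 'm \<Rightarrow> real ^ 'n" where
  "grad_coord c x = (\<chi> k. det (\<chi> i j. if j = k then differential u c x (axis i 1) else g c x $ i $ j) / det (g c x))"

lemma ginner_eq_differential_iff:
  assumes "c \<in> A" "x \<in> fst c"
  shows "(\<forall>w. ginner g c x v w = differential u c x w) \<longleftrightarrow> v = grad_coord c x"
proof -
  define a where "a = (\<chi> i. differential u c x (axis i 1))"
  interpret linear "differential u c x" by (rule linear_differential[OF assms])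
  have du: "differential u c x w = a \<bullet> w" for w
  proof -
    have "differential u c x w = differential u c x (\<Sum>i\<in>UNIV. w $ i *\<^sub>R axis i 1)"
      using basis_expansion[of w] by (simp add: scalar_mult_eq_scaleR)
    also have "\<dots> = a \<bullet> w"
      by (simp add: sum scaleR inner_vec_def mult.commute a_def)
    finally show ?thesis .
  qed
  have "ginner g c x v w = (g c x *v v) \<bullet> w" for w
    by (metis ginner_commute[of g c x, OF g_sym[OF assms]] ginner_def inner_commute)
  then have "(\<forall>w. ginner g c x v w = differential u c x w) \<longleftrightarrow> g c x *v v = a"
    unfolding du by (metis vector_eq_rdot)
  also have "\<dots> \<longleftrightarrow> v = grad_coord c x"
    unfolding grad_coord_def using cramer[of "g c x" v a] det_g_pos[OF assms]
    unfolding a_def by (simp cong: if_cong)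
  finally show ?thesis .
qed

lemma grad_eq: "c \<in> A \<Longrightarrow> x \<in> fst c \<Longrightarrow> grad g u c x = grad_coord c x"
  unfolding grad_def using ginner_eq_differential_iff by simp

lemma ginner_grad: "c \<in> A \<Longrightarrow> x \<in> fst c \<Longrightarrow> ginner g c x (grad g u c x) w = differential u c x w"
  using ginner_eq_differential_iff grad_eq by metis

lemma grad_trans:
  assumes "c \<in> A" "d \<in> A" "x \<in> fst c" "x \<in> fst d"
  shows "grad g u d x = transition c d x (grad g u c x)"
proof -
  have "ginner g d x (transition c d x (grad g u c x)) w = differential u d x w" for w
    using g_trans[OF assms, of "grad g u c x" "transition d c x w"]
      trans_inv[OF assms(2,1,4,3), of w] ginner_grad[OF assms(1,3), of "transition d c x w"]
      differential_trans[OF assms, of "transition d c x w"] by simp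
  then show ?thesis
    using ginner_eq_differential_iff[OF assms(2,4)] grad_eq[OF assms(2,4)] by metis
qed

lemma grad_norm_eq:
  assumes "c \<in> A" "x \<in> fst c"
  shows "gnorm g c x (grad g u c x) = grad_norm A g u x"
proof -
  note c = chart_at[OF in_carrier[OF assms]]
  show ?thesis
    unfolding grad_norm_def gnorm_def grad_trans[OF assms(1) c(1) assms(2) c(2)]
      g_trans[OF assms(1) c(1) assms(2) c(2)] ..
qed

lemma grad_norm_sq:
  assumes "c \<in> A" "x \<in> fst c"
  shows "(grad_norm A g u x)\<^sup>2 = differential u c x (grad g u c x)"
proof -
  have "ginner g c x (grad g u c x) (grad g u c x) \<ge> 0"
    using g_pos[OF assms] by (cases "grad g u c x = 0") (auto simp: ginner_def less_imp_le)
  then show ?thesis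
    using ginner_grad[OF assms] grad_norm_eq[OF assms] by (metis gnorm_def real_sqrt_pow2)
qed

lemma gn_pos: "c \<in> A \<Longrightarrow> x \<in> fst c \<Longrightarrow> grad_norm A g u x > 0"
  using grad_norm_pos in_carrier by blast

section \<open>The transversal field and its regularity\<close>

abbreviation Y :: "('m, 'n) chart \<Rightarrow> 'm \<Rightarrow> real ^ 'n" where
  "Y \<equiv> Y_field g u"

lemma Y_eq: "c \<in> A \<Longrightarrow> x \<in> fst c \<Longrightarrow> Y c x = (1 / (grad_norm A g u x)\<^sup>2) *\<^sub>R grad g u c x"
  by (simp add: Y_field_def grad_norm_eq)

lemma ginner_Y: "c \<in> A \<Longrightarrow> x \<in> fst c \<Longrightarrow> ginner g c x (Y c x) w = differential u c x w / (grad_norm A g u x)\<^sup>2"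
  by (simp add: Y_eq ginner_scaleR_left ginner_grad)

lemma differential_Y: "c \<in> A \<Longrightarrow> x \<in> fst c \<Longrightarrow> differential u c x (Y c x) = 1"
  using gn_pos[of c x] linear_differential[of c x]
  by (simp add: Y_eq linear_scale grad_norm_sq[symmetric])

lemma ginner_Y_Y: "c \<in> A \<Longrightarrow> x \<in> fst c \<Longrightarrow> ginner g c x (Y c x) (Y c x) = 1 / (grad_norm A g u x)\<^sup>2"
  by (simp add: ginner_Y differential_Y)

lemma det_g_Ck:
  assumes "c \<in> A"
  shows "Ck_on 1 (snd c ` fst c) (\<lambda>y. det (g c (cinv c y)))"
  by (intro Ck_on_det g_Ck assms is_chartD chart)

lemma grad_Ck:
  assumes "c \<in> A"
  shows "Ck_on 1 (snd c ` fst c) (\<lambda>y. grad g u c (cinv c y) $ k)"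
proof (rule Ck_on_cong)
  show "Ck_on 1 (snd c ` fst c) (\<lambda>y. det (\<chi> i j. if j = k then differential u c (cinv c y) (axis i 1)
      else g c (cinv c y) $ i $ j) / det (g c (cinv c y)))"
  proof (intro Ck_on_divide Ck_on_det)
    show "Ck_on 1 (snd c ` fst c) (\<lambda>y. (\<chi> i j. if j = k then differential u c (cinv c y) (axis i 1)
      else g c (cinv c y) $ i $ j) $ i $ j)" for i j
      using differential_Ck[OF assms] g_Ck[OF assms] by (cases "j = k") auto
    show "det (g c (cinv c y)) \<noteq> 0" if "y \<in> snd c ` fst c" for y
      using det_g_pos[OF assms, of "cinv c y"] is_chartD(5)[OF chart[OF assms]] that by force
  qed (use assms in \<open>auto simp: chartD g_Ck\<close>)
qed (use assms in \<open>auto simp: chartD grad_eq grad_coord_def\<close>)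

text \<open>The square equals the differential applied to the gradient, a sum of products of C^1
  functions, so no root has to be differentiated.\<close>

lemma grad_norm_sq_Ck:
  assumes "c \<in> A"
  shows "Ck_on 1 (snd c ` fst c) (\<lambda>y. (grad_norm A g u (cinv c y))\<^sup>2)"
proof (rule Ck_on_cong)
  show "Ck_on 1 (snd c ` fst c)
    (\<lambda>y. \<Sum>i\<in>UNIV. grad g u c (cinv c y) $ i * differential u c (cinv c y) (axis i 1))"
    by (intro Ck_on_sum Ck_on_mult grad_Ck differential_Ck assms is_chartD chart)
next
  fix y assume "y \<in> snd c ` fst c"
  then have y: "cinv c y \<in> fst c" using assms by (simp add: chartD)
  let ?v = "grad g u c (cinv c y)"
  have "differential u c (cinv c y) ?v = differential u c (cinv c y) (\<Sum>i\<in>UNIV. ?v $ i *\<^sub>R axis i 1)"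
    using basis_expansion[of ?v] by (simp add: scalar_mult_eq_scaleR)
  then show "(\<Sum>i\<in>UNIV. ?v $ i * differential u c (cinv c y) (axis i 1)) = (grad_norm A g u (cinv c y))\<^sup>2"
    using linear_differential[OF assms y] grad_norm_sq[OF assms y]
    by (simp add: linear_sum linear_scale)
qed (use assms in \<open>auto simp: chartD\<close>)

lemma Y_Ck:
  assumes "c \<in> A"
  shows "Ck_on 1 (snd c ` fst c) (\<lambda>y. Y c (cinv c y))"
proof (rule Ck_on_cong)
  show "Ck_on 1 (snd c ` fst c) (\<lambda>y. (1 / (grad_norm A g u (cinv c y))\<^sup>2) *\<^sub>R grad g u c (cinv c y))"
  proof (intro Ck_on_scaleR Ck_on_divide grad_norm_sq_Ck Ck_on_const assms)
    show "Ck_on 1 (snd c ` fst c) (\<lambda>y. grad g u c (cinv c y))"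
      using grad_Ck[OF assms] Ck_on_vec_iff is_chartD(2)[OF chart[OF assms]] by blast
    show "(grad_norm A g u (cinv c y))\<^sup>2 \<noteq> 0" if "y \<in> snd c ` fst c" for y
      using gn_pos[OF assms, of "cinv c y"] is_chartD(5)[OF chart[OF assms]] that by force
  qed (use assms in \<open>auto simp: chartD\<close>)
qed (use assms in \<open>auto simp: chartD Y_eq\<close>)

lemma continuous_on_grad_norm: "continuous_on (carrier A) (grad_norm A g u)"
  unfolding carrier_def
proof (rule continuous_on_open_UN)
  fix c assume c: "c \<in> A"
  note ch = is_chartD[OF chart[OF c]]
  show "open (fst c)" by (rule ch)
  have "continuous_on (fst c) (\<lambda>x. sqrt ((grad_norm A g u (cinv c (snd c x)))\<^sup>2))"
    by (intro continuous_on_real_sqrt continuous_on_compose2[OF Ck_on_imp_continuous_on[OF ch(2) grad_norm_sq_Ck[OF c]] ch(6)]) auto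
  then show "continuous_on (fst c) (grad_norm A g u)"
    by (rule continuous_on_eq) (use gn_pos[OF c] ch in \<open>auto simp: less_imp_le\<close>)
qed

text \<open>\<open>Y\<close> is orthogonal to the kernel of the differential and has squared length
  \<open>1 / (grad_norm A g u x)\<^sup>2\<close>; its reciprocal is the first factor. Densities and
  Jacobians along level sets are both computed through this identity, which makes them
  comparable.\<close>

lemma minor_det_gram:
  assumes c: "c \<in> A" "x \<in> fst c" and e: "\<And>i. i \<noteq> k \<Longrightarrow> differential u c x (e i) = 0"
  shows "minor_det k (gram g c x e) =
    (grad_norm A g u x)\<^sup>2 * det (g c x) * (det (cols (e(k := Y c x))))\<^sup>2"
proof -
  have "det (gram g c x (e(k := Y c x))) = ginner g c x (Y c x) (Y c x) * minor_det k (gram g c x e)"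
  proof (rule det_gram_orthogonal)
    show "ginner g c x (Y c x) (e i) = 0" "ginner g c x (e i) (Y c x) = 0" if "i \<noteq> k" for i
      using that e by (simp_all add: ginner_Y c ginner_commute[of g c x "e i", OF g_sym[OF c]])
  qed
  then show ?thesis
    using det_gram[of g c x "e(k := Y c x)"] gn_pos[OF c] by (simp add: ginner_Y_Y c field_simps)
qed

text \<open>Ensures that the \<open>SOME\<close> in \<open>level_jacobian\<close> picks a genuine
  frame: the differential does not vanish on \<open>Y\<close>, so its kernel has dimension n -
  1.\<close>

lemma level_frame_exists:
  assumes c: "c \<in> A" "x \<in> fst c"
  obtains k e where "level_frame g u c x k e"
proof -
  let ?K = "{v. differential u c x v = 0}"
  interpret linear "differential u c x" by (rule linear_differential[OF c])
  define a where "a = (\<chi> i. differential u c x (axis i 1))"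
  have du: "differential u c x w = a \<bullet> w" for w
  proof -
    have "differential u c x w = differential u c x (\<Sum>i\<in>UNIV. w $ i *\<^sub>R axis i 1)"
      using basis_expansion[of w] by (simp add: scalar_mult_eq_scaleR)
    also have "\<dots> = a \<bullet> w"
      by (simp add: sum scaleR inner_vec_def mult.commute a_def)
    finally show ?thesis .
  qed
  have "a \<noteq> 0" using differential_Y[OF c] by (auto simp: du)
  then have dim: "dim ?K = CARD('n) - 1" unfolding du by (simp add: dim_hyperplane)
  have "subspace ?K" unfolding du by (rule subspace_hyperplane)
  then obtain B where B: "B \<subseteq> ?K" "finite B" "card B = dim ?K"
    "\<forall>v\<in>B. \<forall>w\<in>B. ginner g c x v w = of_bool (v = w)"
    using orthonormal_basis_exists[of g c x ?K, OF g_sym[OF c] g_pos[OF c]] by blast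
  \<comment> \<open>The choice of index is free; the other n - 1 indices label the basis of the
    kernel.\<close>
  fix k :: 'n
  have "card (UNIV - {k}) = card B" using B(3) dim by (simp add: card_Diff_singleton)
  then obtain e where e: "bij_betw e (UNIV - {k}) B"
    using finite_same_card_bij[of "UNIV - {k}" B] B(2) by auto
  have "level_frame g u c x k e"
    unfolding level_frame_def
  proof (intro conjI allI impI)
    fix i j assume "i \<noteq> k" "j \<noteq> k"
    then show "ginner g c x (e i) (e j) = of_bool (i = j)"
      using e B(4) by (auto simp: bij_betw_def inj_on_def)
  next
    fix i assume "i \<noteq> k"
    then show "differential u c x (e i) = 0" using e B(1) by (auto simp: bij_betw_def)
  qed
  then show ?thesis by (rule that)
qed

end

section \<open>Maps shifting the level sets\<close>

text \<open>Applied to coordinate lines inside a slice, along which \<open>u\<close>, or the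
  struck-out coordinate of an image point, is constant.\<close>

lemma derivative_eq_0_if_constant_along:
  fixes F :: "'a::real_normed_vector \<Rightarrow> 'b::real_normed_vector"
  assumes F: "(F has_derivative F') (at y)" and U: "open U" "y \<in> U"
    and const: "\<And>r. y + r *\<^sub>R v \<in> U \<Longrightarrow> F (y + r *\<^sub>R v) = k"
  shows "F' v = 0"
proof -
  have line: "((\<lambda>r. y + r *\<^sub>R v) has_derivative (\<lambda>r. r *\<^sub>R v)) (at 0)"
    by (auto intro!: derivative_eq_intros)
  have "((\<lambda>r. F (y + r *\<^sub>R v)) has_derivative (\<lambda>r. F' (r *\<^sub>R v))) (at (0::real))"
    by (rule has_derivative_compose[OF line]) (use F in simp)
  moreover have "((\<lambda>r. F (y + r *\<^sub>R v)) has_derivative (\<lambda>r. 0)) (at (0::real))"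
  proof (rule has_derivative_transform_within_open[where f = "\<lambda>_. k"])
    show "open ((\<lambda>r. y + r *\<^sub>R v) -` U)"
      by (intro open_vimage U continuous_intros)
  qed (use U const in auto)
  ultimately have "(\<lambda>r. F' (r *\<^sub>R v)) = (\<lambda>r. 0)" by (rule has_derivative_unique)
  from fun_cong[OF this, of 1] show ?thesis by simp
qed

context regular_function
begin

text \<open>What the change of variables between level sets requires of a flow map. The identity
  with shift 0 qualifies as well, so comparing two slice charts of one level set becomes a special
  case of comparing two level sets.\<close>

definition shift_map :: "real \<Rightarrow> 'm set \<Rightarrow> ('m \<Rightarrow> 'm) \<Rightarrow> bool" where
  "shift_map \<tau> N f \<longleftrightarrow> open N \<and> N \<subseteq> carrier A \<and> continuous_on N f \<and> f ` N \<subseteq> carrier A \<and>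
     (\<forall>x\<in>N. u (f x) = u x + \<tau>) \<and>
     (\<forall>c\<in>A. \<forall>d\<in>A. Ck_on 1 (snd c ` (fst c \<inter> (N \<inter> f -` fst d))) (snd d \<circ> f \<circ> cinv c))"

lemma shift_map_id: "shift_map 0 (carrier A) (\<lambda>x. x)"
  unfolding shift_map_def
proof (intro conjI ballI)
  fix c d assume cd: "c \<in> A" "d \<in> A"
  have "fst c \<inter> (carrier A \<inter> (\<lambda>x. x) -` fst d) = fst c \<inter> fst d"
    using in_carrier[OF cd(1)] by auto
  then show "Ck_on 1 (snd c ` (fst c \<inter> (carrier A \<inter> (\<lambda>x. x) -` fst d))) (snd d \<circ> (\<lambda>x. x) \<circ> cinv c)"
    using C1_atlas[OF cd] by (simp add: C1_charts_def Ck_compatible_def o_def)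
qed (auto simp: open_carrier)

lemma shift_map_open: "shift_map \<tau> N f \<Longrightarrow> open U \<Longrightarrow> open (N \<inter> f -` U)"
  unfolding shift_map_def by (metis continuous_on_open_vimage Int_commute)

definition deriv_rep :: "('m \<Rightarrow> 'm) \<Rightarrow> ('m, 'n) chart \<Rightarrow> ('m, 'n) chart \<Rightarrow> 'm \<Rightarrow> real ^ 'n \<Rightarrow> real ^ 'n" where
  "deriv_rep f c d x = frechet_derivative (snd d \<circ> f \<circ> cinv c) (at (snd c x))"

lemma deriv_rep:
  assumes f: "shift_map \<tau> N f" and c: "c \<in> A" "x \<in> fst c" "x \<in> N" and d: "d \<in> A" "f x \<in> fst d"
  shows "(snd d \<circ> f \<circ> cinv c has_derivative deriv_rep f c d x) (at (snd c x))"
  unfolding deriv_rep_def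
proof (rule Ck_on_has_derivative)
  show "Ck_on (Suc 0) (snd c ` (fst c \<inter> (N \<inter> f -` fst d))) (snd d \<circ> f \<circ> cinv c)"
    using f c d by (auto simp: shift_map_def)
  show "open (snd c ` (fst c \<inter> (N \<inter> f -` fst d)))"
    by (intro open_chart_image chart c shift_map_open[OF f] chartD d)
qed (use c d in auto)

lemma linear_deriv_rep:
  assumes "shift_map \<tau> N f" "c \<in> A" "x \<in> fst c" "x \<in> N" "d \<in> A" "f x \<in> fst d"
  shows "linear (deriv_rep f c d x)"
  using deriv_rep[OF assms] by (rule has_derivative_linear)

text \<open>The charts \<open>c'\<close> and \<open>d'\<close> may be slice charts, which are only compatible with the atlas.\<close>

lemma rep_Ck:
  assumes f: "shift_map \<tau> N f"
    and c': "is_chart c'" "fst c' \<subseteq> carrier A" "\<And>a. a \<in> A \<Longrightarrow> C1_charts c' a"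
    and d': "is_chart d'" "\<And>a. a \<in> A \<Longrightarrow> C1_charts a d'"
  shows "Ck_on 1 (snd c' ` (fst c' \<inter> (N \<inter> f -` fst d'))) (snd d' \<circ> f \<circ> cinv c')"
proof (rule Ck_on_local)
  show "open (snd c' ` (fst c' \<inter> (N \<inter> f -` fst d')))"
    by (intro open_chart_image c' shift_map_open[OF f] is_chartD d')
next
  fix y assume "y \<in> snd c' ` (fst c' \<inter> (N \<inter> f -` fst d'))"
  then obtain x where x: "x \<in> fst c'" "x \<in> N" "f x \<in> fst d'" "y = snd c' x" by auto
  have "f x \<in> carrier A" using x f by (auto simp: shift_map_def)
  then obtain c d where c: "c \<in> A" "x \<in> fst c" and d: "d \<in> A" "f x \<in> fst d"
    using x c'(2) by (metis chart_at subsetD)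
  note cD = is_chartD[OF c'(1)] chartD[OF c(1)] and dD = is_chartD[OF d'(1)] chartD[OF d(1)]
  define W where "W = N \<inter> f -` (fst d \<inter> fst d')"
  have W: "open W" unfolding W_def using dD by (intro shift_map_open[OF f]) auto
  define V where "V = fst c' \<inter> (fst c \<inter> W)"
  have 1: "Ck_on 1 (snd c' ` V) (snd c \<circ> cinv c')"
    using c'(3)[OF c(1)] by (auto simp: C1_charts_def Ck_compatible_def V_def elim!: Ck_on_subset)
  have "snd c ` (fst c \<inter> W) \<subseteq> snd c ` (fst c \<inter> (N \<inter> f -` fst d))"
    by (auto simp: W_def)
  moreover have "Ck_on 1 (snd c ` (fst c \<inter> (N \<inter> f -` fst d))) (snd d \<circ> f \<circ> cinv c)"
    using f c d by (simp add: shift_map_def)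
  ultimately have 2: "Ck_on 1 (snd c ` (fst c \<inter> W)) (snd d \<circ> f \<circ> cinv c)"
    using Ck_on_subset by blast
  have 3: "Ck_on 1 (snd d ` (fst d \<inter> fst d')) (snd d' \<circ> cinv d)"
    using d'(2)[OF d(1)] by (auto simp: C1_charts_def Ck_compatible_def)
  have V: "open (snd c' ` V)" unfolding V_def
    using W cD by (intro open_chart_image c') auto
  have cW: "open (snd c ` (fst c \<inter> W))" by (intro open_chart_image chart c W)
  have "Ck_on 1 (snd c' ` V) ((snd d' \<circ> cinv d) \<circ> ((snd d \<circ> f \<circ> cinv c) \<circ> (snd c \<circ> cinv c')))"
  proof (rule Ck_on_compose[OF V _ _ Ck_on_compose[OF V cW _ 1 2] 3])
    show "open (snd d ` (fst d \<inter> fst d'))" using dD by (intro open_chart_image chart d) auto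
    show "(snd c \<circ> cinv c') ` snd c' ` V \<subseteq> snd c ` (fst c \<inter> W)"
      using cD by (auto simp: V_def)
    show "((snd d \<circ> f \<circ> cinv c) \<circ> (snd c \<circ> cinv c')) ` snd c' ` V \<subseteq> snd d ` (fst d \<inter> fst d')"
      using cD by (auto simp: V_def W_def)
  qed
  then have "Ck_on 1 (snd c' ` V) (snd d' \<circ> f \<circ> cinv c')"
    by (rule Ck_on_cong[OF V, rotated]) (use cD dD in \<open>auto simp: V_def W_def\<close>)
  moreover have "y \<in> snd c' ` V" using x c d by (auto simp: V_def W_def)
  ultimately show "\<exists>T. open T \<and> y \<in> T \<and> Ck_on 1 T (snd d' \<circ> f \<circ> cinv c')"
    using V by blast
qed

lemma rep_has_derivative:
  assumes f: "shift_map \<tau> N f"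
    and c: "c \<in> A" "x \<in> fst c" and d: "d \<in> A" "f x \<in> fst d"
    and c': "C1_charts c' c" "x \<in> fst c'" and d': "C1_charts d d'" "f x \<in> fst d'" and x: "x \<in> N"
  shows "(snd d' \<circ> f \<circ> cinv c' has_derivative
    (\<lambda>v. transition d d' (f x) (deriv_rep f c d x (transition c' c x v)))) (at (snd c' x))"
proof -
  have ch: "is_chart c'" "is_chart d'" using c' d' by (auto simp: C1_charts_def)
  note cD = is_chartD[OF ch(1)] chartD[OF c(1)] and dD = is_chartD[OF ch(2)] chartD[OF d(1)]
  have 1: "((snd d \<circ> f \<circ> cinv c) \<circ> (snd c \<circ> cinv c') has_derivative deriv_rep f c d x \<circ> transition c' c x) (at (snd c' x))"
    by (intro diff_chain_at transition_has_derivative) (use c' c d x cD deriv_rep[OF f c x d] in auto)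
  have "((snd d' \<circ> cinv d) \<circ> ((snd d \<circ> f \<circ> cinv c) \<circ> (snd c \<circ> cinv c')) has_derivative
      transition d d' (f x) \<circ> (deriv_rep f c d x \<circ> transition c' c x)) (at (snd c' x))"
  proof (rule diff_chain_at[OF 1])
    have "((snd d \<circ> f \<circ> cinv c) \<circ> (snd c \<circ> cinv c')) (snd c' x) = snd d (f x)"
      using cD c c' by simp
    then show "(snd d' \<circ> cinv d has_derivative transition d d' (f x))
        (at (((snd d \<circ> f \<circ> cinv c) \<circ> (snd c \<circ> cinv c')) (snd c' x)))"
      using transition_has_derivative[OF d'(1) d(2) d'(2)] by simp
  qed
  then have "(snd d' \<circ> f \<circ> cinv c' has_derivative
      transition d d' (f x) \<circ> (deriv_rep f c d x \<circ> transition c' c x)) (at (snd c' x))"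
  proof (rule has_derivative_transform_within_open)
    show "open (snd c' ` (fst c' \<inter> (fst c \<inter> (N \<inter> f -` fst d))))"
      by (rule open_chart_image[OF ch(1) open_Int[OF chartD(1)[OF c(1)] shift_map_open[OF f chartD(1)[OF d(1)]]]])
    show "((snd d' \<circ> cinv d) \<circ> ((snd d \<circ> f \<circ> cinv c) \<circ> (snd c \<circ> cinv c'))) y = (snd d' \<circ> f \<circ> cinv c') y"
      if "y \<in> snd c' ` (fst c' \<inter> (fst c \<inter> (N \<inter> f -` fst d)))" for y
      using that cD dD by auto
  qed (use c c' d x in auto)
  then show ?thesis by (simp add: o_def)
qed

lemma deriv_rep_trans:
  assumes f: "shift_map \<tau> N f" and x: "x \<in> N"
    and c: "c \<in> A" "x \<in> fst c" "c' \<in> A" "x \<in> fst c'"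
    and d: "d \<in> A" "f x \<in> fst d" "d' \<in> A" "f x \<in> fst d'"
  shows "deriv_rep f c' d' x (transition c c' x v) = transition d d' (f x) (deriv_rep f c d x v)"
proof -
  have "deriv_rep f c' d' x w = transition d d' (f x) (deriv_rep f c d x (transition c' c x w))" for w
    using has_derivative_unique[OF deriv_rep[OF f c(3,4) x d(3,4)]
        rep_has_derivative[OF f c(1,2) d(1,2) C1_atlas[OF c(3,1)] c(4) C1_atlas[OF d(1,3)] d(4) x]]
    by metis
  then show ?thesis using trans_inv[OF c(1,3,2,4)] by simp
qed

text \<open>Differentiates \<open>u (f x) = u x + \<tau>\<close>; the constant drops out. In
  particular the derivative of \<open>f\<close> takes tangent vectors of level sets to tangent
  vectors of level sets.\<close>

lemma differential_deriv_rep: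
  assumes f: "shift_map \<tau> N f" and x: "x \<in> N" and c: "c \<in> A" "x \<in> fst c" and d: "d \<in> A" "f x \<in> fst d"
  shows "differential u d (f x) (deriv_rep f c d x v) = differential u c x v"
proof -
  note cD = chartD[OF c(1)] and dD = chartD[OF d(1)]
  have "((u \<circ> cinv d) \<circ> (snd d \<circ> f \<circ> cinv c) has_derivative differential u d (f x) \<circ> deriv_rep f c d x) (at (snd c x))"
    by (rule diff_chain_at[OF deriv_rep[OF f c x d]])
      (use differential_has_derivative[OF d] cD c in simp)
  moreover have "((u \<circ> cinv d) \<circ> (snd d \<circ> f \<circ> cinv c) has_derivative differential u c x) (at (snd c x))"
  proof (rule has_derivative_transform_within_open[where f = "\<lambda>y. (u \<circ> cinv c) y + \<tau>"])
    show "((\<lambda>y. (u \<circ> cinv c) y + \<tau>) has_derivative differential u c x) (at (snd c x))"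
      using has_derivative_add[OF differential_has_derivative[OF c] has_derivative_const[of \<tau>]] by simp
    show "open (snd c ` (fst c \<inter> (N \<inter> f -` fst d)))"
      using shift_map_open[OF f] cD dD by (intro open_chart_image chart c) auto
    show "(u \<circ> cinv c) y + \<tau> = ((u \<circ> cinv d) \<circ> (snd d \<circ> f \<circ> cinv c)) y"
      if "y \<in> snd c ` (fst c \<inter> (N \<inter> f -` fst d))" for y
      using that cD dD f by (auto simp: shift_map_def)
  qed (use c d x in auto)
  ultimately show ?thesis using has_derivative_unique by (metis comp_apply)
qed

text \<open>The derivative of \<open>f\<close>, corrected in the direction transversal to the level sets so that
  it maps $Y$ to $Y$; its determinant computes the Jacobian along level sets.\<close>

definition deriv_corr :: "('m \<Rightarrow> 'm) \<Rightarrow> ('m, 'n) chart \<Rightarrow> ('m, 'n) chart \<Rightarrow> 'm \<Rightarrow> real ^ 'n \<Rightarrow> real ^ 'n" where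
  "deriv_corr f c d x w = deriv_rep f c d x w +
     differential u c x w *\<^sub>R (Y d (f x) - deriv_rep f c d x (Y c x))"

lemma linear_deriv_corr:
  assumes "shift_map \<tau> N f" "c \<in> A" "x \<in> fst c" "x \<in> N" "d \<in> A" "f x \<in> fst d"
  shows "linear (deriv_corr f c d x)"
  using linear_deriv_rep[OF assms] linear_differential[OF assms(2,3)]
  by (intro linearI) (auto simp: deriv_corr_def linear_add linear_scale algebra_simps)

lemma deriv_corr_Y: "c \<in> A \<Longrightarrow> x \<in> fst c \<Longrightarrow> deriv_corr f c d x (Y c x) = Y d (f x)"
  by (simp add: deriv_corr_def differential_Y)

lemma deriv_corr_tangent: "differential u c x w = 0 \<Longrightarrow> deriv_corr f c d x w = deriv_rep f c d x w"
  by (simp add: deriv_corr_def)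

lemma level_frame_minor_det:
  "level_frame g u c x k e \<Longrightarrow> minor_det k (gram g c x e) = 1"
  by (rule minor_det_orthonormal) (simp add: level_frame_def gram_def)

lemma level_jacobian_frame:
  assumes x: "x \<in> carrier A"
  obtains k e where
    "level_frame g u (chart_at A x) x k e"
    "\<And>f. level_jacobian A g u f x =
      sqrt (minor_det k (gram g (chart_at A (f x)) (f x)
        (\<lambda>i. deriv_rep f (chart_at A x) (chart_at A (f x)) x (e i))))"
proof -
  let ?c = "chart_at A x"
  obtain k0 e0 where "level_frame g u ?c x k0 e0"
    using level_frame_exists chart_at[OF x] by blast
  moreover obtain k e where ke: "(SOME (k, e). level_frame g u ?c x k e) = (k, e)"
    by (metis surj_pair)
  ultimately have "level_frame g u ?c x k e"
    using someI[of "\<lambda>(k, e). level_frame g u ?c x k e" "(k0, e0)"] by simp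
  then show ?thesis
    by (rule that) (simp add: level_jacobian_def Let_def ke deriv_rep_def)
qed

text \<open>One frame at \<open>x\<close> serves all shift maps \<open>f\<close> and all charts
  \<open>d\<close> around the image point. This uniformity allows differentiation in
  \<open>t\<close> later, when \<open>f\<close> runs through the flow maps. Moving the frame from
  the distinguished chart to \<open>c\<close> is harmless because the metric is a tensor.\<close>

lemma level_jacobian_eq_deriv_rep:
  assumes x: "x \<in> carrier A" and c: "c \<in> A" "x \<in> fst c"
  obtains k e where "\<And>i. i \<noteq> k \<Longrightarrow> differential u c x (e i) = 0" "minor_det k (gram g c x e) = 1"
    "\<And>\<tau> N f d. shift_map \<tau> N f \<Longrightarrow> x \<in> N \<Longrightarrow> d \<in> A \<Longrightarrow> f x \<in> fst d \<Longrightarrow>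
      level_jacobian A g u f x = sqrt (minor_det k (gram g d (f x) (\<lambda>i. deriv_rep f c d x (e i))))"
proof -
  let ?a = "chart_at A x"
  note a = chart_at[OF x]
  obtain k e where ke: "level_frame g u ?a x k e" "\<And>f. level_jacobian A g u f x =
      sqrt (minor_det k (gram g (chart_at A (f x)) (f x) (\<lambda>i. deriv_rep f ?a (chart_at A (f x)) x (e i))))"
    using level_jacobian_frame[OF x] by blast
  show ?thesis
  proof (rule that[of k "\<lambda>i. transition ?a c x (e i)"])
    show "differential u c x (transition ?a c x (e i)) = 0" if "i \<noteq> k" for i
      using ke(1) that differential_trans[OF a(1) c(1) a(2) c(2)] by (simp add: level_frame_def)
    show "minor_det k (gram g c x (\<lambda>i. transition ?a c x (e i))) = 1"
      using level_frame_minor_det[OF ke(1)] gram_trans[OF a(1) c(1) a(2) c(2)] by simp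
    fix \<tau> N f d assume f: "shift_map \<tau> N f" "x \<in> N" and d: "d \<in> A" "f x \<in> fst d"
    have "f x \<in> carrier A" using f by (auto simp: shift_map_def)
    note b = chart_at[OF this]
    show "level_jacobian A g u f x = sqrt (minor_det k (gram g d (f x)
        (\<lambda>i. deriv_rep f c d x (transition ?a c x (e i)))))"
      using ke(2) gram_trans[OF b(1) d(1) b(2) d(2)] deriv_rep_trans[OF f a c b d] by simp
  qed
qed

text \<open>The frame enters the Jacobian only through the determinant \<open>?D\<close> of its
  completion by \<open>Y\<close>, and orthonormality fixes \<open>\<bar>?D\<bar>\<close>. What
  remains is free of the frame.\<close>

lemma level_jacobian_eq:
  assumes f: "shift_map \<tau> N f" and x: "x \<in> N" and c: "c \<in> A" "x \<in> fst c" and d: "d \<in> A" "f x \<in> fst d"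
  shows "level_jacobian A g u f x =
    grad_norm A g u (f x) / grad_norm A g u x * sqrt (det (g d (f x)) / det (g c x)) *
      \<bar>det (matrix (deriv_corr f c d x))\<bar>"
proof -
  obtain k e where e: "\<And>i. i \<noteq> k \<Longrightarrow> differential u c x (e i) = 0" "minor_det k (gram g c x e) = 1"
    "\<And>\<tau> N f d. shift_map \<tau> N f \<Longrightarrow> x \<in> N \<Longrightarrow> d \<in> A \<Longrightarrow> f x \<in> fst d \<Longrightarrow>
      level_jacobian A g u f x = sqrt (minor_det k (gram g d (f x) (\<lambda>i. deriv_rep f c d x (e i))))"
    using level_jacobian_eq_deriv_rep[OF in_carrier[OF c] c] by blast
  let ?n = "grad_norm A g u x" and ?n' = "grad_norm A g u (f x)"
  let ?D = "det (cols (e(k := Y c x)))"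
  have pos: "?n > 0" "?n' > 0" "det (g c x) > 0" "det (g d (f x)) > 0"
    using gn_pos det_g_pos c d by auto
  \<comment> \<open>The minor of an orthonormal frame is 1, which determines the volume of the frame
    completed by \<open>Y\<close>.\<close>
  have 1: "?n\<^sup>2 * det (g c x) * ?D\<^sup>2 = 1"
    using minor_det_gram[OF c e(1)] e(2) by simp
  have "sqrt (?n\<^sup>2 * det (g c x) * ?D\<^sup>2) = ?n * sqrt (det (g c x)) * \<bar>?D\<bar>"
    using pos by (simp add: real_sqrt_mult)
  with 1 have D: "?n * sqrt (det (g c x)) * \<bar>?D\<bar> = 1" by simp
  have "(\<lambda>i. deriv_rep f c d x (e i))(k := Y d (f x)) = (\<lambda>i. deriv_corr f c d x ((e(k := Y c x)) i))"
    using e(1) by (auto simp: deriv_corr_tangent deriv_corr_Y c)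
  then have 2: "det (cols ((\<lambda>i. deriv_rep f c d x (e i))(k := Y d (f x)))) =
      det (matrix (deriv_corr f c d x)) * ?D"
    using det_cols_linear[OF linear_deriv_corr[OF f c x d], of "e(k := Y c x)"] by simp
  have "level_jacobian A g u f x = sqrt (?n'\<^sup>2 * det (g d (f x)) * (det (matrix (deriv_corr f c d x)) * ?D)\<^sup>2)"
    unfolding e(3)[OF f x d] 2[symmetric]
    by (subst minor_det_gram[OF d]) (use e(1) differential_deriv_rep[OF f x c d] in auto)
  also have "\<dots> = ?n' * sqrt (det (g d (f x))) * \<bar>det (matrix (deriv_corr f c d x))\<bar> * \<bar>?D\<bar>"
    using pos by (simp add: real_sqrt_mult abs_mult)
  also have "\<bar>?D\<bar> = 1 / (?n * sqrt (det (g c x)))"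
    using D pos by (simp add: field_simps)
  finally show ?thesis using pos by (simp add: real_sqrt_divide field_simps)
qed

text \<open>The identity is demanded on \<open>N\<close> only, since \<open>\<psi> 0\<close> is
  known to be the identity only there.\<close>

lemma level_jacobian_ident:
  assumes f: "shift_map \<tau> N f" and x: "x \<in> N" and id: "\<And>y. y \<in> N \<Longrightarrow> f y = y"
  shows "level_jacobian A g u f x = 1"
proof -
  have N: "N \<subseteq> carrier A" "open N" using f by (auto simp: shift_map_def)
  define c where "c = chart_at A x"
  have c: "c \<in> A" "x \<in> fst c" using chart_at[of x] N x by (auto simp: c_def)
  note ch = chart[OF c(1)]
  have fc: "f x \<in> fst c" using id[OF x] c by simp
  have "deriv_rep f c c x = transition c c x"
    unfolding deriv_rep_def transition_def
  proof (rule frechet_derivative_cong_open)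
    show "open (snd c ` (fst c \<inter> N))" by (rule open_chart_image[OF ch N(2)])
    show "(snd c \<circ> f \<circ> cinv c) y = (snd c \<circ> cinv c) y" if "y \<in> snd c ` (fst c \<inter> N)" for y
      using that id is_chartD(3)[OF ch] by auto
  qed (use c x in auto)
  then have "deriv_rep f c c x v = v" for v
    using transition_self[OF ch c(2)] by simp
  then have "deriv_corr f c c x = (\<lambda>v. v)"
    using id[OF x] by (simp add: deriv_corr_def fun_eq_iff)
  then show ?thesis
    using level_jacobian_eq[OF f x c c(1) fc] gn_pos[OF c] det_g_pos[OF c] id[OF x]
    by (simp add: matrix_id_mat_1[unfolded id_def])
qed

section \<open>Continuity of the Jacobian along level sets\<close>

lemma continuous_on_Y: "c \<in> A \<Longrightarrow> continuous_on (fst c) (Y c)"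
proof -
  assume c: "c \<in> A"
  note ch = chartD[OF c]
  have "continuous_on (fst c) (\<lambda>x. Y c (cinv c (snd c x)))"
    by (rule continuous_on_compose2[OF Ck_on_imp_continuous_on[OF ch(2) Y_Ck[OF c]] ch(6)]) auto
  then show ?thesis by (rule continuous_on_eq) (simp add: ch)
qed

lemma continuous_on_differential: "c \<in> A \<Longrightarrow> continuous_on (fst c) (\<lambda>x. differential u c x v)"
proof -
  assume c: "c \<in> A"
  note ch = chartD[OF c]
  have "continuous_on (fst c) (\<lambda>x. differential u c (cinv c (snd c x)) v)"
    by (rule continuous_on_compose2[OF Ck_on_imp_continuous_on[OF ch(2) differential_Ck[OF c]] ch(6)]) auto
  then show ?thesis by (rule continuous_on_eq) (simp add: ch)
qed

lemma continuous_on_g: "c \<in> A \<Longrightarrow> continuous_on (fst c) (\<lambda>x. g c x $ i $ j)"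
proof -
  assume c: "c \<in> A"
  note ch = chartD[OF c]
  have "continuous_on (fst c) (\<lambda>x. g c (cinv c (snd c x)) $ i $ j)"
    by (rule continuous_on_compose2[OF Ck_on_imp_continuous_on[OF ch(2) g_Ck[OF c]] ch(6)]) auto
  then show ?thesis by (rule continuous_on_eq) (simp add: ch)
qed

lemma continuous_on_deriv_rep:
  assumes f: "shift_map \<tau> N f" and c: "c \<in> A" and d: "d \<in> A"
  shows "continuous_on (fst c \<inter> (N \<inter> f -` fst d)) (\<lambda>x. deriv_rep f c d x v)"
proof -
  have "continuous_on (snd c ` (fst c \<inter> (N \<inter> f -` fst d))) (\<lambda>y. frechet_derivative (snd d \<circ> f \<circ> cinv c) (at y) v)"
    using f c d by (intro continuous_on_frechet[of 0] open_chart_image chart shift_map_open[OF f] chartD)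
      (auto simp: shift_map_def)
  then show ?thesis
    unfolding deriv_rep_def
    by (rule continuous_on_compose2[of _ _ _ "snd c"])
      (auto intro: continuous_on_subset[OF chartD(6)[OF c]])
qed

text \<open>The frame chosen at each point may jump, but \<open>level_jacobian_eq\<close> expresses
  the Jacobian near a point by continuous quantities in two fixed charts.\<close>

lemma continuous_on_level_jacobian:
  assumes f: "shift_map \<tau> N f"
  shows "continuous_on N (level_jacobian A g u f)"
proof -
  have N: "N \<subseteq> carrier A" "f ` N \<subseteq> carrier A" "continuous_on N f" using f by (auto simp: shift_map_def)
  have "\<exists>V. open V \<and> x \<in> V \<and> continuous_on V (level_jacobian A g u f)" if x: "x \<in> N" for x
  proof -
    obtain c d where c: "c \<in> A" "x \<in> fst c" and d: "d \<in> A" "f x \<in> fst d"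
      using N x by (metis chart_at image_subset_iff subsetD)
    define V where "V = fst c \<inter> (N \<inter> f -` fst d)"
    have V: "open V" unfolding V_def
      by (rule open_Int[OF chartD(1)[OF c(1)] shift_map_open[OF f chartD(1)[OF d(1)]]])
    have sub: "continuous_on V f" "f ` V \<subseteq> fst d" "f ` V \<subseteq> carrier A" "V \<subseteq> carrier A" "V \<subseteq> fst c"
      using N d in_carrier by (auto simp: V_def intro: continuous_on_subset)
    have Df: "continuous_on V (\<lambda>x. deriv_rep f c d x v)" for v
      using continuous_on_deriv_rep[OF f c(1) d(1)] by (simp add: V_def)
    have Yc: "continuous_on V (Y c)" and Yd: "continuous_on V (\<lambda>x. Y d (f x))"
      using continuous_on_compose2[OF continuous_on_Y[OF d(1)] sub(1,2)] continuous_on_subset[OF continuous_on_Y[OF c(1)] sub(5)]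
      by auto
    \<comment> \<open>Continuity of the derivative is available for fixed directions only; the
      moving direction \<open>Y c x\<close> is expanded in the standard basis.\<close>
    have DfY: "continuous_on V (\<lambda>x. deriv_rep f c d x (Y c x))"
    proof (rule continuous_on_eq)
      show "continuous_on V (\<lambda>x. \<Sum>i\<in>UNIV. Y c x $ i *\<^sub>R deriv_rep f c d x (axis i 1))"
        by (intro continuous_intros Df Yc)
      fix z assume "z \<in> V"
      then have lin: "linear (deriv_rep f c d z)"
        by (intro linear_deriv_rep[OF f]) (auto simp: V_def c d)
      show "(\<Sum>i\<in>UNIV. Y c z $ i *\<^sub>R deriv_rep f c d z (axis i 1)) = deriv_rep f c d z (Y c z)"
        using basis_expansion[of "Y c z"]
        by (simp add: scalar_mult_eq_scaleR linear_scale[OF lin, symmetric] linear_sum[OF lin, symmetric])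
    qed
    have du: "continuous_on V (\<lambda>x. differential u c x v)" for v
      using continuous_on_subset[OF continuous_on_differential[OF c(1)] sub(5)] .
    have corr: "continuous_on V (\<lambda>x. deriv_corr f c d x v)" for v
      unfolding deriv_corr_def by (intro continuous_intros Df du Yd DfY)
    have mat: "continuous_on V (\<lambda>x. matrix (deriv_corr f c d x) $ i $ j)" for i j
      unfolding matrix_def using corr by (auto intro!: continuous_intros)
    have gn': "continuous_on V (\<lambda>x. grad_norm A g u (f x))"
      by (rule continuous_on_compose2[OF continuous_on_grad_norm sub(1,3)])
    have gn: "continuous_on V (\<lambda>x. grad_norm A g u x)"
      using continuous_on_subset[OF continuous_on_grad_norm sub(4)] .
    have gd: "continuous_on V (\<lambda>x. g d (f x) $ i $ j)" for i j
      by (rule continuous_on_compose2[OF continuous_on_g[OF d(1)] sub(1,2)])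
    have gc: "continuous_on V (\<lambda>x. g c x $ i $ j)" for i j
      using continuous_on_subset[OF continuous_on_g[OF c(1)] sub(5)] .
    have nz: "\<forall>x\<in>V. grad_norm A g u x \<noteq> 0" "\<forall>x\<in>V. det (g c x) \<noteq> 0"
      using gn_pos[OF c(1)] det_g_pos[OF c(1)] sub(5) by (metis less_irrefl subsetD)+
    have "continuous_on V (\<lambda>x. grad_norm A g u (f x) / grad_norm A g u x * sqrt (det (g d (f x)) / det (g c x)) *
      \<bar>det (matrix (deriv_corr f c d x))\<bar>)"
      by (intro continuous_on_mult continuous_on_divide continuous_on_real_sqrt continuous_on_rabs
          continuous_on_det mat gn gn' gc gd nz)
    then have "continuous_on V (level_jacobian A g u f)"
      by (rule continuous_on_eq) (use c d in \<open>auto simp: V_def level_jacobian_eq[OF f]\<close>)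
    then show ?thesis using V x c d by (auto simp: V_def)
  qed
  then show ?thesis
    by (meson continuous_at_imp_continuous_on continuous_on_eq_continuous_at)
qed

end

section \<open>Slice charts\<close>

definition slice_mass ::
  "('m::topological_space, 'n::finite) chart set \<Rightarrow> ('m, 'n) metric \<Rightarrow> 'n \<Rightarrow> ('m, 'n) chart \<Rightarrow> 'm set \<Rightarrow> ennreal" where
  "slice_mass A g k c E = (\<integral>\<^sup>+ z. (if slice_point k z \<in> snd c ` E
     then ennreal (slice_density A g k c (cinv c (slice_point k z))) else 0) \<partial>(Pi\<^sub>M (UNIV - {k}) (\<lambda>_. lborel)))"

context regular_function
begin

lemma slice_chartD:
  assumes "slice_chart A S k c"
  shows "is_chart c" "fst c \<subseteq> carrier A" "\<And>x. x \<in> fst c \<Longrightarrow> x \<in> S \<longleftrightarrow> snd c x $ k = 0"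
    "\<And>a. a \<in> A \<Longrightarrow> C1_charts c a" "\<And>a. a \<in> A \<Longrightarrow> C1_charts a c"
proof -
  show c: "is_chart c" "fst c \<subseteq> carrier A" "\<And>x. x \<in> fst c \<Longrightarrow> x \<in> S \<longleftrightarrow> snd c x $ k = 0"
    using assms by (auto simp: slice_chart_def)
  show *: "C1_charts c a" if a: "a \<in> A" for a
  proof -
    have "open (snd c ` (fst c \<inter> fst a))" "open (snd a ` (fst c \<inter> fst a))"
      using open_chart_image[OF c(1) chartD(1)[OF a]] open_chart_image[OF chart[OF a] is_chartD(1)[OF c(1)]]
      by (simp_all add: Int_commute)
    moreover have "Ck_compatible 2 c a" using assms a by (simp add: slice_chart_def)
    ultimately show ?thesis
      unfolding C1_charts_def Ck_compatible_def using c(1) chart[OF a] Ck_on_mono[of _ 2 _ 1] by auto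
  qed
  show "C1_charts a c" if "a \<in> A" for a using *[OF that] by (rule C1_charts_sym)
qed

lemma slice_density_eq:
  assumes c: "slice_chart A S k c" "x \<in> fst c" and d: "d \<in> A" "x \<in> fst d"
  shows "slice_density A g k c x = sqrt (minor_det k (gram g d x (\<lambda>i. transition c d x (axis i 1))))"
proof -
  have "x \<in> carrier A" using c slice_chartD(2) by blast
  note a = chart_at[OF this]
  show ?thesis
    using transition_comp[OF slice_chartD(4)[OF c(1) a(1)] C1_atlas[OF a(1) d(1)] slice_chartD(4)[OF c(1) d(1)] c(2) a(2) d(2)]
      gram_trans[OF a(1) d(1) a(2) d(2), of "\<lambda>i. transition c (chart_at A x) x (axis i 1)"]
    by (simp add: slice_density_def Let_def transition_def)
qed

lemma continuous_on_slice_density: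
  assumes c: "slice_chart A S k c"
  shows "continuous_on (fst c) (slice_density A g k c)"
proof -
  have "\<exists>V. open V \<and> x \<in> V \<and> continuous_on V (slice_density A g k c)" if x: "x \<in> fst c" for x
  proof -
    have "x \<in> carrier A" using c x slice_chartD(2) by blast
    then obtain d where d: "d \<in> A" "x \<in> fst d" using chart_at by blast
    have V: "open (fst c \<inter> fst d)"
      by (rule open_Int[OF is_chartD(1)[OF slice_chartD(1)[OF c]] chartD(1)[OF d(1)]])
    have tr: "continuous_on (fst c \<inter> fst d) (\<lambda>x. transition c d x v)" for v
      by (rule continuous_on_transition[OF slice_chartD(4)[OF c d(1)]])
    have gc: "continuous_on (fst c \<inter> fst d) (\<lambda>x. g d x $ i $ j)" for i j
      using continuous_on_subset[OF continuous_on_g[OF d(1)]] by auto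
    have gr: "continuous_on (fst c \<inter> fst d) (\<lambda>x. gram g d x (\<lambda>i. transition c d x (axis i 1)) $ i $ j)" for i j
      unfolding gram_def ginner_def inner_vec_def matrix_vector_mult_def
      by (simp, intro continuous_intros gc tr)
    have "continuous_on (fst c \<inter> fst d) (\<lambda>x. sqrt (minor_det k (gram g d x (\<lambda>i. transition c d x (axis i 1)))))"
      unfolding minor_det_def
    proof (intro continuous_on_real_sqrt continuous_on_det)
      show "continuous_on (fst c \<inter> fst d) (\<lambda>x. (\<chi> i j. if i = k \<or> j = k then of_bool (i = j)
        else gram g d x (\<lambda>i. transition c d x (axis i 1)) $ i $ j) $ i $ j)" for i j
        using gr[of i j] by (cases "i = k \<or> j = k") auto
    qed
    then have "continuous_on (fst c \<inter> fst d) (slice_density A g k c)"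
      by (rule continuous_on_eq) (use slice_density_eq[OF c _ d(1)] in auto)
    then show ?thesis using V x d by blast
  qed
  then show ?thesis
    by (meson continuous_at_imp_continuous_on continuous_on_eq_continuous_at)
qed

text \<open>Moving along a coordinate other than \<open>k\<close> keeps the \<open>k\<close>-th
  coordinate at 0, hence stays in the level set, where \<open>u\<close> is constant.\<close>

lemma tangent_slice:
  assumes c: "slice_chart A (level_set A u t) k c" "x \<in> fst c" "x \<in> level_set A u t"
    and d: "d \<in> A" "x \<in> fst d" and i: "i \<noteq> k"
  shows "differential u d x (transition c d x (axis i 1)) = 0"
proof (rule derivative_eq_0_if_constant_along[OF chain_differential[OF slice_chartD(4)[OF c(1) d(1)] d(1) c(2) d(2)]])
  note cD = is_chartD[OF slice_chartD(1)[OF c(1)]]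
  show "open (snd c ` fst c)" "snd c x \<in> snd c ` fst c" using cD c by auto
  fix r assume r: "snd c x + r *\<^sub>R axis i 1 \<in> snd c ` fst c"
  have "(snd c x + r *\<^sub>R axis i 1) $ k = 0"
    using slice_chartD(3)[OF c(1,2)] c(3) i by (simp add: axis_def)
  then have "cinv c (snd c x + r *\<^sub>R axis i 1) \<in> level_set A u t"
    using slice_chartD(3)[OF c(1) cD(5)[OF r]] cD(4)[OF r] by simp
  then show "(u \<circ> cinv c) (snd c x + r *\<^sub>R axis i 1) = t" by (simp add: level_set_def)
qed

definition slice_basis :: "'n \<Rightarrow> ('m, 'n) chart \<Rightarrow> ('m, 'n) chart \<Rightarrow> 'm \<Rightarrow> 'n \<Rightarrow> real ^ 'n" where
  "slice_basis k c d x = (\<lambda>i. transition c d x (axis i 1))(k := Y d x)"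

lemma slice_density_level:
  assumes c: "slice_chart A (level_set A u t) k c" "x \<in> fst c" "x \<in> level_set A u t"
    and d: "d \<in> A" "x \<in> fst d"
  shows "slice_density A g k c x =
    grad_norm A g u x * sqrt (det (g d x)) * \<bar>det (cols (slice_basis k c d x))\<bar>"
  unfolding slice_density_eq[OF c(1,2) d] slice_basis_def
  using minor_det_gram[OF d, of k "\<lambda>i. transition c d x (axis i 1)"] tangent_slice[OF c d] gn_pos[OF d]
  by (simp add: real_sqrt_mult)

text \<open>In the bases \<open>slice_basis\<close>, where the struck-out position is filled by
  \<open>Y\<close>, the map \<open>deriv_corr\<close> has exactly the matrix of
  \<open>slice_extend_deriv\<close>: tangential directions transform by \<open>\<Theta>'\<close>,
  and \<open>Y\<close> goes to \<open>Y\<close>. Multiplicativity of the determinant then matches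
  the factors in \<open>slice_density_level\<close> and \<open>level_jacobian_eq\<close>.\<close>

lemma slice_jacobian:
  assumes f: "shift_map \<tau> N f" "x \<in> N"
    and c: "slice_chart A (level_set A u t) k c" "x \<in> fst c" "x \<in> level_set A u t"
    and c': "slice_chart A (level_set A u (t + \<tau>)) k' c'" "f x \<in> fst c'"
    and \<Theta>': "(snd c' \<circ> f \<circ> cinv c has_derivative \<Theta>') (at (snd c x))"
  shows "\<bar>det (matrix (slice_extend_deriv k k' \<Theta>'))\<bar> * slice_density A g k' c' (f x) =
    level_jacobian A g u f x * slice_density A g k c x"
proof -
  have fx: "f x \<in> level_set A u (t + \<tau>)" using f c(3) by (auto simp: level_set_def shift_map_def)
  obtain a d where a: "a \<in> A" "x \<in> fst a" and d: "d \<in> A" "f x \<in> fst d"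
    using c(3) fx chart_at by (metis (no_types, lifting) level_set_def mem_Collect_eq)
  note cD = is_chartD[OF slice_chartD(1)[OF c(1)]] and c'D = is_chartD[OF slice_chartD(1)[OF c'(1)]]
  define T where "T = slice_extend_deriv k k' \<Theta>'"
  have lin\<Theta>: "linear \<Theta>'" using \<Theta>' by (rule has_derivative_linear)
  have linT: "linear T"
  proof -
    have l: "linear (\<lambda>h. \<Theta>' (drop_coord k h))"
      using linear_compose[OF bounded_linear.linear[OF bounded_linear_drop_coord] lin\<Theta>] by (simp add: o_def)
    show ?thesis
      unfolding T_def slice_extend_deriv_def
      by (intro linearI) (auto simp: vec_eq_iff linear_add[OF l] linear_scale[OF l])
  qed
  let ?B = "cols (slice_basis k c a x)" and ?B' = "cols (slice_basis k' c' d (f x))"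
  have "?B' *v T (axis i 1) = deriv_corr f a d x (slice_basis k c a x i)" for i
  proof (cases "i = k")
    case True
    have drop: "drop_coord k (axis k (1::real)) = 0" by (simp add: vec_eq_iff axis_def)
    have "T (axis k 1) $ j = axis k' 1 $ j" for j
      unfolding T_def slice_extend_deriv_def drop linear_0[OF lin\<Theta>] by (simp add: axis_def)
    then have "T (axis i 1) = axis k' 1" using True by (simp add: vec_eq_iff)
    then show ?thesis
      using True by (simp add: cols_mult_axis slice_basis_def deriv_corr_Y a)
  next
    case False
    let ?w = "\<Theta>' (axis i 1)"
    have "((\<lambda>y. (snd c' \<circ> f \<circ> cinv c) y $ k') has_derivative (\<lambda>v. \<Theta>' v $ k')) (at (snd c x))"
      by (rule bounded_linear.has_derivative[OF bounded_linear_vec_nth \<Theta>'])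
    \<comment> \<open>Along this direction \<open>f\<close> stays in the target level set, where the
      \<open>k'\<close>-th slice coordinate is constantly 0.\<close>
    then have w0: "?w $ k' = 0"
    proof (rule derivative_eq_0_if_constant_along)
      let ?U = "snd c ` (fst c \<inter> (N \<inter> f -` fst c'))"
      show "open ?U"
        by (rule open_chart_image[OF slice_chartD(1)[OF c(1)] shift_map_open[OF f(1) c'D(1)]])
      show "snd c x \<in> ?U" using c c' f by auto
      fix r assume "snd c x + r *\<^sub>R axis i 1 \<in> ?U"
      then obtain z where "snd c x + r *\<^sub>R axis i 1 = snd c z" "z \<in> fst c \<inter> (N \<inter> f -` fst c')"
        by (rule imageE)
      then have z: "z \<in> fst c" "z \<in> N" "f z \<in> fst c'" "snd c z = snd c x + r *\<^sub>R axis i 1"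
        by auto
      have "z \<in> level_set A u t"
        using slice_chartD(3)[OF c(1)] z c False by (simp add: axis_def)
      then have "f z \<in> level_set A u (t + \<tau>)" using f(1) z by (auto simp: level_set_def shift_map_def)
      then show "(snd c' \<circ> f \<circ> cinv c) (snd c x + r *\<^sub>R axis i 1) $ k' = 0"
        using slice_chartD(3)[OF c'(1) z(3)] cD(3)[OF z(1)] by (simp add: z(4)[symmetric])
    qed
    have drop: "drop_coord k (axis i (1::real)) = axis i 1" using False by (simp add: vec_eq_iff axis_def)
    have "T (axis i 1) $ j = ?w $ j" for j
      unfolding T_def slice_extend_deriv_def drop using w0 False by (simp add: axis_def)
    then have Ti: "T (axis i 1) = ?w" by (simp add: vec_eq_iff)
    have lin: "linear (transition c' d (f x))"
      by (rule linear_transition[OF slice_chartD(4)[OF c'(1) d(1)] c'(2) d(2)])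
    \<comment> \<open>Column \<open>k'\<close> of \<open>?B'\<close> is \<open>Y\<close> and not a
      coordinate vector, but its coefficient vanishes by \<open>w0\<close>.\<close>
    have "?B' *v ?w = (\<Sum>j\<in>UNIV. ?w $ j *\<^sub>R transition c' d (f x) (axis j 1))"
      unfolding cols_mult slice_basis_def by (intro sum.cong) (use w0 in auto)
    also have "\<dots> = transition c' d (f x) (\<Sum>j\<in>UNIV. ?w $ j *\<^sub>R axis j 1)"
      by (simp add: linear_sum[OF lin] linear_scale[OF lin])
    also have "\<dots> = transition c' d (f x) ?w"
      using basis_expansion[of ?w] by (simp add: scalar_mult_eq_scaleR)
    also have "\<dots> = deriv_rep f a d x (transition c a x (axis i 1))"
    proof -
      have "?w = transition d c' (f x) (deriv_rep f a d x (transition c a x (axis i 1)))"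
        using has_derivative_unique[OF \<Theta>' rep_has_derivative[OF f(1) a d slice_chartD(4)[OF c(1) a(1)] c(2)
          slice_chartD(5)[OF c'(1) d(1)] c'(2) f(2)]] by metis
      then show ?thesis
        using transition_inverse[OF slice_chartD(5)[OF c'(1) d(1)] d(2) c'(2)] by simp
    qed
    also have "\<dots> = deriv_corr f a d x (slice_basis k c a x i)"
      using tangent_slice[OF c a False] False by (simp add: deriv_corr_tangent slice_basis_def)
    finally show ?thesis using Ti by simp
  qed
  then have "cols (\<lambda>i. ?B' *v T (axis i 1)) = cols (\<lambda>i. deriv_corr f a d x (slice_basis k c a x i))"
    by simp
  then have "det (matrix ((\<lambda>v. ?B' *v v) \<circ> T)) * det (cols (\<lambda>i::'n. axis i (1::real))) =
      det (matrix (deriv_corr f a d x)) * det ?B"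
    using det_cols_linear[OF linear_deriv_corr[OF f(1) a f(2) d]]
      det_cols_linear[OF linear_compose[OF linT matrix_vector_mul_linear[of ?B']], of "\<lambda>i::'n. axis i 1"]
    by (simp add: o_def)
  moreover have "cols (\<lambda>i::'n. axis i (1::real)) = (mat 1 :: real ^ 'n ^ 'n)"
    by (auto simp: cols_def mat_def axis_def vec_eq_iff)
  moreover have "matrix ((\<lambda>v. ?B' *v v) \<circ> T) = ?B' ** matrix T"
    using matrix_compose[OF linT matrix_vector_mul_linear[of ?B']] by simp
  ultimately have "det ?B' * det (matrix T) = det (matrix (deriv_corr f a d x)) * det ?B"
    by (simp add: det_mul)
  then have dets: "\<bar>det (matrix T)\<bar> * \<bar>det ?B'\<bar> = \<bar>det (matrix (deriv_corr f a d x))\<bar> * \<bar>det ?B\<bar>"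
    by (metis abs_mult mult.commute)
  show ?thesis
    unfolding slice_density_level[OF c a] slice_density_level[OF c'(1,2) fx d] T_def[symmetric]
      level_jacobian_eq[OF f a d]
    using dets gn_pos[OF a] det_g_pos[OF a] by (simp add: real_sqrt_divide field_simps)
qed

section \<open>Slice masses and their transport by shift maps\<close>

lemma slice_mass_indicator:
  "slice_mass A g k c E = (\<integral>\<^sup>+ z. indicator (snd c ` E) (slice_point k z) *
     ennreal (slice_density A g k c (cinv c (slice_point k z))) \<partial>(Pi\<^sub>M (UNIV - {k}) (\<lambda>_. lborel)))"
  unfolding slice_mass_def by (intro nn_integral_cong) (simp add: indicator_def)

lemma borel_chart_image:
  assumes c: "is_chart c" and E: "E \<in> sets borel" "E \<subseteq> fst c"
  shows "snd c ` E \<in> sets borel"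
proof -
  note cD = is_chartD[OF c]
  have "cinv c \<in> borel_measurable (restrict_space borel (snd c ` fst c))"
    by (rule borel_measurable_continuous_on_restrict[OF cD(7)])
  from measurable_sets[OF this E(1)] have "cinv c -` E \<inter> snd c ` fst c \<in> sets borel"
    using cD(2) by (simp add: space_restrict_space sets_restrict_space_iff)
  moreover have "cinv c -` E \<inter> snd c ` fst c = snd c ` E"
    using cD(3) E(2) by (auto simp: image_iff)
  ultimately show ?thesis by simp
qed

lemma slice_density_measurable:
  assumes c: "slice_chart A S k c"
  shows "(\<lambda>y. indicator (snd c ` fst c) y * ennreal (slice_density A g k c (cinv c y))) \<in> borel_measurable borel"
proof -
  note cD = is_chartD[OF slice_chartD(1)[OF c]]
  have "continuous_on (snd c ` fst c) (\<lambda>y. slice_density A g k c (cinv c y))"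
    by (rule continuous_on_compose2[OF continuous_on_slice_density[OF c] cD(7)]) (use cD in auto)
  then have "(\<lambda>y. if y \<in> snd c ` fst c then slice_density A g k c (cinv c y) else 0) \<in> borel_measurable borel"
    using borel_measurable_continuous_on_if[of "snd c ` fst c" "\<lambda>y. slice_density A g k c (cinv c y)" "\<lambda>_. 0"] cD(2) by simp
  then have "(\<lambda>y. ennreal (if y \<in> snd c ` fst c then slice_density A g k c (cinv c y) else 0)) \<in> borel_measurable borel"
    by measurable
  also have "(\<lambda>y. ennreal (if y \<in> snd c ` fst c then slice_density A g k c (cinv c y) else 0)) =
      (\<lambda>y. indicator (snd c ` fst c) y * ennreal (slice_density A g k c (cinv c y)))"
    by (auto simp: indicator_def)
  finally show ?thesis .
qed

text \<open>The change of variables between level sets as long as one slice chart suffices at each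
  end: \<open>slice_change_of_variables\<close> for the coordinate expression of \<open>f\<close>,
  with its determinant evaluated by \<open>slice_jacobian\<close>.\<close>

lemma slice_mass_image:
  assumes f: "shift_map \<tau> N f"
    and c: "slice_chart A (level_set A u t) k c" and c': "slice_chart A (level_set A u (t + \<tau>)) k' c'"
    and inj: "inj_on f (N \<inter> level_set A u t)"
    and E: "E \<in> sets borel" "E \<subseteq> level_set A u t \<inter> N \<inter> fst c" "f ` E \<subseteq> fst c'"
  shows "f ` E \<in> sets borel"
    and "slice_mass A g k' c' (f ` E) = (\<integral>\<^sup>+ z. indicator (snd c ` E) (slice_point k z) *
      ennreal (slice_density A g k c (cinv c (slice_point k z)) * level_jacobian A g u f (cinv c (slice_point k z)))
      \<partial>(Pi\<^sub>M (UNIV - {k}) (\<lambda>_. lborel)))"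
proof -
  note ch = slice_chartD(1)[OF c] slice_chartD(1)[OF c']
  note cD = is_chartD[OF ch(1)] and c'D = is_chartD[OF ch(2)]
  define \<Omega> where "\<Omega> = snd c ` (fst c \<inter> (N \<inter> f -` fst c'))"
  define \<Theta> where "\<Theta> = snd c' \<circ> f \<circ> cinv c"
  define F where "F y = indicator (snd c' ` fst c') y * ennreal (slice_density A g k' c' (cinv c' y))" for y
  have \<Omega>: "open \<Omega>" unfolding \<Omega>_def
    by (rule open_chart_image[OF ch(1) shift_map_open[OF f c'D(1)]])
  have Ck: "Ck_on 1 \<Omega> \<Theta>"
    unfolding \<Omega>_def \<Theta>_def by (rule rep_Ck[OF f ch(1) slice_chartD(2,4)[OF c] ch(2) slice_chartD(5)[OF c']])
  have der: "(\<Theta> has_derivative frechet_derivative \<Theta> (at y)) (at y)" if "y \<in> \<Omega>" for y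
    using Ck_on_has_derivative[OF _ \<Omega> that, of 0] Ck by simp
  have cont: "continuous_on \<Omega> (\<lambda>y. frechet_derivative \<Theta> (at y) v)" for v
    using continuous_on_frechet[of 0] Ck \<Omega> by simp
  have level: "cinv c y \<in> level_set A u t \<and> cinv c y \<in> N \<and> f (cinv c y) \<in> fst c' \<and> snd c (cinv c y) = y
      \<and> f (cinv c y) \<in> level_set A u (t + \<tau>)"
    if y: "y \<in> \<Omega>" "y $ k = 0" for y
  proof -
    obtain x where x: "x \<in> fst c" "x \<in> N" "f x \<in> fst c'" "y = snd c x" using y by (auto simp: \<Omega>_def)
    then have "x \<in> level_set A u t" using slice_chartD(3)[OF c x(1)] y(2) by simp
    then show ?thesis using x f cD(3)[OF x(1)] by (auto simp: level_set_def shift_map_def)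
  qed
  have slice: "\<Theta> y $ k' = 0" if "y \<in> \<Omega>" "y $ k = 0" for y
    using level[OF that] slice_chartD(3)[OF c', of "f (cinv c y)"] by (simp add: \<Theta>_def)
  \<comment> \<open>Injectivity of \<open>f\<close> is assumed on the level set only, which is why
    the change of variables asks for injectivity on the hyperplane and not on the whole of
    \<open>\<Omega>\<close>.\<close>
  have inj\<Theta>: "inj_on \<Theta> (\<Omega> \<inter> {y. y $ k = 0})"
  proof
    fix y z assume "y \<in> \<Omega> \<inter> {y. y $ k = 0}" "z \<in> \<Omega> \<inter> {y. y $ k = 0}" and eq: "\<Theta> y = \<Theta> z"
    then have y: "y \<in> \<Omega>" "y $ k = 0" and z: "z \<in> \<Omega>" "z $ k = 0" by auto
    note ly = level[OF y] and lz = level[OF z]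
    have "cinv c' (snd c' (f (cinv c y))) = cinv c' (snd c' (f (cinv c z)))"
      using eq by (simp add: \<Theta>_def)
    then have "f (cinv c y) = f (cinv c z)"
      using ly lz c'D(3) by simp
    then have "cinv c y = cinv c z"
      by (rule inj_onD[OF inj]) (use ly lz in auto)
    then have "snd c (cinv c y) = snd c (cinv c z)" by simp
    then show "y = z" using ly lz by simp
  qed
  have E': "snd c ` E \<in> sets borel" "snd c ` E \<subseteq> \<Omega> \<inter> {y. y $ k = 0}"
  proof -
    show "snd c ` E \<in> sets borel" using borel_chart_image[OF ch(1) E(1)] E(2) by blast
    have "x \<in> fst c \<inter> (N \<inter> f -` fst c') \<and> snd c x $ k = 0" if "x \<in> E" for x
      using that E(2,3) slice_chartD(3)[OF c, of x] by auto
    then show "snd c ` E \<subseteq> \<Omega> \<inter> {y. y $ k = 0}" by (auto simp: \<Omega>_def)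
  qed
  have F: "F \<in> borel_measurable borel"
    unfolding F_def by (rule slice_density_measurable[OF c'])
  note cov = slice_change_of_variables[OF \<Omega> der cont slice inj\<Theta> E' F]
  have img: "\<Theta> ` snd c ` E = snd c' ` f ` E"
    unfolding \<Theta>_def using E(2) cD(3) by (force simp: image_iff)
  have Em: "cinv c y \<in> E" "y = snd c (cinv c y)" if "y \<in> snd c ` E" for y
    using that E(2) cD(3) by auto
  have "f ` E = snd c' -` (snd c' ` f ` E) \<inter> fst c'"
    using E(3) c'D(3) by (auto simp: image_iff) (metis image_subset_iff)
  also have "\<dots> \<in> sets borel"
  proof -
    have "snd c' \<in> borel_measurable (restrict_space borel (fst c'))"
      by (rule borel_measurable_continuous_on_restrict[OF c'D(6)])
    from measurable_sets[OF this cov(1)[unfolded img]]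
    have "snd c' -` snd c' ` f ` E \<inter> fst c' \<in> sets (restrict_space borel (fst c'))"
      by (simp only: space_restrict_space space_borel Int_UNIV_right)
    then show ?thesis
      using c'D(1) by (subst (asm) sets_restrict_space_iff) auto
  qed
  finally show "f ` E \<in> sets borel" .
  have "slice_mass A g k' c' (f ` E) = (\<integral>\<^sup>+z. indicator (\<Theta> ` snd c ` E) (slice_point k' z) * F (slice_point k' z) \<partial>Pi\<^sub>M (UNIV - {k'}) (\<lambda>_. lborel))"
    unfolding slice_mass_indicator img F_def using E(3)
    by (intro nn_integral_cong) (auto simp: indicator_def)
  also have "\<dots> = (\<integral>\<^sup>+z. indicator (snd c ` E) (slice_point k z) *
      (ennreal \<bar>det (matrix (slice_extend_deriv k k' (frechet_derivative \<Theta> (at (slice_point k z)))))\<bar> * F (\<Theta> (slice_point k z)))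
      \<partial>Pi\<^sub>M (UNIV - {k}) (\<lambda>_. lborel))"
    by (rule cov(2))
  also have "\<dots> = (\<integral>\<^sup>+ z. indicator (snd c ` E) (slice_point k z) *
      ennreal (slice_density A g k c (cinv c (slice_point k z)) * level_jacobian A g u f (cinv c (slice_point k z)))
      \<partial>(Pi\<^sub>M (UNIV - {k}) (\<lambda>_. lborel)))"
  proof (intro nn_integral_cong)
    fix z
    show "indicator (snd c ` E) (slice_point k z) *
      (ennreal \<bar>det (matrix (slice_extend_deriv k k' (frechet_derivative \<Theta> (at (slice_point k z)))))\<bar> * F (\<Theta> (slice_point k z))) =
      indicator (snd c ` E) (slice_point k z) *
      ennreal (slice_density A g k c (cinv c (slice_point k z)) * level_jacobian A g u f (cinv c (slice_point k z)))"
    proof (cases "slice_point k z \<in> snd c ` E")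
      case True
      define x where "x = cinv c (slice_point k z)"
      have x: "x \<in> E" "slice_point k z = snd c x" using Em[OF True] by (auto simp: x_def)
      have x': "x \<in> N" "x \<in> fst c" "x \<in> level_set A u t" "f x \<in> fst c'" "snd c x \<in> \<Omega>"
        using x E E'(2) by auto
      let ?D = "\<bar>det (matrix (slice_extend_deriv k k' (frechet_derivative \<Theta> (at (snd c x)))))\<bar>"
      have J: "?D * slice_density A g k' c' (f x) =
          level_jacobian A g u f x * slice_density A g k c x"
        by (rule slice_jacobian[OF f x'(1) c x'(2,3) c' x'(4)])
          (use der[OF x'(5)] in \<open>simp add: \<Theta>_def\<close>)
      have "F (\<Theta> (snd c x)) = ennreal (slice_density A g k' c' (f x))"
        using x' cD(3) c'D(3) by (simp add: F_def \<Theta>_def)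
      then have "ennreal ?D * F (\<Theta> (snd c x)) = ennreal (level_jacobian A g u f x * slice_density A g k c x)"
        using ennreal_mult'[of ?D "slice_density A g k' c' (f x)"] J by simp
      then show ?thesis
        unfolding x(2) cD(3)[OF x'(2)] by (simp add: mult.commute)
    qed simp
  qed
  finally show "slice_mass A g k' c' (f ` E) = (\<integral>\<^sup>+ z. indicator (snd c ` E) (slice_point k z) *
      ennreal (slice_density A g k c (cinv c (slice_point k z)) * level_jacobian A g u f (cinv c (slice_point k z)))
      \<partial>(Pi\<^sub>M (UNIV - {k}) (\<lambda>_. lborel)))" .
qed

lemma slice_mass_independent:
  assumes c: "slice_chart A (level_set A u t) k c" and c': "slice_chart A (level_set A u t) k' c'"
    and E: "E \<in> sets borel" "E \<subseteq> level_set A u t \<inter> fst c \<inter> fst c'"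
  shows "slice_mass A g k' c' E = slice_mass A g k c E"
proof -
  have "E \<subseteq> level_set A u t \<inter> carrier A \<inter> fst c" using E by (auto simp: level_set_def)
  from slice_mass_image(2)[OF shift_map_id c _ _ E(1) this, of k' c'] c' E
  have "slice_mass A g k' c' E = (\<integral>\<^sup>+ z. indicator (snd c ` E) (slice_point k z) *
      ennreal (slice_density A g k c (cinv c (slice_point k z)) * level_jacobian A g u (\<lambda>x. x) (cinv c (slice_point k z)))
      \<partial>(Pi\<^sub>M (UNIV - {k}) (\<lambda>_. lborel)))"
    by auto
  also have "\<dots> = slice_mass A g k c E"
    unfolding slice_mass_indicator
  proof (intro nn_integral_cong)
    fix z
    have "level_jacobian A g u (\<lambda>x. x) (cinv c y) = 1" if "y \<in> snd c ` E" for y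
    proof (rule level_jacobian_ident[OF shift_map_id _ refl])
      have "cinv c y \<in> E" using that E(2) is_chartD(3)[OF slice_chartD(1)[OF c]] by auto
      then show "cinv c y \<in> carrier A" using E(2) by (auto simp: level_set_def)
    qed
    then show "indicator (snd c ` E) (slice_point k z) *
      ennreal (slice_density A g k c (cinv c (slice_point k z)) * level_jacobian A g u (\<lambda>x. x) (cinv c (slice_point k z))) =
      indicator (snd c ` E) (slice_point k z) * ennreal (slice_density A g k c (cinv c (slice_point k z)))"
      by (simp add: indicator_def)
  qed
  finally show ?thesis .
qed

end

section \<open>The measure of a level set\<close>

context regular_function
begin

text \<open>The implicit function theorem: in a chart of the atlas, a coordinate along which
  \<open>u\<close> has nonzero derivative is replaced by \<open>u - t\<close>. The new coordinate
  map is C^2 because \<open>u\<close> is; its inverse is continuous by invariance of domain and then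
  gains its two derivatives one at a time.\<close>

lemma slice_chart_exists:
  assumes p: "p \<in> level_set A u t"
  shows "\<exists>k c. slice_chart A (level_set A u t) k c \<and> p \<in> fst c"
proof -
  have pc: "p \<in> carrier A" using p by (simp add: level_set_def)
  define a where "a = chart_at A p"
  have a: "a \<in> A" "p \<in> fst a" using chart_at[OF pc] by (auto simp: a_def)
  note aD = chartD[OF a(1)]
  define v where "v = u \<circ> cinv a"
  define D where "D = snd a ` fst a"
  define dv where "dv y = frechet_derivative v (at y)" for y
  have D: "open D" using aD by (simp add: D_def)
  have v2: "Ck_on 2 D v" using C2 a by (simp add: v_def D_def Ck_function_def)
  then have v2': "Ck_on (Suc 1) D v" by (simp add: numeral_2_eq_2)
  have dv: "(v has_derivative dv y) (at y)" if "y \<in> D" for y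
    unfolding dv_def by (rule Ck_on_has_derivative[OF v2' D that])
  have dvC: "Ck_on 1 D (\<lambda>y. dv y h)" for h
    using v2' unfolding dv_def by (simp add: Ck_on.simps(2))
  have lin: "linear (dv y)" if "y \<in> D" for y
    using dv[OF that] by (rule has_derivative_linear)
  let ?p = "snd a p"
  have pD: "?p \<in> D" using a by (simp add: D_def)
  \<comment> \<open>If all partial derivatives vanished, so would the derivative along
    \<open>Y\<close>, which is 1.\<close>
  have "\<exists>k. dv ?p (axis k 1) \<noteq> 0"
  proof (rule ccontr)
    assume "\<nexists>k. dv ?p (axis k 1) \<noteq> 0"
    then have "dv ?p (\<Sum>i\<in>UNIV. Y a p $ i *\<^sub>R axis i 1) = 0"
      by (simp add: linear_sum[OF lin[OF pD]] linear_scale[OF lin[OF pD]])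
    then have "dv ?p (Y a p) = 0"
      using basis_expansion[of "Y a p"] by (simp add: scalar_mult_eq_scaleR)
    then show False
      using differential_Y[OF a] by (simp add: differential_def dv_def v_def)
  qed
  then obtain k where k: "dv ?p (axis k 1) \<noteq> 0" by blast
  define \<Phi> where "\<Phi> y = (\<chi> i. if i = k then v y - t else y $ i)" for y
  define \<Phi>' where "\<Phi>' y h = (\<chi> i. if i = k then dv y h else h $ i)" for y h
  have \<Phi>_alt: "\<Phi> y = y + (v y - t - y $ k) *\<^sub>R axis k 1" for y
    by (auto simp: \<Phi>_def vec_eq_iff axis_def)
  have \<Phi>2: "Ck_on 2 D \<Phi>"
    unfolding \<Phi>_alt[abs_def]
    by (intro Ck_on_add Ck_on_scaleR Ck_on_diff Ck_on_const v2 D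
        Ck_on_bounded_linear bounded_linear_ident bounded_linear_vec_nth)
  have \<Phi>': "(\<Phi> has_derivative \<Phi>' y) (at y)" if "y \<in> D" for y
  proof -
    have n: "((\<lambda>y. y $ k) has_derivative (\<lambda>h. h $ k)) (at y)"
      by (intro bounded_linear_imp_has_derivative bounded_linear_vec_nth)
    have "(\<Phi> has_derivative (\<lambda>h. h + (dv y h - 0 - h $ k) *\<^sub>R axis k 1)) (at y)"
      unfolding \<Phi>_alt[abs_def]
      by (intro has_derivative_add has_derivative_ident has_derivative_scaleR_left has_derivative_diff
          dv that n has_derivative_const)
    moreover have "(\<lambda>h. h + (dv y h - 0 - h $ k) *\<^sub>R axis k 1) = \<Phi>' y"
      by (auto simp: \<Phi>'_def vec_eq_iff axis_def)
    ultimately show ?thesis by simp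
  qed
  have "open (D \<inter> (\<lambda>y. dv y (axis k 1)) -` (- {0}))"
  proof -
    have "open (- {0::real})" by (intro open_Compl closed_singleton)
    then have "open ((\<lambda>y. dv y (axis k 1)) -` (- {0}) \<inter> D)"
      by (rule iffD1[OF continuous_on_open_vimage[OF D], OF Ck_on_imp_continuous_on[OF D dvC], rule_format])
    then show ?thesis by (simp only: Int_commute)
  qed
  \<comment> \<open>A ball is taken for its convexity: the segments used for injectivity must not
    leave the region where the partial derivative is nonzero.\<close>
  then obtain r where r: "r > 0" "ball ?p r \<subseteq> D \<inter> (\<lambda>y. dv y (axis k 1)) -` (- {0})"
    using k pD by (metis Compl_iff IntI open_contains_ball singletonD vimageI)
  define W where "W = ball ?p r"
  have W: "open W" "W \<subseteq> D" "?p \<in> W" "\<And>y. y \<in> W \<Longrightarrow> dv y (axis k 1) \<noteq> 0"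
    using r by (auto simp: W_def)
  \<comment> \<open>Two points with the same image differ in coordinate \<open>k\<close> alone and
    have equal values of \<open>v\<close>. The mean value theorem on the segment between them yields
    a point where \<open>s\<close> times the partial derivative vanishes, so \<open>s\<close> is
    0.\<close>
  have inj: "inj_on \<Phi> W"
  proof
    fix y z assume yz: "y \<in> W" "z \<in> W" "\<Phi> y = \<Phi> z"
    define s where "s = z $ k - y $ k"
    have "y $ i = z $ i" if "i \<noteq> k" for i
      using arg_cong[OF yz(3), of "\<lambda>w. w $ i"] that by (simp add: \<Phi>_def)
    then have z: "z = y + s *\<^sub>R axis k 1"
      by (auto simp: vec_eq_iff axis_def s_def)
    have vyz: "v y = v z" using arg_cong[OF yz(3), of "\<lambda>w. w $ k"] by (simp add: \<Phi>_def)
    let ?l = "\<lambda>x::real. y + x *\<^sub>R (s *\<^sub>R axis k 1)"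
    have lW: "?l x \<in> W" if "0 \<le> x" "x \<le> 1" for x
    proof -
      have "?l x = (1 - x) *\<^sub>R y + x *\<^sub>R z" by (simp add: z algebra_simps)
      then show ?thesis using that yz(1,2) convex_ball[of ?p r] unfolding W_def
        by (metis convexD_alt)
    qed
    have "\<exists>x\<in>{0<..<1::real}. v (?l 1) - v (?l 0) = (\<lambda>h. dv (?l x) (h *\<^sub>R (s *\<^sub>R axis k 1))) (1 - 0)"
    proof (rule mvt_simple)
      fix x :: real assume "0 \<le> x" "x \<le> 1"
      then have "?l x \<in> D" using lW W(2) by blast
      have line: "(?l has_derivative (\<lambda>h. h *\<^sub>R (s *\<^sub>R axis k 1))) (at x within {0..1})"
        by (auto intro!: derivative_eq_intros)
      show "((\<lambda>x. v (?l x)) has_derivative (\<lambda>h. dv (?l x) (h *\<^sub>R (s *\<^sub>R axis k 1)))) (at x within {0..1})"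
        by (rule has_derivative_compose[OF line dv[OF \<open>?l x \<in> D\<close>]])
    qed simp
    then obtain x where x: "x \<in> {0<..<1}" "dv (?l x) (s *\<^sub>R axis k 1) = 0"
      using vyz z by auto
    then have "?l x \<in> W" using lW by simp
    then have "s = 0"
      using x(2) W(2,4) linear_scale[OF lin, of "?l x" s "axis k 1"] by auto
    then show "y = z" using z by simp
  qed
  have contW: "continuous_on W \<Phi>"
    using Ck_on_imp_continuous_on[OF D \<Phi>2] W(2) by (rule continuous_on_subset)
  define V where "V = \<Phi> ` W"
  have V: "open V" unfolding V_def by (rule invariance_of_domain[OF contW W(1) inj])
  obtain \<Psi> where hom: "homeomorphism W V \<Phi> \<Psi>"
    using invariance_of_domain_homeomorphism[OF W(1) contW _ inj] unfolding V_def by auto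
  have \<Psi>: "\<And>w. w \<in> V \<Longrightarrow> \<Psi> w \<in> W" "\<And>w. w \<in> V \<Longrightarrow> \<Phi> (\<Psi> w) = w" "\<And>y. y \<in> W \<Longrightarrow> \<Psi> (\<Phi> y) = y"
    "continuous_on V \<Psi>"
    using hom by (auto simp: homeomorphism_def)
  \<comment> \<open>Inverts \<open>\<Phi>'\<close>: coordinates other than \<open>k\<close> are
    copied, and \<open>q\<close> solves the remaining scalar equation, which prescribes the value of
    \<open>dv\<close>, for the \<open>k\<close>-th.\<close>
  define q where "q w h = (h $ k - dv (\<Psi> w) (drop_coord k h)) / dv (\<Psi> w) (axis k 1)" for w h
  define \<Psi>' where "\<Psi>' w h = drop_coord k h + q w h *\<^sub>R axis k 1" for w h
  have d\<Psi>: "(\<Psi> has_derivative \<Psi>' w) (at w)" if w: "w \<in> V" for w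
  proof (rule has_derivative_inverse_basic)
    have wD: "\<Psi> w \<in> D" using \<Psi>(1)[OF w] W(2) by blast
    show "(\<Phi> has_derivative \<Phi>' (\<Psi> w)) (at (\<Psi> w))" by (rule \<Phi>'[OF wD])
    note l = lin[OF wD] and dl = bounded_linear.linear[OF bounded_linear_drop_coord]
    have "linear (\<Psi>' w)"
      unfolding \<Psi>'_def q_def
      by (intro linearI) (auto simp: vec_eq_iff axis_def linear_add[OF l] linear_scale[OF l]
          linear_add[OF dl] linear_scale[OF dl] add_divide_distrib diff_divide_distrib algebra_simps)
    then show "bounded_linear (\<Psi>' w)" by (simp add: linear_conv_bounded_linear)
    show "\<Psi>' w \<circ> \<Phi>' (\<Psi> w) = id"
    proof
      fix h
      have drop: "drop_coord k (\<Phi>' (\<Psi> w) h) = drop_coord k h" by (auto simp: \<Phi>'_def vec_eq_iff)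
      have "h = drop_coord k h + h $ k *\<^sub>R axis k 1" by (auto simp: vec_eq_iff axis_def)
      then have "dv (\<Psi> w) h = dv (\<Psi> w) (drop_coord k h) + h $ k * dv (\<Psi> w) (axis k 1)"
        by (metis linear_add[OF l] linear_scale[OF l] real_scaleR_def)
      then have "q w (\<Phi>' (\<Psi> w) h) = h $ k"
        using W(4)[OF \<Psi>(1)[OF w]] unfolding q_def drop by (simp add: \<Phi>'_def)
      then show "(\<Psi>' w \<circ> \<Phi>' (\<Psi> w)) h = id h"
        unfolding \<Psi>'_def comp_def drop by (auto simp: vec_eq_iff axis_def)
    qed
    show "continuous (at w) \<Psi>" using \<Psi>(4) V w continuous_on_eq_continuous_at by blast
  qed (use V w \<Psi>(2) in auto)
  \<comment> \<open>Bootstrapping: the derivative of \<open>\<Psi>\<close> is rational in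
    \<open>dv\<close> evaluated at \<open>\<Psi>\<close>, so it is as smooth as
    \<open>\<Psi>\<close> itself, up to the class C^1 of \<open>dv\<close>. Two rounds lead from
    continuity to C^2.\<close>
  have step: "Ck_on (Suc j) V \<Psi>" if j: "j \<le> 1" "Ck_on j V \<Psi>" for j
  proof (rule Ck_on_SucI[OF V d\<Psi>])
    fix h
    have comp: "Ck_on j V (\<lambda>w. dv (\<Psi> w) e)" for e
    proof -
      have "Ck_on j V ((\<lambda>y. dv y e) \<circ> \<Psi>)"
        by (rule Ck_on_compose[OF V D _ j(2) Ck_on_mono[OF D dvC j(1)]]) (use \<Psi>(1) W(2) in auto)
      then show ?thesis by (simp add: o_def)
    qed
    show "Ck_on j V (\<lambda>w. \<Psi>' w h)"
      unfolding \<Psi>'_def q_def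
      by (intro Ck_on_add Ck_on_scaleR Ck_on_divide Ck_on_diff Ck_on_const comp V W(4) \<Psi>(1))
  qed
  have "Ck_on 0 V \<Psi>" using \<Psi>(4) by (simp add: Ck_on.simps)
  from step[OF _ step[OF _ this]] have \<Psi>2: "Ck_on 2 V \<Psi>" by (simp add: numeral_2_eq_2)

  define F where "F = fst a \<inter> snd a -` W"
  define c where "c = (F, \<Phi> \<circ> snd a)"
  have FW: "snd a ` F = W" using W(2) by (force simp: F_def D_def)
  have F: "open F"
    using continuous_on_open_vimage[OF aD(1)] aD(6) W(1) unfolding F_def by (metis Int_commute)
  have homa: "homeomorphism F W (snd a) (cinv a)"
    unfolding homeomorphism_def
  proof (intro conjI ballI)
    show "continuous_on F (snd a)" "continuous_on W (cinv a)"
      using aD(6,7) W(2) by (auto simp: F_def D_def intro: continuous_on_subset)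
    have "cinv a ` W = (\<lambda>x. cinv a (snd a x)) ` F" by (simp only: FW[symmetric] image_image)
    also have "\<dots> = (\<lambda>x. x) ` F" by (rule image_cong) (use aD(3) in \<open>auto simp: F_def\<close>)
    finally show "cinv a ` W = F" by simp
    show "cinv a (snd a x) = x" if "x \<in> F" for x using that aD(3) by (auto simp: F_def)
    show "snd a (cinv a y) = y" if "y \<in> W" for y using that aD(4) W(2) by (auto simp: D_def)
  qed (rule FW)
  have homc: "homeomorphism F V (\<Phi> \<circ> snd a) (cinv a \<circ> \<Psi>)"
    by (rule homeomorphism_compose[OF homa hom])
  have cinv: "cinv c y = (cinv a \<circ> \<Psi>) y" if "y \<in> V" for y
  proof -
    have "inj_on (\<Phi> \<circ> snd a) F"
      by (rule inj_on_inverseI[of F "cinv a \<circ> \<Psi>"]) (rule homeomorphism_apply1[OF homc])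
    moreover have "(cinv a \<circ> \<Psi>) y \<in> F"
      using homeomorphism_image2[OF homc] that by blast
    ultimately have "inv_into F (\<Phi> \<circ> snd a) y = (cinv a \<circ> \<Psi>) y"
      by (rule inv_into_f_eq) (rule homeomorphism_apply2[OF homc that])
    then show ?thesis by (simp only: cinv_def c_def fst_conv snd_conv)
  qed
  have cimg: "snd c ` fst c = V" using homc by (simp add: c_def homeomorphism_def)
  have chart_c: "is_chart c"
    unfolding is_chart_def cimg
  proof (intro conjI V)
    show "open (fst c)" using F by (simp add: c_def)
    show "homeomorphism (fst c) V (snd c) (cinv c)"
      by (rule homeomorphism_cong[OF homc]) (auto simp: c_def cinv[unfolded c_def])
  qed
  note cD = is_chartD[OF chart_c]
  have slice: "slice_chart A (level_set A u t) k c"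
    unfolding slice_chart_def
  proof (intro conjI ballI chart_c)
    show "fst c \<subseteq> carrier A" using in_carrier[OF a(1)] by (auto simp: c_def F_def)
    show "x \<in> level_set A u t \<longleftrightarrow> snd c x $ k = 0" if "x \<in> fst c" for x
      using that aD(3) in_carrier[OF a(1)] by (auto simp: c_def F_def level_set_def \<Phi>_def v_def)
    fix d assume d: "d \<in> A"
    have 1: "Ck_on 2 (snd a ` (fst a \<inter> fst d)) (snd d \<circ> cinv a)"
        "Ck_on 2 (snd d ` (fst a \<inter> fst d)) (snd a \<circ> cinv d)"
      using riemannian a(1) d unfolding riemannian_manifold_def smooth_atlas_def Ck_compatible_def by blast+
    have o1: "open (snd c ` (fst c \<inter> fst d))" by (rule open_chart_image[OF chart_c chartD(1)[OF d]])
    have o2: "open (snd d ` (fst c \<inter> fst d))"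
      using open_chart_image[OF chart[OF d] cD(1)] by (simp add: Int_commute)
    have "Ck_on 2 (snd c ` (fst c \<inter> fst d)) ((snd d \<circ> cinv a) \<circ> \<Psi>)"
    proof (rule Ck_on_compose[OF o1 open_chart_image[OF chart[OF a(1)] chartD(1)[OF d]] _ _ 1(1)])
      show "Ck_on 2 (snd c ` (fst c \<inter> fst d)) \<Psi>" by (rule Ck_on_subset[OF \<Psi>2]) (use cimg in auto)
      show "\<Psi> ` snd c ` (fst c \<inter> fst d) \<subseteq> snd a ` (fst a \<inter> fst d)"
        using \<Psi>(3) by (auto simp: c_def F_def)
    qed
    then have "Ck_on 2 (snd c ` (fst c \<inter> fst d)) (snd d \<circ> cinv c)"
      by (rule Ck_on_cong[OF o1, rotated]) (use cinv cimg in auto)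
    moreover have "Ck_on 2 (snd d ` (fst c \<inter> fst d)) (\<Phi> \<circ> (snd a \<circ> cinv d))"
    proof (rule Ck_on_compose[OF o2 D _ _ \<Phi>2])
      show "(snd a \<circ> cinv d) ` snd d ` (fst c \<inter> fst d) \<subseteq> D"
        using chartD(3)[OF d] by (auto simp: c_def F_def D_def)
      show "Ck_on 2 (snd d ` (fst c \<inter> fst d)) (snd a \<circ> cinv d)"
        by (rule Ck_on_subset[OF 1(2)]) (auto simp: c_def F_def)
    qed
    then have "Ck_on 2 (snd d ` (fst c \<inter> fst d)) (snd c \<circ> cinv d)"
      by (rule Ck_on_cong[OF o2, rotated]) (simp add: c_def)
    ultimately show "Ck_compatible 2 c d" by (simp add: Ck_compatible_def)
  qed
  have "p \<in> fst c" using a W(3) by (simp add: c_def F_def)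
  with slice show ?thesis by blast
qed

lemma continuous_on_u: "continuous_on (carrier A) u"
  unfolding carrier_def
proof (rule continuous_on_open_UN)
  fix c assume c: "c \<in> A"
  note ch = chartD[OF c]
  show "open (fst c)" by (rule ch)
  have "Ck_on 2 (snd c ` fst c) (u \<circ> cinv c)" using C2 c by (simp add: Ck_function_def)
  then have "continuous_on (fst c) (\<lambda>x. (u \<circ> cinv c) (snd c x))"
    by (rule continuous_on_compose2[OF Ck_on_imp_continuous_on[OF ch(2)] ch(6)]) auto
  then show "continuous_on (fst c) u"
    by (rule continuous_on_eq) (simp add: ch)
qed

lemma level_set_borel: "level_set A u t \<in> sets borel"
proof -
  have "u \<in> borel_measurable (restrict_space borel (carrier A))"
    by (rule borel_measurable_continuous_on_restrict[OF continuous_on_u])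
  from measurable_sets[OF this, of "{t}"] have "u -` {t} \<inter> carrier A \<in> sets borel"
    using open_carrier by (simp add: space_restrict_space sets_restrict_space_iff)
  moreover have "u -` {t} \<inter> carrier A = level_set A u t" by (auto simp: level_set_def)
  ultimately show ?thesis by simp
qed

lemma sets_level: "E \<in> sets (restrict_space borel (level_set A u t)) \<longleftrightarrow> E \<in> sets borel \<and> E \<subseteq> level_set A u t"
  using level_set_borel by (auto simp: sets_restrict_space_iff)

lemma slice_point_measurable [measurable]:
  "slice_point k \<in> Pi\<^sub>M (UNIV - {k}) (\<lambda>_. lborel) \<rightarrow>\<^sub>M (borel :: (real ^ 'k::finite) measure)"
  unfolding slice_point_def
proof (rule borel_measurable_vec_lambda)
  fix i
  show "(\<lambda>z. if i = k then 0 else z i) \<in> borel_measurable (Pi\<^sub>M (UNIV - {k}) (\<lambda>_. lborel))"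
  proof (cases "i = k")
    case False
    then have "(\<lambda>z. z i) \<in> Pi\<^sub>M (UNIV - {k}) (\<lambda>_. lborel) \<rightarrow>\<^sub>M (lborel :: real measure)"
      by (intro measurable_component_singleton) simp
    with False show ?thesis by simp
  qed simp
qed

lemma slice_integrand_measurable:
  assumes c: "slice_chart A S k c" and E: "E \<in> sets borel" "E \<subseteq> fst c"
  shows "(\<lambda>z. indicator (snd c ` E) (slice_point k z) * ennreal (slice_density A g k c (cinv c (slice_point k z))))
    \<in> borel_measurable (Pi\<^sub>M (UNIV - {k}) (\<lambda>_. lborel))"
proof -
  note [measurable] = borel_chart_image[OF slice_chartD(1)[OF c] E] slice_density_measurable[OF c]
  have "(\<lambda>y. indicator (snd c ` E) y * ennreal (slice_density A g k c (cinv c y))) =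
      (\<lambda>y. indicator (snd c ` E) y * (indicator (snd c ` fst c) y * ennreal (slice_density A g k c (cinv c y))))"
  proof
    fix y
    show "indicator (snd c ` E) y * ennreal (slice_density A g k c (cinv c y)) =
      indicator (snd c ` E) y * (indicator (snd c ` fst c) y * ennreal (slice_density A g k c (cinv c y)))"
      using E(2) by (cases "y \<in> snd c ` E") auto
  qed
  also have "\<dots> \<in> borel_measurable borel" by measurable
  finally show ?thesis
    by (rule measurable_compose[OF slice_point_measurable])
qed

section \<open>Gluing slice masses to a measure\<close>

lemma slice_mass_suminf:
  assumes c: "slice_chart A S k c" and E: "\<And>i. E i \<in> sets borel" "\<And>i. E i \<subseteq> fst c" "disjoint_family E"
  shows "slice_mass A g k c (\<Union>i. E i) = (\<Sum>i. slice_mass A g k c (E i))"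
proof -
  note cD = is_chartD[OF slice_chartD(1)[OF c]]
  have "disjoint_family (\<lambda>i. snd c ` E i)"
    unfolding disjoint_family_on_def
  proof (intro ballI impI)
    fix i j :: nat assume "i \<noteq> j"
    then have "E i \<inter> E j = {}" using E(3) by (auto simp: disjoint_family_on_def)
    moreover have "inj_on (snd c) (fst c)" using cD(3) by (rule inj_on_inverseI)
    ultimately show "snd c ` E i \<inter> snd c ` E j = {}"
      using E(2) by (metis image_empty inj_on_image_Int)
  qed
  then have ind: "(\<Sum>i. indicator (snd c ` E i) y :: ennreal) = indicator (snd c ` (\<Union>i. E i)) y" for y
    by (simp add: suminf_indicator image_UN)
  show ?thesis
    unfolding slice_mass_indicator ind[symmetric]
    by (subst ennreal_suminf_multc[symmetric], rule nn_integral_suminf)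
      (rule slice_integrand_measurable[OF c E(1,2)])
qed

text \<open>Second countability leaves countably many slice charts, and cutting out overlaps gives
  disjoint Borel pieces that each lie in one chart. Uniqueness, existence and transport of the
  measure are all reduced to such pieces. The level set is nonempty so that there is a chart to
  start the enumeration with.\<close>

lemma slice_cover:
  assumes "level_set A u t \<noteq> {}"
  obtains k c D where "\<And>n::nat. slice_chart A (level_set A u t) (k n) (c n)"
    "\<And>n. D n \<in> sets borel" "\<And>n. D n \<subseteq> level_set A u t \<inter> fst (c n)"
    "disjoint_family D" "(\<Union>n. D n) = level_set A u t"
proof -
  define \<F> where "\<F> = {fst c |k c. slice_chart A (level_set A u t) k c}"
  have "open U" if "U \<in> \<F>" for U
    using that is_chartD(1)[OF slice_chartD(1)] by (auto simp: \<F>_def)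
  then obtain \<F>' where \<F>': "\<F>' \<subseteq> \<F>" "countable \<F>'" "\<Union>\<F>' = \<Union>\<F>"
    using Lindelof[of \<F>] by auto
  have cover: "level_set A u t \<subseteq> \<Union>\<F>'"
    unfolding \<F>'(3) \<F>_def using slice_chart_exists by blast
  then have ne: "\<F>' \<noteq> {}" using assms by auto
  define U where "U = from_nat_into \<F>'"
  have "\<exists>k c. slice_chart A (level_set A u t) k c \<and> fst c = U n" for n
    using from_nat_into[OF ne, of n] \<F>'(1) by (auto simp: U_def \<F>_def)
  then obtain k c where kc: "\<And>n. slice_chart A (level_set A u t) (k n) (c n)" "\<And>n. fst (c n) = U n"
    by metis
  have UU: "(\<Union>n. U n) = \<Union>\<F>'" using range_from_nat_into[OF ne \<F>'(2)] by (simp add: U_def)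
  have Ub: "U n \<in> sets borel" for n
    using is_chartD(1)[OF slice_chartD(1)[OF kc(1)[of n]]] kc(2) by simp
  define D where "D n = level_set A u t \<inter> disjointed U n" for n
  show ?thesis
  proof (rule that[OF kc(1)])
    show "D n \<in> sets borel" for n
      unfolding D_def using level_set_borel sets.range_disjointed_sets[of U borel] Ub by auto
    show "D n \<subseteq> level_set A u t \<inter> fst (c n)" for n
      unfolding D_def kc(2) using disjointed_subset[of U n] by auto
    show "disjoint_family D"
      using disjoint_family_disjointed[of U] by (auto simp: D_def disjoint_family_on_def)
    show "(\<Union>n. D n) = level_set A u t"
      using cover UU UN_disjointed_eq[of U] by (auto simp: D_def)
  qed
qed

lemma is_hypersurface_measure_iff:
  "is_hypersurface_measure A g S \<mu> \<longleftrightarrow> sets \<mu> = sets (restrict_space borel S) \<and>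
    (\<forall>k c E. slice_chart A S k c \<longrightarrow> E \<in> sets borel \<longrightarrow> E \<subseteq> S \<inter> fst c \<longrightarrow> emeasure \<mu> E = slice_mass A g k c E)"
  by (simp add: is_hypersurface_measure_def slice_mass_def)

text \<open>The defining condition prescribes the measure inside each slice chart, and countable
  additivity over the pieces of \<open>slice_cover\<close> prescribes it everywhere.\<close>

lemma hypersurface_measure_unique:
  assumes ne: "level_set A u t \<noteq> {}"
    and \<mu>: "is_hypersurface_measure A g (level_set A u t) \<mu>" and \<mu>': "is_hypersurface_measure A g (level_set A u t) \<mu>'"
  shows "\<mu> = \<mu>'"
proof -
  obtain k c D where D: "\<And>n::nat. slice_chart A (level_set A u t) (k n) (c n)"
    "\<And>n. D n \<in> sets borel" "\<And>n. D n \<subseteq> level_set A u t \<inter> fst (c n)"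
    "disjoint_family D" "(\<Union>n. D n) = level_set A u t"
    using slice_cover[OF ne] by blast
  note m = \<mu>[unfolded is_hypersurface_measure_iff] \<mu>'[unfolded is_hypersurface_measure_iff]
  have dec: "emeasure M E = (\<Sum>n. slice_mass A g (k n) (c n) (E \<inter> D n))"
    if M: "is_hypersurface_measure A g (level_set A u t) M" and E: "E \<in> sets borel" "E \<subseteq> level_set A u t" for M E
  proof -
    note M = M[unfolded is_hypersurface_measure_iff]
    have "emeasure M E = emeasure M (\<Union>n. E \<inter> D n)"
      using E D(5) by (metis Int_UN_distrib inf.absorb_iff1)
    also have "\<dots> = (\<Sum>n. emeasure M (E \<inter> D n))"
    proof (rule suminf_emeasure[symmetric])
      show "range (\<lambda>n. E \<inter> D n) \<subseteq> sets M"
        using M E D(2) by (auto simp: sets_level)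
      show "disjoint_family (\<lambda>n. E \<inter> D n)"
        using D(4) by (auto simp: disjoint_family_on_def)
    qed
    also have "\<dots> = (\<Sum>n. slice_mass A g (k n) (c n) (E \<inter> D n))"
    proof (rule suminf_cong)
      show "emeasure M (E \<inter> D n) = slice_mass A g (k n) (c n) (E \<inter> D n)" for n
      proof -
        have "E \<inter> D n \<in> sets borel" "E \<inter> D n \<subseteq> level_set A u t \<inter> fst (c n)"
          using D(2,3)[of n] E(1) by auto
        then show ?thesis using M D(1)[of n] by blast
      qed
    qed
    finally show ?thesis .
  qed
  show ?thesis
  proof (rule measure_eqI)
    show "sets \<mu> = sets \<mu>'" using m by simp
    fix E assume "E \<in> sets \<mu>"
    then have "E \<in> sets borel" "E \<subseteq> level_set A u t" using m(1) by (auto simp: sets_level)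
    then show "emeasure \<mu> E = emeasure \<mu>' E" using dec \<mu> \<mu>' by simp
  qed
qed

lemma suminf_commute_ennreal:
  fixes f :: "nat \<Rightarrow> nat \<Rightarrow> ennreal"
  shows "(\<Sum>i. \<Sum>j. f i j) = (\<Sum>j. \<Sum>i. f i j)"
  by (subst (1 2) nn_integral_count_space_nat[symmetric], rule nn_integral_suminf) simp

text \<open>The masses of the pieces are added up, each in its own chart. That any other slice chart
  gives the same value is \<open>slice_mass_independent\<close> on every piece, followed by
  additivity in the other chart.\<close>

lemma hypersurface_measure_exists:
  assumes ne: "level_set A u t \<noteq> {}"
  shows "\<exists>\<mu>. is_hypersurface_measure A g (level_set A u t) \<mu>"
proof -
  let ?S = "level_set A u t"
  obtain k c D where D: "\<And>n::nat. slice_chart A ?S (k n) (c n)"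
    "\<And>n. D n \<in> sets borel" "\<And>n. D n \<subseteq> ?S \<inter> fst (c n)"
    "disjoint_family D" "(\<Union>n. D n) = ?S"
    using slice_cover[OF ne] by blast
  define m where "m E = (\<Sum>n. slice_mass A g (k n) (c n) (E \<inter> D n))" for E
  define \<mu> where "\<mu> = measure_of ?S (sets (restrict_space borel ?S)) m"
  have sp: "space (restrict_space borel ?S) = ?S" by (simp add: space_restrict_space)
  have em: "emeasure \<mu> E = m E" if "E \<in> sets (restrict_space borel ?S)" for E
    unfolding \<mu>_def
  proof (rule emeasure_measure_of_sigma[OF _ _ _ that])
    show "sigma_algebra ?S (sets (restrict_space borel ?S))"
      using sets.sigma_algebra_axioms[of "restrict_space borel ?S"] by (simp add: sp)
    show "positive (sets (restrict_space borel ?S)) m"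
      by (simp add: positive_def m_def slice_mass_indicator)
    show "countably_additive (sets (restrict_space borel ?S)) m"
      unfolding countably_additive_def
    proof (intro allI impI)
      fix E :: "nat \<Rightarrow> 'm set"
      assume E: "range E \<subseteq> sets (restrict_space borel ?S)" "disjoint_family E"
      have Eb: "E i \<in> sets borel" for i using E(1) sets_level[of "E i"] by blast
      have "(\<Sum>i. m (E i)) = (\<Sum>n. \<Sum>i. slice_mass A g (k n) (c n) (E i \<inter> D n))"
        unfolding m_def by (rule suminf_commute_ennreal)
      also have "\<dots> = (\<Sum>n. slice_mass A g (k n) (c n) (\<Union>i. E i \<inter> D n))"
      proof (intro suminf_cong slice_mass_suminf[OF D(1), symmetric])
        show "E i \<inter> D n \<in> sets borel" for i n using Eb D(2) by auto
        show "E i \<inter> D n \<subseteq> fst (c n)" for i n using D(3) by auto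
        show "disjoint_family (\<lambda>i. E i \<inter> D n)" for n
          using E(2) by (auto simp: disjoint_family_on_def)
      qed
      also have "\<dots> = m (\<Union>i. E i)" by (simp add: m_def Int_UN_distrib2)
      finally show "(\<Sum>i. m (E i)) = m (\<Union>i. E i)" .
    qed
  qed
  have sets: "sets \<mu> = sets (restrict_space borel ?S)"
    unfolding \<mu>_def using sets.sets_measure_of_eq[of "restrict_space borel ?S"] by (simp add: sp)
  have "emeasure \<mu> E = slice_mass A g l d E"
    if d: "slice_chart A ?S l d" and E: "E \<in> sets borel" "E \<subseteq> ?S \<inter> fst d" for l d E
  proof -
    have "emeasure \<mu> E = m E" using E by (intro em) (simp add: sets_level)
    also have "\<dots> = (\<Sum>n. slice_mass A g l d (E \<inter> D n))"
      unfolding m_def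
    proof (rule suminf_cong)
      show "slice_mass A g (k n) (c n) (E \<inter> D n) = slice_mass A g l d (E \<inter> D n)" for n
        by (rule slice_mass_independent[OF d D(1)]) (use E D(2,3)[of n] in auto)
    qed
    also have "\<dots> = slice_mass A g l d (\<Union>n. E \<inter> D n)"
      by (rule slice_mass_suminf[OF d, symmetric])
        (use E D(2,4) in \<open>auto simp: disjoint_family_on_def\<close>)
    also have "(\<Union>n. E \<inter> D n) = E" using E D(5) by auto
    finally show ?thesis .
  qed
  with sets show ?thesis by (auto simp: is_hypersurface_measure_iff)
qed

text \<open>Existence and uniqueness together give meaning to the \<open>THE\<close> in
  \<open>hypersurface_measure\<close>.\<close>

lemma level_measure:
  assumes "level_set A u t \<noteq> {}"
  shows "is_hypersurface_measure A g (level_set A u t) (level_measure A g u t)"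
proof -
  obtain \<mu> where \<mu>: "is_hypersurface_measure A g (level_set A u t) \<mu>"
    using hypersurface_measure_exists[OF assms] by blast
  show ?thesis
    unfolding hypersurface_measure_def
    by (rule theI[of _ \<mu>]) (use \<mu> hypersurface_measure_unique[OF assms] in auto)
qed

lemma sets_level_measure:
  "level_set A u t \<noteq> {} \<Longrightarrow> sets (level_measure A g u t) = sets (restrict_space borel (level_set A u t))"
  using level_measure by (simp add: is_hypersurface_measure_def)

lemma space_level_measure: "level_set A u t \<noteq> {} \<Longrightarrow> space (level_measure A g u t) = level_set A u t"
  using sets_eq_imp_space_eq[OF sets_level_measure] by (simp add: space_restrict_space)

text \<open>The level measure cut down to \<open>E\<close> is the image, under the parametrization
  \<open>h\<close>, of the product measure with density \<open>w\<close>. On sets this is the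
  defining condition; equality of measures extends it to integrals.\<close>

lemma nn_integral_level_slice:
  assumes ne: "level_set A u t \<noteq> {}" and c: "slice_chart A (level_set A u t) k c"
    and E: "E \<in> sets borel" "E \<subseteq> level_set A u t \<inter> fst c"
    and F: "F \<in> borel_measurable (level_measure A g u t)"
  shows "(\<integral>\<^sup>+x. indicator E x * F x \<partial>level_measure A g u t) =
    (\<integral>\<^sup>+z. indicator (snd c ` E) (slice_point k z) * ennreal (slice_density A g k c (cinv c (slice_point k z))) *
      F (cinv c (slice_point k z)) \<partial>Pi\<^sub>M (UNIV - {k}) (\<lambda>_. lborel))"
proof -
  let ?S = "level_set A u t" and ?\<mu> = "level_measure A g u t" and ?P = "Pi\<^sub>M (UNIV - {k}) (\<lambda>_. lborel)"
  note ch = slice_chartD(1)[OF c]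
  note cD = is_chartD[OF ch]
  note sets = sets_level_measure[OF ne]
  obtain x0 where x0: "x0 \<in> ?S" using ne by blast
  have Eb: "snd c ` E \<in> sets borel" using borel_chart_image[OF ch E(1)] E(2) by auto
  define w where "w z = indicator (snd c ` E) (slice_point k z) * ennreal (slice_density A g k c (cinv c (slice_point k z)))" for z
  \<comment> \<open>The default \<open>x0\<close> keeps \<open>h\<close> inside the level set for
    parameters that do not come from \<open>E\<close>; there the weight \<open>w\<close> is
    0.\<close>
  define h where "h z = (if slice_point k z \<in> snd c ` E then cinv c (slice_point k z) else x0)" for z
  have w: "w \<in> borel_measurable ?P"
    unfolding w_def[abs_def] by (rule slice_integrand_measurable[OF c E(1)]) (use E(2) in auto)
  have cE: "cinv c y \<in> E" if "y \<in> snd c ` E" for y using that E(2) cD(3) by auto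
  have h: "h \<in> ?P \<rightarrow>\<^sub>M restrict_space borel ?S"
  proof (rule measurable_restrict_space2)
    show "h \<in> space ?P \<rightarrow> ?S" using subsetD[OF E(2) cE] x0 by (auto simp: h_def simp del: image_iff)
    have "(\<lambda>y. if y \<in> snd c ` E then cinv c y else x0) \<in> borel_measurable borel"
      by (rule borel_measurable_continuous_on_if[OF Eb continuous_on_subset[OF cD(7)]]) (use E(2) in auto)
    from measurable_compose[OF slice_point_measurable this] show "h \<in> borel_measurable ?P"
      by (simp add: h_def[abs_def])
  qed
  have Em: "(indicator E :: 'm \<Rightarrow> ennreal) \<in> borel_measurable ?\<mu>"
    using E sets by (intro borel_measurable_indicator) (simp add: sets_level)
  have "density ?\<mu> (indicator E) = distr (density ?P w) (restrict_space borel ?S) h"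
  proof (rule measure_eqI)
    show "sets (density ?\<mu> (indicator E)) = sets (distr (density ?P w) (restrict_space borel ?S) h)"
      using sets by simp
    fix B assume "B \<in> sets (density ?\<mu> (indicator E))"
    then have B: "B \<in> sets ?\<mu>" "B \<in> sets (restrict_space borel ?S)" "B \<in> sets borel" "B \<subseteq> ?S"
      using sets by (auto simp: sets_level)
    have EB: "E \<inter> B \<in> sets ?\<mu>" using E B sets by (auto simp: sets_level)
    have "emeasure (density ?\<mu> (indicator E)) B = (\<integral>\<^sup>+x. indicator E x * indicator B x \<partial>?\<mu>)"
      by (rule emeasure_density[OF Em B(1)])
    also have "\<dots> = (\<integral>\<^sup>+x. indicator (E \<inter> B) x \<partial>?\<mu>)"
      by (intro nn_integral_cong) (simp add: indicator_def)
    also have "\<dots> = emeasure ?\<mu> (E \<inter> B)" using EB by simp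
    also have "\<dots> = slice_mass A g k c (E \<inter> B)"
    proof -
      have "E \<inter> B \<in> sets borel" "E \<inter> B \<subseteq> ?S \<inter> fst c" using E B(3) by auto
      then show ?thesis
        by (rule level_measure[OF ne, unfolded is_hypersurface_measure_iff, THEN conjunct2, rule_format, OF c])
    qed
    also have "\<dots> = (\<integral>\<^sup>+z. w z * indicator (h -` B) z \<partial>?P)"
      unfolding slice_mass_indicator
    proof (intro nn_integral_cong)
      fix z
      have "y \<in> snd c ` (E \<inter> B) \<longleftrightarrow> y \<in> snd c ` E \<and> cinv c y \<in> B" for y
        using E(2) cD(3) by (auto simp: image_iff) (metis IntI subsetD)
      then show "indicator (snd c ` (E \<inter> B)) (slice_point k z) * ennreal (slice_density A g k c (cinv c (slice_point k z))) =
          w z * indicator (h -` B) z"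
        by (simp add: w_def h_def indicator_def)
    qed
    also have "\<dots> = (\<integral>\<^sup>+z. w z * indicator (h -` B \<inter> space ?P) z \<partial>?P)"
      by (intro nn_integral_cong) (simp add: indicator_def)
    also have "\<dots> = emeasure (density ?P w) (h -` B \<inter> space ?P)"
      by (rule emeasure_density[symmetric, OF w measurable_sets[OF h B(2)]])
    also have "\<dots> = emeasure (distr (density ?P w) (restrict_space borel ?S) h) B"
      using h B(2) by (subst emeasure_distr) auto
    finally show "emeasure (density ?\<mu> (indicator E)) B = emeasure (distr (density ?P w) (restrict_space borel ?S) h) B" .
  qed
  then have "(\<integral>\<^sup>+x. F x \<partial>density ?\<mu> (indicator E)) = (\<integral>\<^sup>+x. F x \<partial>distr (density ?P w) (restrict_space borel ?S) h)"
    by simp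
  moreover have "(\<integral>\<^sup>+x. F x \<partial>density ?\<mu> (indicator E)) = (\<integral>\<^sup>+x. indicator E x * F x \<partial>?\<mu>)"
    by (rule nn_integral_density[OF Em F])
  moreover have F': "F \<in> borel_measurable (restrict_space borel ?S)"
    using F measurable_cong_sets[OF sets refl] by blast
  have "(\<integral>\<^sup>+x. F x \<partial>distr (density ?P w) (restrict_space borel ?S) h) = (\<integral>\<^sup>+z. F (h z) \<partial>density ?P w)"
    by (rule nn_integral_distr) (use h F' in auto)
  moreover have "(\<integral>\<^sup>+z. F (h z) \<partial>density ?P w) = (\<integral>\<^sup>+z. w z * F (h z) \<partial>?P)"
    by (rule nn_integral_density[OF w measurable_compose[OF h F']])
  moreover have "(\<integral>\<^sup>+z. w z * F (h z) \<partial>?P) = (\<integral>\<^sup>+z. indicator (snd c ` E) (slice_point k z) *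
      ennreal (slice_density A g k c (cinv c (slice_point k z))) * F (cinv c (slice_point k z)) \<partial>?P)"
    by (intro nn_integral_cong) (auto simp: w_def h_def indicator_def)
  ultimately show ?thesis by simp
qed

lemma level_jacobian_nonneg:
  assumes f: "shift_map \<tau> N f" and x: "x \<in> N"
  shows "level_jacobian A g u f x \<ge> 0"
proof -
  have "x \<in> carrier A" "f x \<in> carrier A" using f x by (auto simp: shift_map_def)
  note c = chart_at[OF this(1)] and d = chart_at[OF this(2)]
  show ?thesis
    unfolding level_jacobian_eq[OF f x c d] using gn_pos[OF c] gn_pos[OF d] det_g_pos[OF c] det_g_pos[OF d] by simp
qed

text \<open>By uniqueness it is enough that the image measure \<open>m\<close> has the defining
  property for the target level set. A Borel set inside one target chart is pulled back, cut into
  pieces that lie in single source charts, and each piece falls under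
  \<open>slice_mass_image\<close>.\<close>

lemma level_measure_image:
  assumes f: "shift_map \<tau> N f" and ne: "level_set A u t \<noteq> {}" and N: "level_set A u t \<subseteq> N"
    and bij: "bij_betw f (level_set A u t) (level_set A u (t + \<tau>))"
  shows "f \<in> level_measure A g u t \<rightarrow>\<^sub>M restrict_space borel (level_set A u (t + \<tau>))"
    and "level_jacobian A g u f \<in> borel_measurable (level_measure A g u t)"
    and "level_measure A g u (t + \<tau>) = distr (density (level_measure A g u t) (\<lambda>x. ennreal (level_jacobian A g u f x)))
      (restrict_space borel (level_set A u (t + \<tau>))) f"
proof -
  let ?S = "level_set A u t" and ?S' = "level_set A u (t + \<tau>)" and ?\<mu> = "level_measure A g u t"
  let ?J = "level_jacobian A g u f"
  note sets = sets_level_measure[OF ne]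
  have ne': "?S' \<noteq> {}" using bij ne by (auto simp: bij_betw_def)
  have fS: "f ` ?S = ?S'" "inj_on f ?S" using bij by (auto simp: bij_betw_def)
  have NS: "N \<inter> ?S = ?S" using N by auto
  have "continuous_on ?S f" using f N by (auto simp: shift_map_def intro: continuous_on_subset)
  then have fb: "f \<in> borel_measurable (restrict_space borel ?S)"
    by (rule borel_measurable_continuous_on_restrict)
  have "f \<in> restrict_space borel ?S \<rightarrow>\<^sub>M restrict_space borel ?S'"
    by (rule measurable_restrict_space2[OF _ fb]) (use fS in \<open>auto simp: space_restrict_space\<close>)
  then show fm: "f \<in> ?\<mu> \<rightarrow>\<^sub>M restrict_space borel ?S'"
    using measurable_cong_sets[OF sets refl] by blast
  have "?J \<in> borel_measurable (restrict_space borel ?S)"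
    by (rule borel_measurable_continuous_on_restrict[OF continuous_on_subset[OF continuous_on_level_jacobian[OF f] N]])
  then show Jm: "?J \<in> borel_measurable ?\<mu>"
    using measurable_cong_sets[OF sets refl] by blast
  then have Jm': "(\<lambda>x. ennreal (?J x)) \<in> borel_measurable ?\<mu>" by measurable
  obtain k c D where D: "\<And>n::nat. slice_chart A ?S (k n) (c n)"
    "\<And>n. D n \<in> sets borel" "\<And>n. D n \<subseteq> ?S \<inter> fst (c n)"
    "disjoint_family D" "(\<Union>n. D n) = ?S"
    using slice_cover[OF ne] by blast
  define m where "m = distr (density ?\<mu> (\<lambda>x. ennreal (?J x))) (restrict_space borel ?S') f"
  have "is_hypersurface_measure A g ?S' m"
    unfolding is_hypersurface_measure_iff
  proof (intro conjI allI impI)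
    show "sets m = sets (restrict_space borel ?S')" by (simp add: m_def)
    fix k' c' E' assume c': "slice_chart A ?S' k' c'" and E': "E' \<in> sets borel" "E' \<subseteq> ?S' \<inter> fst c'"
    note c'D = is_chartD[OF slice_chartD(1)[OF c']]
    define E where "E = f -` E' \<inter> ?S"
    have E'm: "E' \<in> sets (restrict_space borel ?S')" using E' by (simp add: sets_level)
    have Em: "E \<in> sets ?\<mu>"
      using measurable_sets[OF fm E'm] by (simp add: E_def space_level_measure[OF ne])
    then have Eb: "E \<in> sets borel" "E \<subseteq> ?S" using sets by (auto simp: sets_level)
    have ED: "E \<inter> D n \<in> sets borel" "E \<inter> D n \<subseteq> ?S \<inter> fst (c n)" for n
      using Eb D(2)[of n] D(3)[of n] by blast+
    have EDm: "E \<inter> D n \<in> sets ?\<mu>" for n using ED sets by (auto simp: sets_level)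
    have fED: "f ` (E \<inter> D n) \<subseteq> fst c'" for n using E'(2) by (auto simp: E_def)
    have img: "f ` (E \<inter> D n) \<in> sets borel"
      "slice_mass A g k' c' (f ` (E \<inter> D n)) = (\<integral>\<^sup>+x. indicator (E \<inter> D n) x * ennreal (?J x) \<partial>?\<mu>)" for n
    proof -
      have "E \<inter> D n \<subseteq> ?S \<inter> N \<inter> fst (c n)" using ED(2) N by blast
      note im = slice_mass_image[OF f D(1) c' _ ED(1) this fED, unfolded NS, OF fS(2)]
      show "f ` (E \<inter> D n) \<in> sets borel" by (rule im(1))
      \<comment> \<open>\<open>ennreal\<close> truncates negative numbers, so the sign is needed to
        split the product of density and Jacobian.\<close>
      have "?J x \<ge> 0" if "x \<in> E \<inter> D n" for x
        using level_jacobian_nonneg[OF f] that Eb N by blast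
      then have nn: "?J (cinv (c n) y) \<ge> 0" if "y \<in> snd (c n) ` (E \<inter> D n)" for y
        using that ED(2)[of n] is_chartD(3)[OF slice_chartD(1)[OF D(1)[of n]]] by auto
      have "indicator (snd (c n) ` (E \<inter> D n)) y * ennreal (slice_density A g (k n) (c n) (cinv (c n) y) * ?J (cinv (c n) y)) =
          indicator (snd (c n) ` (E \<inter> D n)) y * ennreal (slice_density A g (k n) (c n) (cinv (c n) y)) * ennreal (?J (cinv (c n) y))" for y
        using nn[of y] by (cases "y \<in> snd (c n) ` (E \<inter> D n)") (auto simp: ennreal_mult'')
      then show "slice_mass A g k' c' (f ` (E \<inter> D n)) = (\<integral>\<^sup>+x. indicator (E \<inter> D n) x * ennreal (?J x) \<partial>?\<mu>)"
        unfolding im(2) nn_integral_level_slice[OF ne D(1) ED Jm'] by simp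
    qed
    have disj: "disjoint_family (\<lambda>n. E \<inter> D n)" using D(4) by (auto simp: disjoint_family_on_def)
    have "emeasure m E' = emeasure (density ?\<mu> (\<lambda>x. ennreal (?J x))) E"
      unfolding m_def E_def using fm E'm by (subst emeasure_distr) (auto simp: space_level_measure[OF ne])
    also have "\<dots> = (\<integral>\<^sup>+x. ennreal (?J x) * indicator E x \<partial>?\<mu>)"
      by (rule emeasure_density[OF Jm' Em])
    also have "\<dots> = (\<integral>\<^sup>+x. (\<Sum>n. indicator (E \<inter> D n) x * ennreal (?J x)) \<partial>?\<mu>)"
    proof (rule nn_integral_cong)
      fix x
      have "E = (\<Union>n. E \<inter> D n)" using D(5) Eb by auto
      then have "indicator E x = (\<Sum>n. indicator (E \<inter> D n) x :: ennreal)"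
        using suminf_indicator[OF disj, of x] by simp
      then show "ennreal (?J x) * indicator E x = (\<Sum>n. indicator (E \<inter> D n) x * ennreal (?J x))"
        by (simp add: mult.commute)
    qed
    also have "\<dots> = (\<Sum>n. \<integral>\<^sup>+x. indicator (E \<inter> D n) x * ennreal (?J x) \<partial>?\<mu>)"
    proof (rule nn_integral_suminf)
      show "(\<lambda>x. indicator (E \<inter> D n) x * ennreal (?J x)) \<in> borel_measurable ?\<mu>" for n
        using EDm[of n] Jm' by measurable
    qed
    also have "\<dots> = (\<Sum>n. slice_mass A g k' c' (f ` (E \<inter> D n)))" by (simp add: img(2))
    also have "\<dots> = slice_mass A g k' c' (\<Union>n. f ` (E \<inter> D n))"
    proof (rule slice_mass_suminf[OF c', symmetric])
      show "disjoint_family (\<lambda>n. f ` (E \<inter> D n))"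
        unfolding disjoint_family_on_def
      proof (intro ballI impI)
        fix i j :: nat assume "i \<noteq> j"
        then have "(E \<inter> D i) \<inter> (E \<inter> D j) = {}" using disj by (auto simp: disjoint_family_on_def)
        moreover have "E \<inter> D n \<subseteq> ?S" for n using Eb by auto
        ultimately show "f ` (E \<inter> D i) \<inter> f ` (E \<inter> D j) = {}"
          using inj_on_image_Int[OF fS(2)] by (metis image_empty)
      qed
    qed (use img(1) fED in auto)
    also have "(\<Union>n. f ` (E \<inter> D n)) = E'"
    proof -
      have "(\<Union>n. f ` (E \<inter> D n)) = f ` E" using D(5) Eb by (auto simp: image_UN[symmetric])
      also have "\<dots> = E'"
      proof -
        have "E' \<subseteq> f ` ?S" using E'(2) fS(1) by blast
        then show ?thesis by (auto simp: E_def)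
      qed
      finally show ?thesis .
    qed
    finally show "emeasure m E' = slice_mass A g k' c' E'" .
  qed
  then show "level_measure A g u (t + \<tau>) = m"
    by (rule hypersurface_measure_unique[OF ne' level_measure[OF ne']])
qed

end

section \<open>Flows of $C^1$ vector fields\<close>

text \<open>Only one of the two mixed derivatives is given, and \<open>\<phi>\<close> need not be
  C^2. Integrating \<open>p\<close> in \<open>t\<close> recovers \<open>\<phi>\<close>,
  differentiating under the integral in \<open>\<sigma>\<close> expresses \<open>w\<close> as an
  integral of \<open>q\<close>, and the fundamental theorem of calculus returns the derivative of
  \<open>w\<close>.\<close>

lemma mixed_derivative_swap:
  fixes \<phi> :: "real \<Rightarrow> real \<Rightarrow> 'a::euclidean_space"
  assumes r: "r > 0"
    and p: "\<And>t \<sigma>. \<bar>t - t0\<bar> \<le> r \<Longrightarrow> \<bar>\<sigma>\<bar> \<le> r \<Longrightarrow> ((\<lambda>t. \<phi> t \<sigma>) has_vector_derivative p t \<sigma>) (at t)"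
    and q: "\<And>t \<sigma>. \<bar>t - t0\<bar> \<le> r \<Longrightarrow> \<bar>\<sigma>\<bar> \<le> r \<Longrightarrow> ((\<lambda>\<sigma>. p t \<sigma>) has_vector_derivative q t \<sigma>) (at \<sigma>)"
    and cont: "continuous_on ({-r..r} \<times> {t0 - r..t0 + r}) (\<lambda>(\<sigma>, t). q t \<sigma>)"
    and w: "\<And>t. \<bar>t - t0\<bar> \<le> r \<Longrightarrow> ((\<lambda>\<sigma>. \<phi> t \<sigma>) has_vector_derivative w t) (at 0)"
  shows "(w has_vector_derivative q t0 0) (at t0)"
proof -
  \<comment> \<open>A base point to the left of \<open>t0\<close> puts \<open>t0\<close> in the
    interior of the interval of integration, so that the derivative obtained is two-sided.\<close>
  define a where "a = t0 - r"
  have tI: "\<bar>t - t0\<bar> \<le> r" if "t \<in> {a..t0 + r}" for t using that by (simp add: a_def abs_le_iff)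
  have int: "((\<lambda>\<tau>. p \<tau> \<sigma>) has_integral (\<phi> t \<sigma> - \<phi> a \<sigma>)) {a..t}"
    if t: "t \<in> {a..t0 + r}" and \<sigma>: "\<bar>\<sigma>\<bar> \<le> r" for t \<sigma>
  proof (rule fundamental_theorem_of_calculus)
    show "((\<lambda>\<tau>. \<phi> \<tau> \<sigma>) has_vector_derivative p \<tau> \<sigma>) (at \<tau> within {a..t})" if "\<tau> \<in> {a..t}" for \<tau>
    proof (rule has_vector_derivative_at_within[OF p])
      show "\<bar>\<tau> - t0\<bar> \<le> r" using that t by (intro tI) auto
    qed (rule \<sigma>)
  qed (use t in auto)
  have w_eq: "w t = w a + integral {a..t} (\<lambda>\<tau>. q \<tau> 0)" if t: "t \<in> {a..t0 + r}" for t
  proof -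
    have "((\<lambda>\<sigma>. integral (cbox a t) (\<lambda>\<tau>. p \<tau> \<sigma>)) has_vector_derivative integral (cbox a t) (\<lambda>\<tau>. q \<tau> 0))
        (at 0 within {-r..r})"
    proof (rule leibniz_rule_vector_derivative)
      show "((\<lambda>\<sigma>. p \<tau> \<sigma>) has_vector_derivative q \<tau> \<sigma>) (at \<sigma> within {-r..r})"
        if "\<sigma> \<in> {-r..r}" "\<tau> \<in> cbox a t" for \<sigma> \<tau>
      proof (rule has_vector_derivative_at_within[OF q])
        show "\<bar>\<tau> - t0\<bar> \<le> r" using that t by (intro tI) auto
        show "\<bar>\<sigma>\<bar> \<le> r" using that by auto
      qed
      show "(\<lambda>\<tau>. p \<tau> \<sigma>) integrable_on cbox a t" if "\<sigma> \<in> {-r..r}" for \<sigma>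
      proof -
        have "\<bar>\<sigma>\<bar> \<le> r" using that by auto
        from int[OF t this] show ?thesis by (auto simp: integrable_on_def)
      qed
      show "continuous_on ({-r..r} \<times> cbox a t) (\<lambda>(\<sigma>, t). q t \<sigma>)"
        by (rule continuous_on_subset[OF cont]) (use t in \<open>auto simp: a_def\<close>)
    qed (use r in auto)
    moreover have "at 0 within {-r..r} = at (0::real)"
      using r by (intro at_within_interior) auto
    ultimately have 1: "((\<lambda>\<sigma>. integral (cbox a t) (\<lambda>\<tau>. p \<tau> \<sigma>)) has_vector_derivative integral {a..t} (\<lambda>\<tau>. q \<tau> 0)) (at 0)"
      by simp
    have "((\<lambda>\<sigma>. \<phi> t \<sigma> - \<phi> a \<sigma>) has_vector_derivative integral {a..t} (\<lambda>\<tau>. q \<tau> 0)) (at 0)"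
    proof (rule has_vector_derivative_transform_within_open[OF 1])
      show "open {-r<..<r}" "0 \<in> {-r<..<r}" using r by auto
      show "integral (cbox a t) (\<lambda>\<tau>. p \<tau> \<sigma>) = \<phi> t \<sigma> - \<phi> a \<sigma>" if "\<sigma> \<in> {-r<..<r}" for \<sigma>
      proof -
        have "\<bar>\<sigma>\<bar> \<le> r" using that by auto
        from int[OF t this] show ?thesis by (simp add: integral_unique)
      qed
    qed
    moreover have "((\<lambda>\<sigma>. \<phi> t \<sigma> - \<phi> a \<sigma>) has_vector_derivative (w t - w a)) (at 0)"
      using r t by (intro has_vector_derivative_diff w tI) auto
    ultimately have "w t - w a = integral {a..t} (\<lambda>\<tau>. q \<tau> 0)"
      using vector_derivative_unique_at by blast
    then show ?thesis by (simp add: algebra_simps)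
  qed
  have "continuous_on {a..t0 + r} (\<lambda>t. (\<lambda>(\<sigma>, t). q t \<sigma>) (0, t))"
    by (rule continuous_on_compose2[OF cont]) (use r in \<open>auto simp: a_def intro!: continuous_intros\<close>)
  then have "continuous_on {a..t0 + r} (\<lambda>t. q t 0)" by simp
  then have "((\<lambda>t. integral {a..t} (\<lambda>\<tau>. q \<tau> 0)) has_vector_derivative q t0 0) (at t0 within {a..t0 + r})"
    by (rule integral_has_vector_derivative) (use r in \<open>auto simp: a_def\<close>)
  moreover have "at t0 within {a..t0 + r} = at t0"
    using r by (intro at_within_interior) (auto simp: a_def)
  ultimately have "((\<lambda>t. w a + integral {a..t} (\<lambda>\<tau>. q \<tau> 0)) has_vector_derivative 0 + q t0 0) (at t0)"
    by (intro has_vector_derivative_add has_vector_derivative_const) simp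
  then have 2: "((\<lambda>t. w a + integral {a..t} (\<lambda>\<tau>. q \<tau> 0)) has_vector_derivative q t0 0) (at t0)" by simp
  show ?thesis
  proof (rule has_vector_derivative_transform_within_open[OF 2])
    show "open {a<..<t0 + r}" "t0 \<in> {a<..<t0 + r}" using r by (auto simp: a_def)
    show "w a + integral {a..t} (\<lambda>\<tau>. q \<tau> 0) = w t" if "t \<in> {a<..<t0 + r}" for t
      by (rule w_eq[symmetric]) (use that in auto)
  qed
qed

text \<open>Liouville's formula. The rows of $V' = M V$ are combinations of the rows of $V$.\<close>

lemma det_linear_ode:
  fixes v :: "'n::finite \<Rightarrow> real \<Rightarrow> real ^ 'n"
  assumes v: "\<And>j. (v j has_vector_derivative M (v j t0)) (at t0)" and M: "linear M"
  shows "((\<lambda>t. det (cols (\<lambda>j. v j t))) has_real_derivative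
    (\<Sum>i\<in>UNIV. M (axis i 1) $ i) * det (cols (\<lambda>j. v j t0))) (at t0)"
proof -
  let ?A = "\<lambda>t. cols (\<lambda>j. v j t)"
  define m where "m k j = M (axis j 1) $ k" for k j
  have Mv: "M x $ k = (\<Sum>j\<in>UNIV. m k j * x $ j)" for x k
  proof -
    have "M x = M (\<Sum>j\<in>UNIV. x $ j *\<^sub>R axis j 1)"
      using basis_expansion[of x] by (simp add: scalar_mult_eq_scaleR)
    then show ?thesis by (simp add: linear_sum[OF M] linear_scale[OF M] m_def mult.commute)
  qed
  have entry: "((\<lambda>t. ?A t $ i $ j) has_real_derivative M (v j t0) $ i) (at t0)" for i j
    using bounded_linear.has_vector_derivative[OF bounded_linear_vec_nth v, of j i]
    by (simp add: cols_def has_real_derivative_iff_has_vector_derivative)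
  \<comment> \<open>\<open>R k\<close> has row \<open>k\<close> of the derivative in place of row
    \<open>k\<close>; by the product rule the determinants of these matrices add up to the
    derivative of the determinant. Expanding the new row in the old ones, only the multiple of row
    \<open>k\<close> survives, the others producing two equal rows.\<close>
  define R where "R k = (\<chi> i. if i = k then (\<chi> j. M (v j t0) $ k) else ?A t0 $ i)" for k
  have prod: "((\<lambda>t. \<Prod>i\<in>UNIV. ?A t $ i $ \<pi> i) has_real_derivative
      (\<Sum>k\<in>UNIV. \<Prod>i\<in>UNIV. R k $ i $ \<pi> i)) (at t0)" for \<pi>
  proof -
    have d: "((\<lambda>t. \<Prod>i\<in>UNIV. ?A t $ i $ \<pi> i) has_derivative
        (\<lambda>h. \<Sum>k\<in>UNIV. (M (v (\<pi> k) t0) $ k * h) * (\<Prod>i\<in>UNIV - {k}. ?A t0 $ i $ \<pi> i))) (at t0)"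
      by (rule has_derivative_prod) (use entry in \<open>simp add: has_field_derivative_def\<close>)
    have e: "(\<Prod>i\<in>UNIV. R k $ i $ \<pi> i) = M (v (\<pi> k) t0) $ k * (\<Prod>i\<in>UNIV - {k}. ?A t0 $ i $ \<pi> i)" for k
      by (subst prod.remove[of _ k]) (auto simp: R_def intro!: prod.cong)
    show ?thesis
      unfolding has_field_derivative_def e
      by (rule has_derivative_eq_rhs[OF d]) (simp add: fun_eq_iff sum_distrib_left mult_ac)
  qed
  have "((\<lambda>t. det (?A t)) has_real_derivative (\<Sum>k\<in>UNIV. det (R k))) (at t0)"
  proof -
    have "((\<lambda>t. det (?A t)) has_real_derivative
        (\<Sum>\<pi> | \<pi> permutes UNIV. of_int (sign \<pi>) * (\<Sum>k\<in>UNIV. \<Prod>i\<in>UNIV. R k $ i $ \<pi> i))) (at t0)"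
      unfolding det_def by (intro DERIV_sum DERIV_cmult prod)
    moreover have "(\<Sum>\<pi> | \<pi> permutes UNIV. of_int (sign \<pi>) * (\<Sum>k\<in>UNIV. \<Prod>i\<in>UNIV. R k $ i $ \<pi> i)) = (\<Sum>k\<in>UNIV. det (R k))"
      unfolding det_def sum_distrib_left by (rule sum.swap)
    ultimately show ?thesis by simp
  qed
  moreover have "det (R k) = m k k * det (?A t0)" for k
  proof -
    have "R k = (\<chi> i. if i = k then (\<Sum>j\<in>UNIV. m k j *s ?A t0 $ j) else ?A t0 $ i)"
      by (simp add: R_def vec_eq_iff Mv cols_def)
    then have "det (R k) = (\<Sum>j\<in>UNIV. det (\<chi> i. if i = k then m k j *s ?A t0 $ j else ?A t0 $ i))"
      using det_linear_row_sum[of UNIV k "\<lambda>i j. m k j *s ?A t0 $ j" "\<lambda>i. ?A t0 $ i"] by simp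
    also have "\<dots> = (\<Sum>j\<in>UNIV. if j = k then m k k * det (?A t0) else 0)"
    proof (rule sum.cong[OF refl])
      fix j
      let ?B = "\<chi> i. if i = k then ?A t0 $ j else ?A t0 $ i"
      have "det (\<chi> i. if i = k then m k j *s ?A t0 $ j else ?A t0 $ i) = m k j * det ?B"
        by (rule det_row_mul)
      moreover have "det ?B = 0" if "j \<noteq> k"
        by (rule det_identical_rows[of k j]) (use that in \<open>auto simp: row_def vec_eq_iff\<close>)
      moreover have "det ?B = det (?A t0)" if "j = k"
        using that by (intro arg_cong[where f = det]) (simp add: vec_eq_iff)
      ultimately show "det (\<chi> i. if i = k then m k j *s ?A t0 $ j else ?A t0 $ i) = (if j = k then m k k * det (?A t0) else 0)"
        by auto
    qed
    finally show ?thesis by simp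
  qed
  ultimately show ?thesis by (simp add: m_def sum_distrib_right)
qed

text \<open>At a zero of \<open>f\<close> the derivative vanishes too, so the corner of the absolute
  value does no harm; elsewhere the sign is locally constant. Thus Liouville's formula passes to
  absolute values without excluding zeros of the determinant.\<close>

lemma abs_has_real_derivative_proportional:
  fixes f :: "real \<Rightarrow> real"
  assumes f: "(f has_real_derivative m * f t) (at t)"
  shows "((\<lambda>t. \<bar>f t\<bar>) has_real_derivative m * \<bar>f t\<bar>) (at t)"
proof (cases "f t = 0")
  case True
  have "(\<lambda>h. (f (t + h) - f t) / h) \<midarrow>0\<rightarrow> 0"
    using f True by (simp add: DERIV_def)
  then have "(\<lambda>h. \<bar>f (t + h) / h\<bar>) \<midarrow>0\<rightarrow> 0"
    using True by (simp only: tendsto_rabs_zero_iff diff_0_right)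
  also have "(\<lambda>h. \<bar>f (t + h) / h\<bar>) = (\<lambda>h. \<bar>(\<bar>f (t + h)\<bar> - \<bar>f t\<bar>) / h\<bar>)"
    by (simp add: True fun_eq_iff)
  finally have "(\<lambda>h. (\<bar>f (t + h)\<bar> - \<bar>f t\<bar>) / h) \<midarrow>0\<rightarrow> 0"
    by (rule tendsto_rabs_zero_cancel)
  then show ?thesis using True by (simp add: DERIV_def)
next
  case False
  have cont: "isCont f t" using f by (rule DERIV_isCont)
  have "eventually (\<lambda>s. f s * sgn (f t) > 0) (nhds t)"
  proof (rule order_tendstoD(1))
    show "((\<lambda>s. f s * sgn (f t)) \<longlongrightarrow> f t * sgn (f t)) (nhds t)"
      using cont unfolding isCont_def tendsto_at_iff_tendsto_nhds by (intro tendsto_mult tendsto_const)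
    show "0 < f t * sgn (f t)" using False by (simp add: sgn_if)
  qed
  then have ev: "eventually (\<lambda>s. sgn (f t) * f s = \<bar>f s\<bar>) (nhds t)"
    by eventually_elim (auto simp: sgn_if split: if_splits)
  have "((\<lambda>s. sgn (f t) * f s) has_real_derivative sgn (f t) * (m * f t)) (at t)"
    by (rule DERIV_cmult[OF f])
  then have "((\<lambda>s. \<bar>f s\<bar>) has_real_derivative sgn (f t) * (m * f t)) (at t)"
    using DERIV_cong_ev[OF refl ev refl] by simp
  moreover have "sgn (f t) * (m * f t) = m * \<bar>f t\<bar>" by (simp add: sgn_if)
  ultimately show ?thesis by simp
qed

text \<open>Gronwall's argument for the squared distance \<open>f\<close>, which satisfies
  \<open>\<bar>f' s\<bar> \<le> 2 * L * f s\<close>. Multiplied by a decaying exponential it cannot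
  grow forward in time, multiplied by a growing one it cannot grow backward, and it vanishes at
  \<open>t0\<close>.\<close>

lemma ode_solutions_agree:
  fixes \<alpha> \<beta> :: "real \<Rightarrow> 'a::euclidean_space"
  assumes \<alpha>: "\<And>s. s \<in> I \<Longrightarrow> (\<alpha> has_vector_derivative X (\<alpha> s)) (at s)"
    and \<beta>: "\<And>s. s \<in> I \<Longrightarrow> (\<beta> has_vector_derivative X (\<beta> s)) (at s)"
    and B: "\<And>s. s \<in> I \<Longrightarrow> \<alpha> s \<in> B" "\<And>s. s \<in> I \<Longrightarrow> \<beta> s \<in> B"
    and lip: "\<And>x y. x \<in> B \<Longrightarrow> y \<in> B \<Longrightarrow> norm (X x - X y) \<le> L * norm (x - y)"
    and I: "is_interval I" "t0 \<in> I" "t \<in> I" and eq: "\<alpha> t0 = \<beta> t0"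
  shows "\<alpha> t = \<beta> t"
proof -
  define f where "f s = (\<alpha> s - \<beta> s) \<bullet> (\<alpha> s - \<beta> s)" for s
  define f' where "f' s = 2 * ((\<alpha> s - \<beta> s) \<bullet> (X (\<alpha> s) - X (\<beta> s)))" for s
  have df: "(f has_real_derivative f' s) (at s)" if "s \<in> I" for s
  proof -
    have "((\<lambda>s. \<alpha> s - \<beta> s) has_vector_derivative X (\<alpha> s) - X (\<beta> s)) (at s)"
      by (intro has_vector_derivative_diff \<alpha> \<beta> that)
    then have "((\<lambda>s. \<alpha> s - \<beta> s) has_derivative (\<lambda>h. h *\<^sub>R (X (\<alpha> s) - X (\<beta> s)))) (at s)"
      by (simp add: has_vector_derivative_def)
    from has_derivative_inner[OF this this] show ?thesis
      unfolding f_def f'_def has_field_derivative_def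
      by (rule has_derivative_eq_rhs) (auto simp: inner_commute fun_eq_iff)
  qed
  have bound: "\<bar>f' s\<bar> \<le> 2 * L * f s" if "s \<in> I" for s
  proof -
    have "\<bar>(\<alpha> s - \<beta> s) \<bullet> (X (\<alpha> s) - X (\<beta> s))\<bar> \<le> norm (\<alpha> s - \<beta> s) * norm (X (\<alpha> s) - X (\<beta> s))"
      by (rule Cauchy_Schwarz_ineq2)
    also have "\<dots> \<le> norm (\<alpha> s - \<beta> s) * (L * norm (\<alpha> s - \<beta> s))"
      using lip B that by (intro mult_left_mono) auto
    also have "\<dots> = L * f s" by (simp add: f_def power2_norm_eq_inner[symmetric] power2_eq_square)
    finally show ?thesis by (simp add: f'_def abs_mult)
  qed
  have f0: "f t0 = 0" by (simp add: f_def eq)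
  have mem: "s \<in> I" if "min t0 t \<le> s" "s \<le> max t0 t" for s
  proof (cases "t0 \<le> t")
    case True
    show ?thesis by (rule mem_is_interval_1_I[OF I(1,2,3)]) (use True that in auto)
  next
    case False
    show ?thesis by (rule mem_is_interval_1_I[OF I(1,3,2)]) (use False that in auto)
  qed
  have "f t \<le> 0"
  proof (cases "t0 \<le> t")
    case True
    have "f t * exp (-(2 * L) * t) \<le> f t0 * exp (-(2 * L) * t0)"
    proof (rule DERIV_nonpos_imp_nonincreasing[OF True])
      fix s assume "t0 \<le> s" "s \<le> t"
      then have s: "s \<in> I" using mem by auto
      have "((\<lambda>s. f s * exp (-(2 * L) * s)) has_real_derivative (f' s - 2 * L * f s) * exp (-(2 * L) * s)) (at s)"
        by (auto intro!: derivative_eq_intros df s simp: algebra_simps)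
      moreover have "(f' s - 2 * L * f s) * exp (-(2 * L) * s) \<le> 0"
        using bound[OF s] by (intro mult_nonpos_nonneg) auto
      ultimately show "\<exists>y. ((\<lambda>s. f s * exp (-(2 * L) * s)) has_real_derivative y) (at s) \<and> y \<le> 0" by blast
    qed
    then have "f t * exp (-(2 * L) * t) \<le> 0" using f0 by simp
    then show ?thesis using mult_le_cancel_right_pos[of "exp (-(2 * L) * t)" "f t" 0] by simp
  next
    case False
    then have "t \<le> t0" by simp
    have "f t * exp (2 * L * t) \<le> f t0 * exp (2 * L * t0)"
    proof (rule DERIV_nonneg_imp_nondecreasing[OF \<open>t \<le> t0\<close>])
      fix s assume "t \<le> s" "s \<le> t0"
      then have s: "s \<in> I" using mem by auto
      have "((\<lambda>s. f s * exp (2 * L * s)) has_real_derivative (f' s + 2 * L * f s) * exp (2 * L * s)) (at s)"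
        by (auto intro!: derivative_eq_intros df s simp: algebra_simps)
      moreover have "(f' s + 2 * L * f s) * exp (2 * L * s) \<ge> 0"
        using bound[OF s] by (intro mult_nonneg_nonneg) auto
      ultimately show "\<exists>y. ((\<lambda>s. f s * exp (2 * L * s)) has_real_derivative y) (at s) \<and> y \<ge> 0" by blast
    qed
    then have "f t * exp (2 * L * t) \<le> 0" using f0 by simp
    then show ?thesis using mult_le_cancel_right_pos[of "exp (2 * L * t)" "f t" 0] by simp
  qed
  then have "(\<alpha> t - \<beta> t) \<bullet> (\<alpha> t - \<beta> t) = 0" using inner_ge_zero[of "\<alpha> t - \<beta> t"] by (simp add: f_def)
  then show ?thesis by simp
qed

text \<open>On a compact ball the derivative is bounded, and on the convex open ball the mean value
  inequality turns the bound into a Lipschitz constant.\<close>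

lemma C1_lipschitz_near:
  fixes X :: "real ^ 'n::finite \<Rightarrow> real ^ 'n"
  assumes D: "open D" and X: "Ck_on 1 D X" and z: "z \<in> D"
  obtains r L where "r > 0" "ball z r \<subseteq> D"
    "\<And>x y. x \<in> ball z r \<Longrightarrow> y \<in> ball z r \<Longrightarrow> norm (X x - X y) \<le> L * norm (x - y)"
proof -
  obtain r where r: "r > 0" "cball z r \<subseteq> D" using D z open_contains_cball by blast
  define X' where "X' x = frechet_derivative X (at x)" for x
  have X': "(X has_derivative X' x) (at x)" if "x \<in> D" for x
    unfolding X'_def using Ck_on_has_derivative[of 0] X D that by simp
  have c: "continuous_on D (\<lambda>x. X' x v)" for v
    unfolding X'_def using continuous_on_frechet[of 0] X D by simp
  \<comment> \<open>The sum of the norms of the partial derivatives dominates the operator norm, and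
    its continuity requires only fixed directions.\<close>
  have "continuous_on (cball z r) (\<lambda>x. \<Sum>i\<in>UNIV. norm (X' x (axis i 1)))"
    by (intro continuous_on_sum continuous_on_norm continuous_on_subset[OF c r(2)])
  then have "bounded ((\<lambda>x. \<Sum>i\<in>UNIV. norm (X' x (axis i 1))) ` cball z r)"
    by (intro compact_imp_bounded compact_continuous_image compact_cball)
  then obtain L where "\<forall>y\<in>(\<lambda>x. \<Sum>i\<in>UNIV. norm (X' x (axis i 1))) ` cball z r. norm y \<le> L"
    unfolding bounded_iff by blast
  then have L: "norm (\<Sum>i\<in>UNIV. norm (X' x (axis i 1))) \<le> L" if "x \<in> cball z r" for x
    using that by blast
  have on: "onorm (X' x) \<le> L" if "x \<in> cball z r" for x
  proof (rule onorm_le)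
    fix v
    have lin: "linear (X' x)" using X' r(2) that has_derivative_linear by blast
    have "X' x v = X' x (\<Sum>i\<in>UNIV. v $ i *\<^sub>R axis i 1)"
      using basis_expansion[of v] by (simp add: scalar_mult_eq_scaleR)
    then have "norm (X' x v) \<le> (\<Sum>i\<in>UNIV. norm (v $ i *\<^sub>R X' x (axis i 1)))"
      by (simp only: linear_sum[OF lin] linear_scale[OF lin]) (rule norm_sum)
    also have "\<dots> \<le> (\<Sum>i\<in>UNIV. norm v * norm (X' x (axis i 1)))"
      by (intro sum_mono) (simp add: mult_right_mono component_le_norm_cart)
    also have "\<dots> \<le> L * norm v"
    proof -
      have "(\<Sum>i\<in>UNIV. norm (X' x (axis i 1))) \<le> L" using L[OF that] by simp
      then have "norm v * (\<Sum>i\<in>UNIV. norm (X' x (axis i 1))) \<le> norm v * L"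
        by (intro mult_left_mono) auto
      then show ?thesis by (simp add: sum_distrib_left mult.commute)
    qed
    finally show "norm (X' x v) \<le> L * norm v" .
  qed
  show ?thesis
  proof (rule that[OF r(1)])
    show "ball z r \<subseteq> D" using r(2) by auto
    fix x y assume xy: "x \<in> ball z r" "y \<in> ball z r"
    have 1: "(X has_derivative X' w) (at w within ball z r)" if "w \<in> ball z r" for w
      by (rule has_derivative_at_withinI[OF X']) (use that r(2) in auto)
    have 2: "onorm (X' w) \<le> L" if "w \<in> ball z r" for w
      by (rule on) (use that in auto)
    show "norm (X x - X y) \<le> L * norm (x - y)"
      by (rule differentiable_bound[OF convex_ball 1 2 xy])
  qed
qed

section \<open>The flow of $Y$\<close>

locale level_flow = regular_function A g u
  for A :: "('m::{t2_space,second_countable_topology}, 'n::finite) chart set"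
    and g :: "('m, 'n) metric" and u :: "'m \<Rightarrow> real" +
  fixes \<delta> :: real and N :: "'m set" and \<psi> :: "real \<Rightarrow> 'm \<Rightarrow> 'm"
  assumes flow: "local_flow A (Y_field g u) \<delta> N \<psi>"
begin

abbreviation I :: "real set" where "I \<equiv> {-\<delta><..<\<delta>}"

lemma \<delta>: "\<delta> > 0" and N: "open N" "N \<subseteq> carrier A"
  and \<psi>_carrier: "t \<in> I \<Longrightarrow> x \<in> N \<Longrightarrow> \<psi> t x \<in> carrier A"
  and \<psi>_continuous: "continuous_on (I \<times> N) (\<lambda>(t, x). \<psi> t x)"
  and \<psi>_0: "x \<in> N \<Longrightarrow> \<psi> 0 x = x"
  using flow unfolding local_flow_def by blast+

lemma ode: "x \<in> N \<Longrightarrow> t \<in> I \<Longrightarrow> c \<in> A \<Longrightarrow> \<psi> t x \<in> fst c \<Longrightarrow>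
    ((\<lambda>\<tau>. snd c (\<psi> \<tau> x)) has_vector_derivative Y c (\<psi> t x)) (at t)"
  using flow unfolding local_flow_def by blast

lemma continuous_orbit:
  assumes x: "x \<in> N"
  shows "continuous_on I (\<lambda>t. \<psi> t x)"
proof -
  have "continuous_on I (\<lambda>t. (t, x))" by (intro continuous_intros)
  from continuous_on_compose2[OF \<psi>_continuous this] show ?thesis using x by (simp add: image_subset_iff)
qed

lemma continuous_flow_map:
  assumes t: "t \<in> I"
  shows "continuous_on N (\<psi> t)"
proof -
  have "continuous_on N (\<lambda>x. (t, x))" by (intro continuous_intros)
  from continuous_on_compose2[OF \<psi>_continuous this] show ?thesis using t by (simp add: image_subset_iff)
qed

text \<open>The times at which the orbit of \<open>x\<close> is in \<open>U\<close>. They form an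
  open set when \<open>U\<close> is open, so a computation in one chart is valid at all times near a
  given one.\<close>

definition stay :: "'m \<Rightarrow> 'm set \<Rightarrow> real set" where
  "stay x U = (\<lambda>s. \<psi> s x) -` U \<inter> I"

lemma open_stay: "x \<in> N \<Longrightarrow> open U \<Longrightarrow> open (stay x U)"
  unfolding stay_def using continuous_orbit continuous_on_open_vimage[of I "\<lambda>s. \<psi> s x"] by auto

lemma has_derivative_along_orbit:
  assumes x: "x \<in> N" and t: "t \<in> I" and d: "d \<in> A" "\<psi> t x \<in> fst d"
    and f: "(f has_derivative f') (at (snd d (\<psi> t x)))"
  shows "((\<lambda>s. f (snd d (\<psi> s x))) has_vector_derivative f' (Y d (\<psi> t x))) (at t)"
proof -
  have "((\<lambda>s. snd d (\<psi> s x)) has_derivative (\<lambda>h. h *\<^sub>R Y d (\<psi> t x))) (at t)"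
    using ode[OF x t d] by (simp add: has_vector_derivative_def)
  from has_derivative_compose[OF this f]
  show ?thesis
    using linear_scale[OF has_derivative_linear[OF f]] by (simp add: has_vector_derivative_def)
qed

text \<open>Since the differential of \<open>u\<close> takes the value 1 on \<open>Y\<close>, the
  function \<open>u (\<psi> s x) - s\<close> has derivative 0 on an interval.\<close>

lemma u_flow:
  assumes x: "x \<in> N" and t: "t \<in> I"
  shows "u (\<psi> t x) = u x + t"
proof -
  have "((\<lambda>s. u (\<psi> s x) - s) has_field_derivative 0) (at s within I)" if s: "s \<in> I" for s
  proof -
    define c where "c = chart_at A (\<psi> s x)"
    have c: "c \<in> A" "\<psi> s x \<in> fst c" using chart_at[OF \<psi>_carrier[OF s x]] by (auto simp: c_def)
    have "((\<lambda>r. (u \<circ> cinv c) (snd c (\<psi> r x))) has_vector_derivative 1) (at s)"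
      using has_derivative_along_orbit[OF x s c differential_has_derivative[OF c]] by (simp add: differential_Y c)
    then have "((\<lambda>r. u (\<psi> r x)) has_vector_derivative 1) (at s)"
    proof (rule has_vector_derivative_transform_within_open)
      show "open (stay x (fst c))" by (rule open_stay[OF x chartD(1)[OF c(1)]])
      show "s \<in> stay x (fst c)" using s c by (simp add: stay_def)
      show "(u \<circ> cinv c) (snd c (\<psi> r x)) = u (\<psi> r x)" if "r \<in> stay x (fst c)" for r
        using that chartD(3)[OF c(1)] by (simp add: stay_def)
    qed
    then have "((\<lambda>r. u (\<psi> r x)) has_field_derivative 1) (at s)"
      by (simp add: has_real_derivative_iff_has_vector_derivative)
    from DERIV_diff[OF this DERIV_ident] show ?thesis
      by (auto intro: has_field_derivative_at_within)
  qed
  then obtain k where k: "\<And>s. s \<in> I \<Longrightarrow> u (\<psi> s x) - s = k"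
    using has_field_derivative_zero_constant[of I "\<lambda>s. u (\<psi> s x) - s"] by auto
  have "0 \<in> I" using \<delta> by simp
  with k[OF this] k[OF t] \<psi>_0[OF x] show ?thesis by simp
qed

section \<open>The flow in charts and its variational equation\<close>

definition Wr :: "('m, 'n) chart \<Rightarrow> ('m, 'n) chart \<Rightarrow> (real \<times> (real ^ 'n)) set" where
  "Wr c d = {(t, y). t \<in> I \<and> y \<in> snd c ` (N \<inter> fst c) \<and> \<psi> t (cinv c y) \<in> fst d}"

definition Rep :: "('m, 'n) chart \<Rightarrow> ('m, 'n) chart \<Rightarrow> real \<times> (real ^ 'n) \<Rightarrow> real ^ 'n" where
  "Rep c d = (\<lambda>(t, y). snd d (\<psi> t (cinv c y)))"

definition DRep :: "('m, 'n) chart \<Rightarrow> ('m, 'n) chart \<Rightarrow> real \<times> (real ^ 'n) \<Rightarrow> real \<times> (real ^ 'n) \<Rightarrow> real ^ 'n" where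
  "DRep c d p = frechet_derivative (Rep c d) (at p)"

lemma Wr_iff: "c \<in> A \<Longrightarrow> x \<in> fst c \<Longrightarrow> (t, snd c x) \<in> Wr c d \<longleftrightarrow> t \<in> I \<and> x \<in> N \<and> \<psi> t x \<in> fst d"
  unfolding Wr_def using chartD(3)[of c] by (auto simp: image_iff) (metis)

lemma Wr_cinv: "c \<in> A \<Longrightarrow> (t, y) \<in> Wr c d \<Longrightarrow>
    cinv c y \<in> N \<and> cinv c y \<in> fst c \<and> snd c (cinv c y) = y \<and> t \<in> I \<and> \<psi> t (cinv c y) \<in> fst d"
  unfolding Wr_def using chartD(3)[of c] by auto

lemma open_Wr:
  assumes c: "c \<in> A" and d: "d \<in> A"
  shows "open (Wr c d)"
proof -
  let ?P = "I \<times> snd c ` (fst c \<inter> N)"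
  have P: "open ?P" by (intro open_Times open_chart_image chart c N) auto
  have "continuous_on ?P (\<lambda>p. (\<lambda>(t, x). \<psi> t x) (fst p, cinv c (snd p)))"
  proof (rule continuous_on_compose2[OF \<psi>_continuous])
    have "continuous_on ?P (\<lambda>p. cinv c (snd p))"
      by (rule continuous_on_compose2[OF chartD(7)[OF c]]) (auto intro!: continuous_intros)
    then show "continuous_on ?P (\<lambda>p. (fst p, cinv c (snd p)))"
      by (intro continuous_intros)
    show "(\<lambda>p. (fst p, cinv c (snd p))) ` ?P \<subseteq> I \<times> N"
      using chartD(3)[OF c] by auto
  qed
  then have "open ((\<lambda>p. (\<lambda>(t, x). \<psi> t x) (fst p, cinv c (snd p))) -` fst d \<inter> ?P)"
    using continuous_on_open_vimage[OF P] chartD(1)[OF d] by blast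
  moreover have "(\<lambda>p. (\<lambda>(t, x). \<psi> t x) (fst p, cinv c (snd p))) -` fst d \<inter> ?P = Wr c d"
    by (auto simp: Wr_def)
  ultimately show ?thesis by simp
qed

lemma Rep_Ck:
  assumes c: "c \<in> A" and d: "d \<in> A"
  shows "Ck_on 1 (Wr c d) (Rep c d)"
  using flow c d unfolding local_flow_def Wr_def Rep_def by blast

lemma Rep_has_derivative:
  assumes c: "c \<in> A" and d: "d \<in> A" and p: "p \<in> Wr c d"
  shows "(Rep c d has_derivative DRep c d p) (at p)"
  unfolding DRep_def using Ck_on_has_derivative[OF _ open_Wr[OF c d] p, of 0] Rep_Ck[OF c d] by simp

lemma continuous_on_DRep:
  assumes c: "c \<in> A" and d: "d \<in> A"
  shows "continuous_on (Wr c d) (\<lambda>p. DRep c d p v)"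
  unfolding DRep_def using continuous_on_frechet[OF _ open_Wr[OF c d], of 0] Rep_Ck[OF c d] by simp

lemma Rep_has_derivative_space:
  assumes c: "c \<in> A" and d: "d \<in> A" and p: "(t, y) \<in> Wr c d"
  shows "((\<lambda>y. Rep c d (t, y)) has_derivative (\<lambda>h. DRep c d (t, y) (0, h))) (at y)"
proof (rule has_derivative_compose[where g = "Rep c d" and f = "\<lambda>y. (t, y)"])
  show "((\<lambda>y. (t, y)) has_derivative (\<lambda>h. (0, h))) (at y)"
    by (auto intro!: derivative_eq_intros)
qed (rule Rep_has_derivative[OF c d p])

text \<open>Freezes the time in the joint C^1 regularity of the flow; the derivative in space is the
  joint derivative along vectors \<open>(0, h)\<close>.\<close>

lemma shift_map_flow:
  assumes t: "t \<in> I"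
  shows "shift_map t N (\<psi> t)"
  unfolding shift_map_def
proof (intro conjI ballI)
  show "open N" "N \<subseteq> carrier A" by (rule N)+
  show cont: "continuous_on N (\<psi> t)" by (rule continuous_flow_map[OF t])
  show "\<psi> t ` N \<subseteq> carrier A" using \<psi>_carrier[OF t] by auto
  show "u (\<psi> t x) = u x + t" if "x \<in> N" for x by (rule u_flow[OF that t])
  fix c d assume c: "c \<in> A" and d: "d \<in> A"
  let ?U = "snd c ` (fst c \<inter> (N \<inter> \<psi> t -` fst d))"
  have "open (N \<inter> \<psi> t -` fst d)"
    using cont continuous_on_open_vimage[OF N(1)] chartD(1)[OF d] by (metis Int_commute)
  then have U: "open ?U" by (rule open_chart_image[OF chart[OF c]])
  have UW: "(t, y) \<in> Wr c d" if y: "y \<in> ?U" for y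
  proof -
    obtain x where "x \<in> fst c" "x \<in> N" "\<psi> t x \<in> fst d" "y = snd c x" using y by auto
    then show ?thesis using Wr_iff[OF c, of x t d] t by simp
  qed
  have "Ck_on (Suc 0) ?U (\<lambda>y. Rep c d (t, y))"
  proof (rule Ck_on_SucI[OF U Rep_has_derivative_space[OF c d UW]])
    have "continuous_on ?U (\<lambda>y. DRep c d (t, y) (0, v))" for v
      by (rule continuous_on_compose2[OF continuous_on_DRep[OF c d]]) (use UW in \<open>auto intro!: continuous_intros\<close>)
    then show "Ck_on 0 ?U (\<lambda>y. DRep c d (t, y) (0, v))" for v by (simp add: Ck_on.simps)
  qed
  then show "Ck_on 1 ?U (snd d \<circ> \<psi> t \<circ> cinv c)" by (simp add: Rep_def o_def)
qed

lemma deriv_rep_flow: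
  assumes c: "c \<in> A" "x \<in> fst c" and x: "x \<in> N" and t: "t \<in> I" and d: "d \<in> A" "\<psi> t x \<in> fst d"
  shows "deriv_rep (\<psi> t) c d x h = DRep c d (t, snd c x) (0, h)"
proof -
  have "(snd d \<circ> \<psi> t \<circ> cinv c has_derivative (\<lambda>h. DRep c d (t, snd c x) (0, h))) (at (snd c x))"
    using Rep_has_derivative_space[OF c(1) d(1), of t "snd c x"] Wr_iff[OF c] x t d by (simp add: Rep_def o_def)
  from has_derivative_unique[OF deriv_rep[OF shift_map_flow[OF t] c x d] this] show ?thesis by metis
qed

definition DY :: "('m, 'n) chart \<Rightarrow> real ^ 'n \<Rightarrow> real ^ 'n \<Rightarrow> real ^ 'n" where
  "DY d z = frechet_derivative (\<lambda>y. Y d (cinv d y)) (at z)"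

lemma DY:
  assumes d: "d \<in> A" "z \<in> snd d ` fst d"
  shows "((\<lambda>y. Y d (cinv d y)) has_derivative DY d z) (at z)"
  unfolding DY_def using Ck_on_has_derivative[OF _ chartD(2)[OF d(1)] d(2), of 0] Y_Ck[OF d(1)] by simp

lemma linear_DY: "d \<in> A \<Longrightarrow> z \<in> snd d ` fst d \<Longrightarrow> linear (DY d z)"
  using DY has_derivative_linear by blast

lemma continuous_on_DY:
  assumes d: "d \<in> A"
  shows "continuous_on (snd d ` fst d) (\<lambda>z. DY d z v)"
  unfolding DY_def using continuous_on_frechet[OF _ chartD(2)[OF d], of 0] Y_Ck[OF d] by simp

text \<open>Applies \<open>mixed_derivative_swap\<close> to the flow started at
  \<open>y0 + \<sigma> *\<^sub>R h\<close>. The integral curve equation identifies the derivative in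
  \<open>t\<close> with \<open>Y\<close> at the moving point, and this can be differentiated in
  \<open>\<sigma>\<close> because both \<open>Y\<close> and the flow are C^1.\<close>

lemma variational_equation:
  assumes x: "x \<in> N" and c: "c \<in> A" "x \<in> fst c" and t0: "t0 \<in> I" and d: "d \<in> A" "\<psi> t0 x \<in> fst d"
  shows "((\<lambda>t. deriv_rep (\<psi> t) c d x h) has_vector_derivative
    DY d (snd d (\<psi> t0 x)) (deriv_rep (\<psi> t0) c d x h)) (at t0)"
proof -
  define y0 where "y0 = snd c x"
  define G where "G = (\<lambda>(t, \<sigma>::real). (t::real, y0 + \<sigma> *\<^sub>R h))"
  have G: "continuous_on X G" for X
    unfolding G_def case_prod_unfold by (intro continuous_intros)
  have "open (G -` Wr c d)" by (rule open_vimage[OF open_Wr[OF c(1) d(1)] G])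
  moreover have "(t0, 0) \<in> G -` Wr c d"
    using Wr_iff[OF c] x t0 d by (simp add: G_def y0_def)
  ultimately obtain e where e: "e > 0" "ball (t0, 0) e \<subseteq> G -` Wr c d"
    using open_contains_ball by blast
  \<comment> \<open>With a third of the radius,
    \<open>\<bar>t - t0\<bar> + \<bar>\<sigma>\<bar>\<close> is at most two thirds of
    \<open>e\<close>, so the closed square lies in the open ball.\<close>
  define r where "r = e / 3"
  have r: "r > 0" using e by (simp add: r_def)
  have GW: "(t, y0 + \<sigma> *\<^sub>R h) \<in> Wr c d" if "\<bar>t - t0\<bar> \<le> r" "\<bar>\<sigma>\<bar> \<le> r" for t \<sigma>
  proof -
    have "dist (t0, 0) (t, \<sigma>) \<le> \<bar>t - t0\<bar> + \<bar>\<sigma>\<bar>"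
      unfolding dist_Pair_Pair using sqrt_sum_squares_le_sum_abs[of "dist t0 t" "dist 0 \<sigma>"]
      by (simp add: dist_real_def abs_minus_commute)
    also have "\<dots> < e" using that e(1) by (simp add: r_def)
    finally have "(t, \<sigma>) \<in> ball (t0, 0) e" by simp
    then show ?thesis using e(2) by (auto simp: G_def)
  qed
  have RepD: "Rep c d p \<in> snd d ` fst d" if "p \<in> Wr c d" for p
    using that by (auto simp: Rep_def Wr_def)
  have lin: "linear (DRep c d p)" if "p \<in> Wr c d" for p
    using Rep_has_derivative[OF c(1) d(1) that] has_derivative_linear by blast
  have scale0: "DRep c d p (0, s *\<^sub>R v) = s *\<^sub>R DRep c d p (0, v)" if "p \<in> Wr c d" for p s v
    using linear_scale[OF lin[OF that], of s "(0, v)"] by simp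
  have Rep_\<sigma>: "((\<lambda>\<sigma>. Rep c d (t, y0 + \<sigma> *\<^sub>R h)) has_derivative (\<lambda>s. s *\<^sub>R DRep c d (t, y0 + \<sigma> *\<^sub>R h) (0, h))) (at \<sigma>)"
    if "\<bar>t - t0\<bar> \<le> r" "\<bar>\<sigma>\<bar> \<le> r" for t \<sigma>
  proof -
    have line: "((\<lambda>\<sigma>. y0 + \<sigma> *\<^sub>R h) has_derivative (\<lambda>s. s *\<^sub>R h)) (at \<sigma>)"
      by (auto intro!: derivative_eq_intros)
    show ?thesis
      using has_derivative_compose[OF line Rep_has_derivative_space[OF c(1) d(1) GW[OF that]]]
      by (simp add: scale0[OF GW[OF that]])
  qed
  define q where "q t \<sigma> = DY d (Rep c d (t, y0 + \<sigma> *\<^sub>R h)) (DRep c d (t, y0 + \<sigma> *\<^sub>R h) (0, h))" for t \<sigma>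
  have "((\<lambda>t. DRep c d (t, y0) (0, h)) has_vector_derivative q t0 0) (at t0)"
  proof (rule mixed_derivative_swap[OF r, where \<phi> = "\<lambda>t \<sigma>. Rep c d (t, y0 + \<sigma> *\<^sub>R h)"
        and p = "\<lambda>t \<sigma>. Y d (cinv d (Rep c d (t, y0 + \<sigma> *\<^sub>R h)))"])
    fix t \<sigma> :: real assume t: "\<bar>t - t0\<bar> \<le> r" and \<sigma>: "\<bar>\<sigma>\<bar> \<le> r"
    note gw = GW[OF t \<sigma>]
    note w = Wr_cinv[OF c(1) gw]
    show "((\<lambda>t. Rep c d (t, y0 + \<sigma> *\<^sub>R h)) has_vector_derivative Y d (cinv d (Rep c d (t, y0 + \<sigma> *\<^sub>R h)))) (at t)"
      using ode[of "cinv c (y0 + \<sigma> *\<^sub>R h)" t d] w d(1) chartD(3)[OF d(1)] by (simp add: Rep_def)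
    have "((\<lambda>\<sigma>. Y d (cinv d (Rep c d (t, y0 + \<sigma> *\<^sub>R h)))) has_derivative
        (\<lambda>s. DY d (Rep c d (t, y0 + \<sigma> *\<^sub>R h)) (s *\<^sub>R DRep c d (t, y0 + \<sigma> *\<^sub>R h) (0, h)))) (at \<sigma>)"
      by (rule has_derivative_compose[OF Rep_\<sigma>[OF t \<sigma>] DY[OF d(1) RepD[OF gw]]])
    then show "((\<lambda>\<sigma>. Y d (cinv d (Rep c d (t, y0 + \<sigma> *\<^sub>R h)))) has_vector_derivative q t \<sigma>) (at \<sigma>)"
      by (simp add: has_vector_derivative_def q_def linear_scale[OF linear_DY[OF d(1) RepD[OF gw]]])
  next
    fix t assume t: "\<bar>t - t0\<bar> \<le> r"
    show "((\<lambda>\<sigma>. Rep c d (t, y0 + \<sigma> *\<^sub>R h)) has_vector_derivative DRep c d (t, y0) (0, h)) (at 0)"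
      using Rep_\<sigma>[OF t, of 0] r by (simp add: has_vector_derivative_def)
  next
    let ?P = "{-r..r} \<times> {t0 - r..t0 + r}"
    have PW: "(snd p, y0 + fst p *\<^sub>R h) \<in> Wr c d" if "p \<in> ?P" for p
      using that by (intro GW) (auto simp: abs_le_iff)
    have aff: "continuous_on ?P (\<lambda>p. (snd p, y0 + fst p *\<^sub>R h))" by (intro continuous_intros)
    have cD: "continuous_on ?P (\<lambda>p. DRep c d (snd p, y0 + fst p *\<^sub>R h) (0, h))"
      by (rule continuous_on_compose2[OF continuous_on_DRep[OF c(1) d(1)] aff]) (use PW in auto)
    have cR: "continuous_on ?P (\<lambda>p. Rep c d (snd p, y0 + fst p *\<^sub>R h))"
      by (rule continuous_on_compose2[OF Ck_on_imp_continuous_on[OF open_Wr[OF c(1) d(1)] Rep_Ck[OF c(1) d(1)]] aff])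
        (use PW in auto)
    have cY: "continuous_on ?P (\<lambda>p. DY d (Rep c d (snd p, y0 + fst p *\<^sub>R h)) v)" for v
      by (rule continuous_on_compose2[OF continuous_on_DY[OF d(1)] cR]) (use PW RepD in auto)
    \<comment> \<open>As before, the moving argument of \<open>DY\<close> is expanded in the
      standard basis to reduce joint continuity to fixed directions.\<close>
    have "continuous_on ?P (\<lambda>p. \<Sum>i\<in>UNIV. DRep c d (snd p, y0 + fst p *\<^sub>R h) (0, h) $ i *\<^sub>R
        DY d (Rep c d (snd p, y0 + fst p *\<^sub>R h)) (axis i 1))"
      by (intro continuous_intros cD cY)
    then show "continuous_on ?P (\<lambda>(\<sigma>, t). q t \<sigma>)"
    proof (rule continuous_on_eq)
      fix p assume "p \<in> ?P"
      note l = linear_DY[OF d(1) RepD[OF PW[OF this]]]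
      let ?v = "DRep c d (snd p, y0 + fst p *\<^sub>R h) (0, h)"
      have "(\<Sum>i\<in>UNIV. ?v $ i *\<^sub>R DY d (Rep c d (snd p, y0 + fst p *\<^sub>R h)) (axis i 1)) =
          DY d (Rep c d (snd p, y0 + fst p *\<^sub>R h)) (\<Sum>i\<in>UNIV. ?v $ i *\<^sub>R axis i 1)"
        by (simp add: linear_sum[OF l] linear_scale[OF l])
      also have "(\<Sum>i\<in>UNIV. ?v $ i *\<^sub>R axis i 1) = ?v"
        using basis_expansion[of ?v] by (simp add: scalar_mult_eq_scaleR)
      finally show "(\<Sum>i\<in>UNIV. ?v $ i *\<^sub>R DY d (Rep c d (snd p, y0 + fst p *\<^sub>R h)) (axis i 1)) = (\<lambda>(\<sigma>, t). q t \<sigma>) p"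
        by (simp add: q_def case_prod_unfold)
    qed
  qed
  moreover have "q t0 0 = DY d (snd d (\<psi> t0 x)) (deriv_rep (\<psi> t0) c d x h)"
    using deriv_rep_flow[OF c x t0 d] chartD(3)[OF c] by (simp add: q_def Rep_def y0_def)
  ultimately have 1: "((\<lambda>t. DRep c d (t, y0) (0, h)) has_vector_derivative
      DY d (snd d (\<psi> t0 x)) (deriv_rep (\<psi> t0) c d x h)) (at t0)" by simp
  show ?thesis
  proof (rule has_vector_derivative_transform_within_open[OF 1])
    show "open (stay x (fst d))" by (rule open_stay[OF x chartD(1)[OF d(1)]])
    show "t0 \<in> stay x (fst d)" using t0 d by (simp add: stay_def)
    show "DRep c d (t, y0) (0, h) = deriv_rep (\<psi> t) c d x h" if "t \<in> stay x (fst d)" for t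
      using that deriv_rep_flow[OF c x _ d(1)] by (simp add: stay_def y0_def)
  qed
qed

text \<open>The velocity of an orbit solves the same linear equation as the images of fixed tangent
  vectors, so \<open>Y\<close> can stand as a column next to them in Liouville's formula.\<close>

lemma Y_along_orbit:
  assumes x: "x \<in> N" and t: "t \<in> I" and d: "d \<in> A" "\<psi> t x \<in> fst d"
  shows "((\<lambda>s. Y d (\<psi> s x)) has_vector_derivative DY d (snd d (\<psi> t x)) (Y d (\<psi> t x))) (at t)"
proof (rule has_vector_derivative_transform_within_open[OF has_derivative_along_orbit[OF x t d DY[OF d(1)]]])
  show "open (stay x (fst d))" by (rule open_stay[OF x chartD(1)[OF d(1)]])
  show "t \<in> stay x (fst d)" using t d by (simp add: stay_def)
  show "Y d (cinv d (snd d (\<psi> s x))) = Y d (\<psi> s x)" if "s \<in> stay x (fst d)" for s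
    using that chartD(3)[OF d(1)] by (simp add: stay_def)
qed (use d in auto)

text \<open>Orbits may leave every single chart, so local uniqueness is propagated by connectedness.
  The times at which two orbits coincide form a set that is closed, the manifold being Hausdorff,
  and open, by the Lipschitz estimate in a chart; as it contains \<open>t\<close>, it contains
  0.\<close>

lemma flow_injective:
  assumes t: "t \<in> I" and x: "x \<in> N" and y: "y \<in> N" and eq: "\<psi> t x = \<psi> t y"
  shows "x = y"
proof -
  define E where "E = {s \<in> I. \<psi> s x = \<psi> s y}"
  have "\<exists>T. open T \<and> s \<in> T \<and> T \<subseteq> E" if s: "s \<in> E" for s
  proof -
    have sI: "s \<in> I" and eqs: "\<psi> s x = \<psi> s y" using s by (auto simp: E_def)
    define d where "d = chart_at A (\<psi> s x)"
    have d: "d \<in> A" "\<psi> s x \<in> fst d" using chart_at[OF \<psi>_carrier[OF sI x]] by (auto simp: d_def)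
    note dD = chartD[OF d(1)]
    obtain r L where r: "r > 0" "ball (snd d (\<psi> s x)) r \<subseteq> snd d ` fst d"
      and lip: "\<And>v w. v \<in> ball (snd d (\<psi> s x)) r \<Longrightarrow> w \<in> ball (snd d (\<psi> s x)) r \<Longrightarrow>
        norm (Y d (cinv d v) - Y d (cinv d w)) \<le> L * norm (v - w)"
      using C1_lipschitz_near[OF dD(2) Y_Ck[OF d(1)], of "snd d (\<psi> s x)"] d by blast
    define U where "U = snd d -` ball (snd d (\<psi> s x)) r \<inter> fst d"
    have U: "open U"
      unfolding U_def using continuous_on_open_vimage[OF dD(1)] dD(6) open_ball by blast
    have "open (stay x U \<inter> stay y U)" by (intro open_Int open_stay x y U)
    moreover have "s \<in> stay x U \<inter> stay y U"
      using sI d r(1) eqs by (auto simp: stay_def U_def)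
    ultimately obtain e where e: "e > 0" "ball s e \<subseteq> stay x U \<inter> stay y U"
      using open_contains_ball by blast
    have B: "\<psi> \<tau> x \<in> U" "\<psi> \<tau> y \<in> U" "\<tau> \<in> I" if "\<tau> \<in> ball s e" for \<tau>
      using e(2) that by (auto simp: stay_def)
    have "ball s e \<subseteq> E"
    proof
      fix \<tau> assume \<tau>: "\<tau> \<in> ball s e"
      have "snd d (\<psi> \<tau> x) = snd d (\<psi> \<tau> y)"
      proof (rule ode_solutions_agree[where I = "ball s e" and X = "\<lambda>v. Y d (cinv d v)"
            and B = "ball (snd d (\<psi> s x)) r" and L = L and ?t0.0 = s])
        show "((\<lambda>\<tau>. snd d (\<psi> \<tau> x)) has_vector_derivative Y d (cinv d (snd d (\<psi> r x)))) (at r)"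
          if "r \<in> ball s e" for r
          using ode[OF x B(3)[OF that] d(1)] B(1)[OF that] dD(3) by (simp add: U_def)
        show "((\<lambda>\<tau>. snd d (\<psi> \<tau> y)) has_vector_derivative Y d (cinv d (snd d (\<psi> r y)))) (at r)"
          if "r \<in> ball s e" for r
          using ode[OF y B(3)[OF that] d(1)] B(2)[OF that] dD(3) by (simp add: U_def)
        show "is_interval (ball s e)" by (simp add: is_interval_ball_real)
      qed (use B lip \<tau> e(1) eqs in \<open>auto simp: U_def\<close>)
      moreover have "\<psi> \<tau> x \<in> fst d" "\<psi> \<tau> y \<in> fst d" using B[OF \<tau>] by (auto simp: U_def)
      ultimately have "\<psi> \<tau> x = \<psi> \<tau> y" using dD(3) by metis
      then show "\<tau> \<in> E" using B(3)[OF \<tau>] by (simp add: E_def)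
    qed
    then show ?thesis using e(1) by (intro exI[of _ "ball s e"]) auto
  qed
  then have "open E" by (metis open_subopen)
  moreover have "closedin (top_of_set I) E"
  proof -
    have "continuous_on I (\<lambda>s. (\<psi> s x, \<psi> s y))"
      by (intro continuous_on_Pair continuous_orbit x y)
    from continuous_closedin_preimage[OF this closed_diagonal]
    have "closedin (top_of_set I) (I \<inter> (\<lambda>s. (\<psi> s x, \<psi> s y)) -` {y. \<exists>x. y = (x, x)})" .
    moreover have "I \<inter> (\<lambda>s. (\<psi> s x, \<psi> s y)) -` {y. \<exists>x. y = (x, x)} = E"
      by (auto simp: E_def)
    ultimately show ?thesis by simp
  qed
  moreover have "connected I" by simp
  moreover have "t \<in> E" using t eq by (simp add: E_def)
  ultimately have "E = I"
    unfolding connected_clopen by (metis E_def emptyE openin_open_eq open_greaterThanLessThan mem_Collect_eq subsetI)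
  then have "0 \<in> E" using \<delta> by simp
  then show ?thesis using \<psi>_0 x y by (simp add: E_def)
qed

end

context level_flow
begin

text \<open>On a chart, $\sqrt{\det G}\,|\nabla u|^{q-2}\nabla u = \omega Y$ with
  $\omega = \sqrt{\det G}\,|\nabla u|^q$.\<close>

definition weight :: "real \<Rightarrow> ('m, 'n) chart \<Rightarrow> real ^ 'n \<Rightarrow> real" where
  "weight q d y = sqrt (det (g d (cinv d y))) * (grad_norm A g u (cinv d y)) powr q"

text \<open>The power \<open>q\<close> of the norm is treated as the power \<open>q / 2\<close> of
  its square, which is already known to be C^1 and positive.\<close>

lemma weight_differentiable:
  assumes d: "d \<in> A" "x \<in> fst d"
  obtains \<omega>' where "(weight q d has_derivative \<omega>') (at (snd d x))"
proof -
  let ?D = "snd d ` fst d"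
  note dD = chartD[OF d(1)]
  have z: "snd d x \<in> ?D" using d by auto
  let ?det = "\<lambda>y. det (g d (cinv d y))" and ?n2 = "\<lambda>y. (grad_norm A g u (cinv d y))\<^sup>2"
  have "(?det has_derivative frechet_derivative ?det (at (snd d x))) (at (snd d x))"
    using Ck_on_has_derivative[OF _ dD(2) z, of 0] det_g_Ck[OF d(1)] by simp
  then obtain D1 where D1: "(?det has_derivative D1) (at (snd d x))" by blast
  have "(?n2 has_derivative frechet_derivative ?n2 (at (snd d x))) (at (snd d x))"
    using Ck_on_has_derivative[OF _ dD(2) z, of 0] grad_norm_sq_Ck[OF d(1)] by simp
  then obtain D2 where D2: "(?n2 has_derivative D2) (at (snd d x))" by blast
  have pos: "?det (snd d x) > 0" "?n2 (snd d x) > 0"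
    using det_g_pos[OF d] gn_pos[OF d] dD(3)[OF d(2)] by auto
  have S: "(sqrt has_derivative (\<lambda>h. h * (inverse (sqrt (?det (snd d x))) / 2))) (at (?det (snd d x)))"
    by (rule has_derivative_eq_rhs[OF DERIV_real_sqrt[OF pos(1), unfolded has_field_derivative_def]])
      (simp add: fun_eq_iff)
  have P: "((\<lambda>r. r powr (q / 2)) has_derivative (\<lambda>h. h * (q / 2 * ?n2 (snd d x) powr (q / 2 - 1)))) (at (?n2 (snd d x)))"
    by (rule has_derivative_eq_rhs[OF has_real_derivative_powr[OF pos(2), of "q / 2", unfolded has_field_derivative_def]])
      (simp add: fun_eq_iff)
  have "((\<lambda>y. sqrt (?det y) * ?n2 y powr (q / 2)) has_derivative
      (\<lambda>h. sqrt (?det (snd d x)) * (D2 h * (q / 2 * ?n2 (snd d x) powr (q / 2 - 1))) +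
        D1 h * (inverse (sqrt (?det (snd d x))) / 2) * ?n2 (snd d x) powr (q / 2))) (at (snd d x))"
    by (intro has_derivative_mult has_derivative_compose[OF D1 S] has_derivative_compose[OF D2 P])
  then have "(weight q d has_derivative
      (\<lambda>h. sqrt (?det (snd d x)) * (D2 h * (q / 2 * ?n2 (snd d x) powr (q / 2 - 1))) +
        D1 h * (inverse (sqrt (?det (snd d x))) / 2) * ?n2 (snd d x) powr (q / 2))) (at (snd d x))"
  proof (rule has_derivative_transform_within_open[OF _ dD(2) z])
    fix y assume "y \<in> ?D"
    then have "grad_norm A g u (cinv d y) > 0" using gn_pos[OF d(1)] dD(5) by blast
    then have "?n2 y = grad_norm A g u (cinv d y) powr 2" by (simp add: powr_numeral)
    then have "?n2 y powr (q / 2) = grad_norm A g u (cinv d y) powr q"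
      by (simp only: powr_powr) simp
    then show "sqrt (?det y) * ?n2 y powr (q / 2) = weight q d y"
      by (simp add: weight_def)
  qed
  then show ?thesis by (rule that)
qed

text \<open>The product rule for the divergence of \<open>\<omega> Y\<close>. It splits into the
  derivative of the weight along the orbit and the trace of \<open>DY\<close>, the very two terms
  that arise when the transported integrand is differentiated. The chart is the distinguished one,
  in which \<open>divergence\<close> is evaluated.\<close>

lemma q_laplacian_eq:
  assumes x: "x \<in> carrier A" and d: "d = chart_at A x"
    and \<omega>': "(weight q d has_derivative \<omega>') (at (snd d x))"
  shows "q_laplacian A g q u x =
    (\<omega>' (Y d x) + weight q d (snd d x) * (\<Sum>i\<in>UNIV. DY d (snd d x) (axis i 1) $ i)) / sqrt (det (g d x))"
proof -
  have dA: "d \<in> A" "x \<in> fst d" using chart_at[OF x] d by auto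
  note dD = chartD[OF dA(1)]
  let ?z = "snd d x" and ?D = "snd d ` fst d"
  have z: "?z \<in> ?D" using dA by auto
  let ?X = "\<lambda>y i. sqrt (det (g d (cinv d y))) *
      ((gnorm g d (cinv d y) (grad g u d (cinv d y)) powr (q - 2)) *\<^sub>R grad g u d (cinv d y)) $ i"
  have X: "?X y i = weight q d y * Y d (cinv d y) $ i" if "y \<in> ?D" for y i
  proof -
    have c: "cinv d y \<in> fst d" using dD(5)[OF that] .
    let ?n = "grad_norm A g u (cinv d y)"
    have n: "?n > 0" by (rule gn_pos[OF dA(1) c])
    have "?n powr q = ?n powr (q - 2) * ?n\<^sup>2"
      using n by (simp add: powr_diff powr_numeral)
    then show ?thesis
      using n by (simp add: weight_def Y_eq[OF dA(1) c] grad_norm_eq[OF dA(1) c])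
  qed
  have der: "frechet_derivative (\<lambda>y. ?X y i) (at ?z) =
      (\<lambda>h. weight q d ?z * DY d ?z h $ i + \<omega>' h * Y d x $ i)" for i
  proof -
    have Yi: "((\<lambda>y. Y d (cinv d y) $ i) has_derivative (\<lambda>h. DY d ?z h $ i)) (at ?z)"
      by (rule bounded_linear.has_derivative[OF bounded_linear_vec_nth DY[OF dA(1) z]])
    have "((\<lambda>y. weight q d y * Y d (cinv d y) $ i) has_derivative
        (\<lambda>h. weight q d ?z * DY d ?z h $ i + \<omega>' h * Y d (cinv d ?z) $ i)) (at ?z)"
      by (rule has_derivative_mult[OF \<omega>' Yi])
    then have "((\<lambda>y. ?X y i) has_derivative
        (\<lambda>h. weight q d ?z * DY d ?z h $ i + \<omega>' h * Y d (cinv d ?z) $ i)) (at ?z)"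
      by (rule has_derivative_transform_within_open[OF _ dD(2) z]) (rule X[symmetric])
    from frechet_derivative_at[OF this] show ?thesis using dD(3)[OF dA(2)] by simp
  qed
  have l: "linear \<omega>'" using \<omega>' by (rule has_derivative_linear)
  have "(\<Sum>i\<in>UNIV. \<omega>' (axis i 1) * Y d x $ i) = \<omega>' (\<Sum>i\<in>UNIV. Y d x $ i *\<^sub>R axis i 1)"
    by (simp add: linear_sum[OF l] linear_scale[OF l] mult.commute)
  also have "(\<Sum>i\<in>UNIV. Y d x $ i *\<^sub>R axis i 1) = Y d x"
    using basis_expansion[of "Y d x"] by (simp add: scalar_mult_eq_scaleR)
  finally have s: "(\<Sum>i\<in>UNIV. \<omega>' (axis i 1) * Y d x $ i) = \<omega>' (Y d x)" .
  have "q_laplacian A g q u x = (\<Sum>i\<in>UNIV. frechet_derivative (\<lambda>y. ?X y i) (at ?z) (axis i 1)) / sqrt (det (g d x))"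
    by (simp add: q_laplacian_def divergence_def Let_def d)
  also have "(\<Sum>i\<in>UNIV. frechet_derivative (\<lambda>y. ?X y i) (at ?z) (axis i 1)) =
      \<omega>' (Y d x) + weight q d ?z * (\<Sum>i\<in>UNIV. DY d ?z (axis i 1) $ i)"
    unfolding der by (simp add: sum.distrib s sum_distrib_left add.commute)
  finally show ?thesis .
qed

section \<open>The derivative of the transported integrand\<close>

definition integrand :: "real \<Rightarrow> 'm \<Rightarrow> real \<Rightarrow> real" where
  "integrand q x t = level_jacobian A g u (\<psi> t) x * grad_norm A g u (\<psi> t x) powr (q - 1)"

lemma integrand_has_derivative:
  assumes x: "x \<in> N" and t0: "t0 \<in> I"
  shows "(integrand q x has_real_derivative
    q_laplacian A g q u (\<psi> t0 x) / grad_norm A g u (\<psi> t0 x) * level_jacobian A g u (\<psi> t0) x) (at t0)"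
proof -
  have xc: "x \<in> carrier A" using x N by auto
  define c where "c = chart_at A x"
  \<comment> \<open>The chart is fixed at time \<open>t0\<close>. The chart that
    \<open>level_jacobian\<close> uses at \<open>\<psi> t x\<close> may jump with \<open>t\<close>,
    but the formula \<open>J\<close> holds in \<open>d\<close> as long as the orbit stays in its
    domain.\<close>
  define d where "d = chart_at A (\<psi> t0 x)"
  have c: "c \<in> A" "x \<in> fst c" using chart_at[OF xc] by (auto simp: c_def)
  have pc: "\<psi> t0 x \<in> carrier A" by (rule \<psi>_carrier[OF t0 x])
  have d: "d \<in> A" "\<psi> t0 x \<in> fst d" using chart_at[OF pc] by (auto simp: d_def)
  note dD = chartD[OF d(1)]
  obtain k e where e: "\<And>i. i \<noteq> k \<Longrightarrow> differential u c x (e i) = 0" "minor_det k (gram g c x e) = 1"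
    "\<And>\<tau> N f d. shift_map \<tau> N f \<Longrightarrow> x \<in> N \<Longrightarrow> d \<in> A \<Longrightarrow> f x \<in> fst d \<Longrightarrow>
      level_jacobian A g u f x = sqrt (minor_det k (gram g d (f x) (\<lambda>i. deriv_rep f c d x (e i))))"
    using level_jacobian_eq_deriv_rep[OF xc c] by blast
  \<comment> \<open>The columns of the matrix to which Liouville's formula applies; the vacant index
    \<open>k\<close> is filled by \<open>Y\<close>, which obeys the same equation as the other
    columns.\<close>
  define v where "v j t = (if j = k then Y d (\<psi> t x) else deriv_rep (\<psi> t) c d x (e j))" for j t
  let ?V = "\<lambda>t. \<bar>det (cols (\<lambda>j. v j t))\<bar>"
  have J: "level_jacobian A g u (\<psi> t) x = grad_norm A g u (\<psi> t x) * sqrt (det (g d (\<psi> t x))) * ?V t"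
    if t: "t \<in> I" "\<psi> t x \<in> fst d" for t
  proof -
    note sm = shift_map_flow[OF t(1)]
    have "(\<lambda>i. deriv_rep (\<psi> t) c d x (e i))(k := Y d (\<psi> t x)) = (\<lambda>j. v j t)"
      by (auto simp: v_def)
    then have "minor_det k (gram g d (\<psi> t x) (\<lambda>i. deriv_rep (\<psi> t) c d x (e i))) =
        (grad_norm A g u (\<psi> t x))\<^sup>2 * det (g d (\<psi> t x)) * (det (cols (\<lambda>j. v j t)))\<^sup>2"
      using minor_det_gram[OF d(1) t(2), of k "\<lambda>i. deriv_rep (\<psi> t) c d x (e i)"]
        differential_deriv_rep[OF sm x c d(1) t(2)] e(1) by simp
    then show ?thesis
      using e(3)[OF sm x d(1) t(2)] gn_pos[OF d(1) t(2)] by (simp add: real_sqrt_mult)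
  qed
  have F: "integrand q x t = weight q d (snd d (\<psi> t x)) * ?V t" if t: "t \<in> I" "\<psi> t x \<in> fst d" for t
  proof -
    let ?n = "grad_norm A g u (\<psi> t x)"
    have n: "?n > 0" by (rule gn_pos[OF d(1) t(2)])
    then have "?n powr q = ?n powr (q - 1) * ?n" by (simp add: powr_diff)
    then show ?thesis
      unfolding integrand_def J[OF t] weight_def dD(3)[OF t(2)] by simp
  qed
  let ?z = "snd d (\<psi> t0 x)"
  have zD: "?z \<in> snd d ` fst d" using d by auto
  let ?tr = "\<Sum>i\<in>UNIV. DY d ?z (axis i 1) $ i"
  obtain \<omega>' where \<omega>': "(weight q d has_derivative \<omega>') (at ?z)"
    using weight_differentiable[OF d] by blast
  have dv: "(v j has_vector_derivative DY d ?z (v j t0)) (at t0)" for j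
  proof (cases "j = k")
    case True
    then show ?thesis using Y_along_orbit[OF x t0 d] by (simp add: v_def[abs_def])
  next
    case False
    then show ?thesis using variational_equation[OF x c t0 d] by (simp add: v_def[abs_def])
  qed
  have dV: "(?V has_real_derivative ?tr * ?V t0) (at t0)"
    by (rule abs_has_real_derivative_proportional[OF det_linear_ode[OF dv linear_DY[OF d(1) zD]]])
  have d\<omega>: "((\<lambda>t. weight q d (snd d (\<psi> t x))) has_real_derivative \<omega>' (Y d (\<psi> t0 x))) (at t0)"
    using has_derivative_along_orbit[OF x t0 d \<omega>'] by (simp add: has_real_derivative_iff_has_vector_derivative)
  have "((\<lambda>t. weight q d (snd d (\<psi> t x)) * ?V t) has_real_derivative
      \<omega>' (Y d (\<psi> t0 x)) * ?V t0 + ?tr * ?V t0 * weight q d ?z) (at t0)"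
    by (rule DERIV_mult'[OF d\<omega> dV, THEN DERIV_cong]) simp
  moreover have "\<omega>' (Y d (\<psi> t0 x)) * ?V t0 + ?tr * ?V t0 * weight q d ?z =
      q_laplacian A g q u (\<psi> t0 x) / grad_norm A g u (\<psi> t0 x) * level_jacobian A g u (\<psi> t0) x"
    unfolding J[OF t0 d(2)] q_laplacian_eq[OF pc d_def \<omega>']
    using gn_pos[OF d] det_g_pos[OF d] by (simp add: field_simps)
  ultimately have 1: "((\<lambda>t. weight q d (snd d (\<psi> t x)) * ?V t) has_real_derivative
      q_laplacian A g q u (\<psi> t0 x) / grad_norm A g u (\<psi> t0 x) * level_jacobian A g u (\<psi> t0) x) (at t0)" by simp
  \<comment> \<open>The product formula holds at all times in this open set, so it has the same
    derivative at \<open>t0\<close> as the integrand.\<close>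
  have "stay x (fst d) \<in> {S. open S \<and> t0 \<in> S}"
    using open_stay[OF x dD(1)] t0 d by (simp add: stay_def)
  then have ev: "eventually (\<lambda>t. weight q d (snd d (\<psi> t x)) * ?V t = integrand q x t) (nhds t0)"
    unfolding eventually_nhds using F by (intro exI[of _ "stay x (fst d)"]) (auto simp: stay_def)
  show ?thesis using DERIV_cong_ev[OF refl ev refl] 1 by blast
qed

section \<open>Integration over shifted level sets and differentiation of nu\<close>

lemma nu_shift:
  assumes S: "level_set A u s \<noteq> {}" "level_set A u s \<subseteq> N" and t: "t \<in> I"
    and onto: "\<psi> t ` level_set A u s = level_set A u (s + t)"
    and int: "integrable (level_measure A g u (s + t)) (\<lambda>x. grad_norm A g u x powr (q - 1))"
  shows "integrable (level_measure A g u s) (\<lambda>x. integrand q x t)"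
    and "nu A g q u (s + t) = (\<integral>x. integrand q x t \<partial>level_measure A g u s)"
proof -
  let ?\<mu> = "level_measure A g u s" and ?R = "restrict_space borel (level_set A u (s + t))"
  have bij: "bij_betw (\<psi> t) (level_set A u s) (level_set A u (s + t))"
    unfolding bij_betw_def
  proof (intro conjI onto inj_onI)
    fix x y assume xy: "x \<in> level_set A u s" "y \<in> level_set A u s" and eq: "\<psi> t x = \<psi> t y"
    show "x = y" by (rule flow_injective[OF t subsetD[OF S(2) xy(1)] subsetD[OF S(2) xy(2)] eq])
  qed
  note im = level_measure_image[OF shift_map_flow[OF t] S bij]
  have S': "level_set A u (s + t) \<noteq> {}" using onto S(1) by auto
  let ?h = "\<lambda>x. grad_norm A g u x powr (q - 1)"
  have "?h \<in> borel_measurable (level_measure A g u (s + t))" using int by simp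
  then have h: "?h \<in> borel_measurable ?R"
    using measurable_cong_sets[OF sets_level_measure[OF S'] refl] by blast
  have m1: "\<psi> t \<in> density ?\<mu> (\<lambda>x. ennreal (level_jacobian A g u (\<psi> t) x)) \<rightarrow>\<^sub>M ?R"
    using im(1) by simp
  have m2: "(\<lambda>x. ?h (\<psi> t x)) \<in> borel_measurable ?\<mu>" by (rule measurable_compose[OF im(1) h])
  have J: "AE x in ?\<mu>. 0 \<le> level_jacobian A g u (\<psi> t) x"
  proof (rule AE_I2)
    fix x assume "x \<in> space ?\<mu>"
    then have "x \<in> N" using S by (auto simp: space_level_measure[OF S(1)])
    then show "0 \<le> level_jacobian A g u (\<psi> t) x" by (rule level_jacobian_nonneg[OF shift_map_flow[OF t]])
  qed
  show "integrable ?\<mu> (\<lambda>x. integrand q x t)"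
    using int unfolding im(3) integrable_distr_eq[OF m1 h] integrable_density[OF m2 im(2) J]
    by (simp add: integrand_def)
  show "nu A g q u (s + t) = (\<integral>x. integrand q x t \<partial>?\<mu>)"
    unfolding nu_def im(3) integral_distr[OF m1 h] integral_density[OF m2 im(2) J]
    by (simp add: integrand_def)
qed

lemma nu_has_derivative:
  assumes S: "level_set A u s \<noteq> {}" "level_set A u s \<subseteq> N"
    and int: "\<And>t. t \<in> u ` carrier A \<Longrightarrow> integrable (level_measure A g u t) (\<lambda>x. grad_norm A g u x powr (q - 1))"
    and onto: "\<forall>\<^sub>F t in nhds 0. \<psi> t ` level_set A u s = level_set A u (s + t)"
    and eps: "0 < \<epsilon>" "\<epsilon> \<le> \<delta>"
    and dom: "\<And>t x. t \<in> {-\<epsilon><..<\<epsilon>} \<Longrightarrow> x \<in> level_set A u s \<Longrightarrow>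
      \<bar>q_laplacian A g q u (\<psi> t x) / grad_norm A g u (\<psi> t x) * level_jacobian A g u (\<psi> t) x\<bar> \<le> h x"
    and h: "integrable (level_measure A g u s) h"
  shows "(nu A g q u has_real_derivative
    (\<integral>x. q_laplacian A g q u x / grad_norm A g u x \<partial>level_measure A g u s)) (at s)"
proof -
  let ?\<mu> = "level_measure A g u s" and ?S = "level_set A u s"
  let ?f = "\<lambda>x. q_laplacian A g q u x / grad_norm A g u x"
  note sp = space_level_measure[OF S(1)]
  obtain \<eta> where \<eta>: "\<eta> > 0" "\<And>t. \<bar>t\<bar> < \<eta> \<Longrightarrow> \<psi> t ` ?S = level_set A u (s + t)"
    using onto unfolding eventually_nhds_metric by (auto simp: dist_real_def)
  \<comment> \<open>For times below \<open>r\<close> both the surjectivity onto the shifted level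
    set and the domination are available.\<close>
  define r where "r = min \<eta> \<epsilon>"
  have r: "r > 0" "\<And>t. \<bar>t\<bar> < r \<Longrightarrow> \<psi> t ` ?S = level_set A u (s + t)"
    "\<And>t. \<bar>t\<bar> < r \<Longrightarrow> t \<in> {-\<epsilon><..<\<epsilon>}" "\<And>t. \<bar>t\<bar> < r \<Longrightarrow> t \<in> I"
    using \<eta> eps by (auto simp: r_def)
  have nu: "integrable ?\<mu> (\<lambda>x. integrand q x t)" "nu A g q u (s + t) = (\<integral>x. integrand q x t \<partial>?\<mu>)"
    if t: "\<bar>t\<bar> < r" for t
  proof -
    have "level_set A u (s + t) \<noteq> {}" using r(2)[OF t] S(1) by auto
    then obtain x where "x \<in> carrier A" "s + t = u x" by (auto simp: level_set_def)
    then have "s + t \<in> u ` carrier A" by (rule rev_image_eqI)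
    from nu_shift[OF S r(4)[OF t] r(2)[OF t] int[OF this]]
    show "integrable ?\<mu> (\<lambda>x. integrand q x t)" "nu A g q u (s + t) = (\<integral>x. integrand q x t \<partial>?\<mu>)" .
  qed
  have 0: "\<bar>0\<bar> < r" using r(1) by simp
  have d0: "(integrand q x has_real_derivative ?f x) (at 0)" if "x \<in> ?S" for x
  proof -
    have x: "x \<in> N" using that S by auto
    have "level_jacobian A g u (\<psi> 0) x = 1"
      using level_jacobian_ident[OF shift_map_flow[OF r(4)[OF 0]] x \<psi>_0] .
    then show ?thesis using integrand_has_derivative[OF x r(4)[OF 0], of q] \<psi>_0[OF x] by simp
  qed
  \<comment> \<open>By the mean value inequality the bound on the derivative in \<open>t\<close>,
    uniform over the interval, dominates every difference quotient.\<close>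
  have quot: "\<bar>(integrand q x t - integrand q x 0) / t\<bar> \<le> h x" if x: "x \<in> ?S" and t: "\<bar>t\<bar> < r" "t \<noteq> 0" for x t
  proof -
    have xN: "x \<in> N" using x S by auto
    have "norm (integrand q x t - integrand q x 0) \<le> h x * norm (t - 0)"
    proof (rule field_differentiable_bound[of "{-r<..<r}"])
      fix z assume z: "z \<in> {-r<..<r}"
      then have z': "\<bar>z\<bar> < r" by auto
      show "(integrand q x has_field_derivative q_laplacian A g q u (\<psi> z x) / grad_norm A g u (\<psi> z x) * level_jacobian A g u (\<psi> z) x)
          (at z within {-r<..<r})"
        by (rule has_field_derivative_at_within[OF integrand_has_derivative[OF xN r(4)[OF z']]])
      show "norm (q_laplacian A g q u (\<psi> z x) / grad_norm A g u (\<psi> z x) * level_jacobian A g u (\<psi> z) x) \<le> h x"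
        using dom[OF r(3)[OF z'] x] by simp
    qed (use t r(1) in auto)
    then show ?thesis using t by (simp add: abs_divide divide_le_eq)
  qed
  have "((\<lambda>t. (nu A g q u (s + t) - nu A g q u s) / t) \<longlongrightarrow> (\<integral>x. ?f x \<partial>?\<mu>)) (at 0)"
    unfolding tendsto_at_iff_sequentially comp_def
  proof (intro allI impI)
    fix X :: "nat \<Rightarrow> real" assume X: "\<forall>i. X i \<in> UNIV - {0}" "X \<longlonglongrightarrow> 0"
    have "eventually (\<lambda>i. \<bar>X i\<bar> < r) sequentially"
      using order_tendstoD(2)[OF tendsto_rabs_zero[OF X(2)] r(1)] .
    then obtain n where n: "\<And>i. i \<ge> n \<Longrightarrow> \<bar>X i\<bar> < r" by (auto simp: eventually_sequentially)
    \<comment> \<open>Dominated convergence asks for the bound at every index, so the finitely many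
      terms outside the radius \<open>r\<close> are dropped and restored at the end by
      \<open>LIMSEQ_offset\<close>.\<close>
    define Z where "Z i = X (i + n)" for i
    have Z: "\<bar>Z i\<bar> < r" "Z i \<noteq> 0" for i using n X(1) by (auto simp: Z_def)
    have Z0: "Z \<longlonglongrightarrow> 0" unfolding Z_def using X(2) by (rule LIMSEQ_ignore_initial_segment)
    define G where "G i x = (integrand q x (Z i) - integrand q x 0) / Z i" for i x
    have Gm: "integrable ?\<mu> (G i)" for i
      unfolding G_def by (intro integrable_divide_zero Bochner_Integration.integrable_diff nu(1) Z(1) 0)
    have Glim: "(\<lambda>i. G i x) \<longlonglongrightarrow> ?f x" if "x \<in> space ?\<mu>" for x
    proof -
      have "((\<lambda>t. (integrand q x (0 + t) - integrand q x 0) / t) \<longlongrightarrow> ?f x) (at 0)"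
        using d0[of x] that sp by (simp add: DERIV_def)
      then show ?thesis
        unfolding tendsto_at_iff_sequentially using Z(2) Z0 by (simp add: G_def[abs_def] o_def)
    qed
    \<comment> \<open>Measurable as the pointwise limit of the measurable difference quotients; no
      formula for the q-Laplacian has to be inspected.\<close>
    have fm: "?f \<in> borel_measurable ?\<mu>"
      by (rule borel_measurable_LIMSEQ_real[OF Glim]) (use Gm in auto)
    have "(\<lambda>i. \<integral>x. G i x \<partial>?\<mu>) \<longlonglongrightarrow> (\<integral>x. ?f x \<partial>?\<mu>)"
    proof (rule integral_dominated_convergence[OF fm _ h])
      show "G i \<in> borel_measurable ?\<mu>" for i using Gm by auto
      show "AE x in ?\<mu>. (\<lambda>i. G i x) \<longlonglongrightarrow> ?f x" using Glim by (rule AE_I2)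
      show "AE x in ?\<mu>. norm (G i x) \<le> h x" for i
        using quot[OF _ Z] sp by (intro AE_I2) (simp add: G_def)
    qed
    moreover have "(\<integral>x. G i x \<partial>?\<mu>) = (nu A g q u (s + Z i) - nu A g q u s) / Z i" for i
      using nu(2)[OF Z(1)[of i]] nu(2)[OF 0] Bochner_Integration.integral_diff[OF nu(1)[OF Z(1)[of i]] nu(1)[OF 0]]
      by (simp add: G_def)
    ultimately have "(\<lambda>i. (nu A g q u (s + X (i + n)) - nu A g q u s) / X (i + n)) \<longlonglongrightarrow> (\<integral>x. ?f x \<partial>?\<mu>)"
      by (simp add: Z_def)
    then show "(\<lambda>i. (nu A g q u (s + X i) - nu A g q u s) / X i) \<longlonglongrightarrow> (\<integral>x. ?f x \<partial>?\<mu>)"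
      by (rule LIMSEQ_offset)
  qed
  then show ?thesis by (simp add: DERIV_def)
qed

end

theorem proposition4p1:
  fixes A :: "('m::{t2_space,second_countable_topology}, 'n::finite) chart set"
    and g :: "('m, 'n) metric"
    and u :: "'m \<Rightarrow> real"
    and q s \<delta> \<epsilon> :: real
    and N :: "'m set"
    and \<psi> :: "real \<Rightarrow> 'm \<Rightarrow> 'm"
    and h :: "'m \<Rightarrow> real"
  assumes q: "q > 1"
    and M: "riemannian_manifold A g"
    and u: "Ck_function 2 A u"
    and grad_pos: "\<forall>x\<in>carrier A. grad_norm A g u x > 0"
    and s: "s \<in> u ` carrier A"
    and nu_finite: "\<forall>t\<in>u ` carrier A.
      integrable (level_measure A g u t) (\<lambda>x. grad_norm A g u x powr (q - 1))"
    and flow: "local_flow A (Y_field g u) \<delta> N \<psi>"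
    and near: "level_set A u s \<subseteq> N"
    and onto: "\<forall>\<^sub>F t in nhds 0. \<psi> t ` level_set A u s = level_set A u (s + t)"
    and eps: "0 < \<epsilon>" "\<epsilon> \<le> \<delta>"
    and dominated: "\<forall>t\<in>{-\<epsilon><..<\<epsilon>}. \<forall>x\<in>level_set A u s.
      \<bar>q_laplacian A g q u (\<psi> t x) / grad_norm A g u (\<psi> t x) * level_jacobian A g u (\<psi> t) x\<bar> \<le> h x"
    and h_integrable: "\<forall>t\<in>{-\<epsilon><..<\<epsilon>}. integrable (level_measure A g u (s + t)) h"
  shows "(nu A g q u has_real_derivative
      (\<integral>x. q_laplacian A g q u x / grad_norm A g u x \<partial>level_measure A g u s)) (at s)"
proof -
  interpret level_flow A g u \<delta> N \<psi>
    by unfold_locales (use M u grad_pos flow in auto)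
  have S: "level_set A u s \<noteq> {}" using s by (auto simp: level_set_def)
  have h: "integrable (level_measure A g u s) h"
    using bspec[OF h_integrable, of 0] eps by simp
  show ?thesis
    by (rule nu_has_derivative[OF S near _ onto eps _ h]) (use nu_finite dominated in blast)+
qed

end
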